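(* Let $$F_1={}_1F_1(m\kappa+1;\,m+1;\,m\eta),\qquad F_2={}_2F_1(m\kappa+1,\,m\kappa+1;\,m+1;\,\eta).$$ As $m\to\infty$, for $j=1,2$, $$F_j=C_m\,\psi_j(t_j)\,e^{-\mathrm i\omega_j/2}\,\bigl|2\pi m\,\varphi_j''(t_j)\bigr|^{-1/2}\exp\{-m\varphi_j(t_j)\}\,(1+o(1)),$$ and the convergence $o(1)\to0$ holds uniformly with respect to $(\kappa,\eta)\in\Omega_{j\delta}$, for any $\delta>0$.
   Context: $m>0$ and $\kappa>1$ are real, $\eta\in\mathbb C$. ${}_1F_1$ and ${}_2F_1$ are the scalar confluent and Gauss hypergeometric functions (${}_2F_1$ being the principal branch, $|\arg(1-\eta)|<\pi$). Notation: $$C_m=\frac{\Gamma(m+1)\,\Gamma(m(\kappa-1)+1)}{\Gamma(m\kappa+1)},$$ $$\varphi_1(t)=-\eta t-\kappa\ln t+(\kappa-1)\ln(t-1),\qquad \varphi_2(t)=-\kappa\ln\bigl(t/(1-\eta t)\bigr)+(\kappa-1)\ln(t-1),$$ $$\psi_1(t)=(t-1)^{-1},\qquad \psi_2(t)=(t-1)^{-1}(1-\eta t)^{-1},$$ $$t_1=\frac{1}{2\eta}\Bigl\{\eta-1+\sqrt{(\eta-1)^2+4\kappa\eta}\Bigr\},\qquad t_2=\frac{1}{2\eta(\kappa-1)}\Bigl\{-1+\sqrt{1+4\kappa(\kappa-1)\eta}\Bigr\}.$$ Square roots and logarithms are principal (cut along $(-\infty,0]$); for $j=1$, on the line $\operatorname{Re}\eta=1-2\kappa$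 the square root is defined by continuity from $\operatorname{Re}\eta>1-2\kappa$. Primes denote derivatives in $t$. $\omega_j=\arg\varphi_j''(t_j)+\pi$ and $\omega_{0j}=\arg(t_j-1)$, where the branches of $\arg$ are chosen so that $|\omega_j+2\omega_{0j}|\le\pi/2$. Parameter sets: $\Omega_{j\delta}=\Omega_\delta\cap\hat\Omega_{j\delta}$, where $\Omega_\delta$ is the set of pairs $(\kappa,\eta)\in\mathbb R\times\mathbb C$ with $\delta\le\kappa-1\le1/\delta$, $|\eta|\le1/\delta$ and $\inf_{y\in(-\infty,0)}|\eta-y|\ge\delta$; $\hat\Omega_{1\delta}$ is the set of pairs with $\operatorname{Re}\eta\ge-2\kappa+1$; $\hat\Omega_{2\delta}$ is the set of pairs with $\inf_{y\in(1,\infty)}|\eta-y|\ge\delta$ ($\kappa$ unconstrained). *)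

theory Defs
  imports "HOL-Complex_Analysis.Complex_Analysis"
begin

definition hyp1F1 :: "complex \<Rightarrow> complex \<Rightarrow> complex \<Rightarrow> complex" where
  "hyp1F1 a b z = eval_fps (fps_hypergeo [a] [b] 1) z"

(* Principal branch: the holomorphic function on the plane cut along [1, infinity) that extends
   the Gauss series.  It is unique (hyp2F1_eqI below); values on the cut are meaningless. *)
definition hyp2F1 :: "complex \<Rightarrow> complex \<Rightarrow> complex \<Rightarrow> complex \<Rightarrow> complex" where
  "hyp2F1 a b c =
     (SOME f. f holomorphic_on - (complex_of_real ` {1..}) \<and>
              (\<forall>z\<in>ball 0 1. f z = eval_fps (fps_hypergeo [a, b] [c] 1) z))"

lemma hyp2F1_eqI:
  assumes f: "f holomorphic_on - (complex_of_real ` {1..})"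
    and f_ser: "\<And>z. z \<in> ball 0 1 \<Longrightarrow> f z = eval_fps (fps_hypergeo [a, b] [c] 1) z"
    and z: "z \<notin> complex_of_real ` {1..}"
  shows "hyp2F1 a b c z = f z"
proof -
  let ?S = "- (complex_of_real ` {1..})"
  let ?P = "\<lambda>f. f holomorphic_on ?S \<and>
              (\<forall>z\<in>ball 0 1. f z = eval_fps (fps_hypergeo [a, b] [c] 1) z)"
  have g: "?P (hyp2F1 a b c)"
    unfolding hyp2F1_def by (rule someI[of ?P f]) (use f f_ser in auto)
  have "closed (complex_of_real ` {1..})"
    by (rule closed_slot_right)
  then have op: "open ?S" by (simp add: open_Compl)
  have conn: "connected ?S"
    by (intro starlike_imp_connected starlike_slotted_complex_plane_right)
  have sub: "ball 0 1 \<subseteq> ?S" by auto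
  show ?thesis
    by (rule analytic_continuation_open[of "ball 0 1" ?S]) (use op conn sub g f f_ser z in auto)
qed

definition C_const :: "real \<Rightarrow> real \<Rightarrow> real" where
  "C_const m \<kappa> = Gamma (m + 1) * Gamma (m * (\<kappa> - 1) + 1) / Gamma (m * \<kappa> + 1)"

definition phi1 :: "real \<Rightarrow> complex \<Rightarrow> complex \<Rightarrow> complex" where
  "phi1 \<kappa> \<eta> t = - \<eta> * t - of_real \<kappa> * Ln t + of_real (\<kappa> - 1) * Ln (t - 1)"

definition phi2 :: "real \<Rightarrow> complex \<Rightarrow> complex \<Rightarrow> complex" where
  "phi2 \<kappa> \<eta> t = - of_real \<kappa> * Ln (t / (1 - \<eta> * t)) + of_real (\<kappa> - 1) * Ln (t - 1)"

definition psi1 :: "complex \<Rightarrow> complex" where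
  "psi1 t = inverse (t - 1)"

definition psi2 :: "complex \<Rightarrow> complex \<Rightarrow> complex" where
  "psi2 \<eta> t = inverse (t - 1) * inverse (1 - \<eta> * t)"

(* On the line Re \<eta> = 1 - 2 \<kappa> the radicand is a negative real number, so the principal root is
   replaced there by its limit from the right of the line. *)
definition root1 :: "real \<Rightarrow> complex \<Rightarrow> complex" where
  "root1 \<kappa> \<eta> =
     (if Re \<eta> = 1 - 2 * \<kappa>
      then Lim (at \<eta> within {z. Re z > 1 - 2 * \<kappa>})
             (\<lambda>z. csqrt ((z - 1)\<^sup>2 + 4 * of_real \<kappa> * z))
      else csqrt ((\<eta> - 1)\<^sup>2 + 4 * of_real \<kappa> * \<eta>))"

definition t1 :: "real \<Rightarrow> complex \<Rightarrow> complex" where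
  "t1 \<kappa> \<eta> = 1 / (2 * \<eta>) * (\<eta> - 1 + root1 \<kappa> \<eta>)"

definition t2 :: "real \<Rightarrow> complex \<Rightarrow> complex" where
  "t2 \<kappa> \<eta> = 1 / (2 * \<eta> * of_real (\<kappa> - 1)) *
     (- 1 + csqrt (1 + 4 * of_real \<kappa> * of_real (\<kappa> - 1) * \<eta>))"

definition omega_branch :: "(complex \<Rightarrow> complex) \<Rightarrow> complex \<Rightarrow> real \<Rightarrow> real \<Rightarrow> bool" where
  "omega_branch \<phi> t \<omega> \<omega>0 \<longleftrightarrow>
     is_Arg (deriv (deriv \<phi>) t) (\<omega> - pi) \<and> is_Arg (t - 1) \<omega>0 \<and> \<bar>\<omega> + 2 * \<omega>0\<bar> \<le> pi / 2"

definition omega :: "(complex \<Rightarrow> complex) \<Rightarrow> complex \<Rightarrow> real" where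
  "omega \<phi> t = (SOME \<omega>. \<exists>\<omega>0. omega_branch \<phi> t \<omega> \<omega>0)"

(* The condition leaves \<omega> free modulo 4 pi, which does not affect exp (- i \<omega> / 2). *)
lemma exp_omega_eq:
  assumes "omega_branch \<phi> t \<omega> \<omega>0" "deriv (deriv \<phi>) t \<noteq> 0" "t \<noteq> 1"
  shows "exp (- \<i> * of_real (omega \<phi> t) / 2) = exp (- \<i> * of_real \<omega> / 2)"
proof -
  have ex: "\<exists>v0. omega_branch \<phi> t (omega \<phi> t) v0"
    unfolding omega_def by (rule someI_ex) (use assms(1) in blast)
  then obtain v0 where v: "omega_branch \<phi> t (omega \<phi> t) v0" by blast
  define v where "v = omega \<phi> t"
  have eqI: "\<exists>k::int. r - s = 2 * pi * k" if "is_Arg z r" "is_Arg z s" "z \<noteq> 0" for z r s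
  proof -
    have "exp (\<i> * of_real r) = exp (\<i> * of_real s)"
      using that unfolding is_Arg_def by (metis mult_cancel_left norm_eq_zero of_real_eq_0_iff)
    then obtain k :: int where "\<i> * of_real r = \<i> * of_real s + (of_int (2 * k) * pi) * \<i>"
      unfolding exp_eq by auto
    then have "r = s + 2 * k * pi"
      by (simp add: complex_eq_iff)
    then show ?thesis by (intro exI[of _ k]) simp
  qed
  obtain k :: int where k: "v - \<omega> = 2 * pi * k"
    using eqI[of _ "v - pi" "\<omega> - pi"] v assms unfolding omega_branch_def v_def by auto
  obtain l :: int where l: "v0 - \<omega>0 = 2 * pi * l"
    using eqI[of "t - 1" v0 \<omega>0] v assms unfolding omega_branch_def by auto
  have "\<bar>(v + 2 * v0) - (\<omega> + 2 * \<omega>0)\<bar> \<le> pi"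
    using v assms(1) unfolding omega_branch_def v_def by linarith
  also have "(v + 2 * v0) - (\<omega> + 2 * \<omega>0) = 2 * pi * of_int (k + 2 * l)"
    using k l by (simp add: algebra_simps)
  finally have "2 * pi * \<bar>of_int (k + 2 * l) :: real\<bar> \<le> 2 * pi * (1 / 2)"
    by (simp add: abs_mult)
  then have "\<bar>of_int (k + 2 * l) :: real\<bar> \<le> 1 / 2"
    using mult_le_cancel_left_pos[of "2 * pi"] pi_gt_zero by simp
  then have "k + 2 * l = 0" by linarith
  then have "k = - (2 * l)" by linarith
  then have "v = \<omega> - 4 * pi * l" using k by (simp add: algebra_simps)
  then have "- \<i> * of_real v / 2 = - \<i> * of_real \<omega> / 2 + (of_int (2 * l) * pi) * \<i>"
    by (simp add: complex_eq_iff algebra_simps)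
  then show ?thesis
    unfolding v_def[symmetric] exp_eq by blast
qed

definition F1 :: "real \<Rightarrow> real \<Rightarrow> complex \<Rightarrow> complex" where
  "F1 m \<kappa> \<eta> = hyp1F1 (of_real (m * \<kappa> + 1)) (of_real (m + 1)) (of_real m * \<eta>)"

definition F2 :: "real \<Rightarrow> real \<Rightarrow> complex \<Rightarrow> complex" where
  "F2 m \<kappa> \<eta> = hyp2F1 (of_real (m * \<kappa> + 1)) (of_real (m * \<kappa> + 1)) (of_real (m + 1)) \<eta>"

definition laplace_main ::
    "real \<Rightarrow> real \<Rightarrow> (complex \<Rightarrow> complex) \<Rightarrow> (complex \<Rightarrow> complex) \<Rightarrow> complex \<Rightarrow> complex" where
  "laplace_main m \<kappa> \<phi> \<psi> t =
     of_real (C_const m \<kappa>) * \<psi> t * exp (- \<i> * of_real (omega \<phi> t) / 2) *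
     of_real (cmod (2 * of_real pi * of_real m * deriv (deriv \<phi>) t) powr (- 1 / 2)) *
     exp (- of_real m * \<phi> t)"

definition Omega :: "real \<Rightarrow> (real \<times> complex) set" where
  "Omega \<delta> = {(\<kappa>, \<eta>). \<delta> \<le> \<kappa> - 1 \<and> \<kappa> - 1 \<le> 1 / \<delta> \<and> cmod \<eta> \<le> 1 / \<delta> \<and>
                (INF y\<in>{..<(0::real)}. cmod (\<eta> - of_real y)) \<ge> \<delta>}"

definition Omega1 :: "real \<Rightarrow> (real \<times> complex) set" where
  "Omega1 \<delta> = Omega \<delta> \<inter> {(\<kappa>, \<eta>). Re \<eta> \<ge> - 2 * \<kappa> + 1}"

definition Omega2 :: "real \<Rightarrow> (real \<times> complex) set" where
  "Omega2 \<delta> = Omega \<delta> \<inter> {(\<kappa>, \<eta>). (INF y\<in>{(1::real)<..}. cmod (\<eta> - of_real y)) \<ge> \<delta>}"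

end

theory Submission
  imports Defs "HOL-Real_Asymp.Real_Asymp"
begin

text \<open>
  No contour integral is used: the asymptotics are read off from the hypergeometric differential
  equations. With \<open>D = \<eta> d/d\<eta>\<close> for \<open>j = 1\<close> and \<open>D = \<eta> (1 - \<eta>) d/d\<eta>\<close> for \<open>j = 2\<close> they read
  \<open>D\<^sup>2F + P DF + Q F = 0\<close> with large coefficients \<open>P\<close>, \<open>Q\<close>. As a function of \<open>\<eta>\<close> the saddle point
  term is \<open>M (1 + o(1))\<close>, where \<open>M\<close> is the Liouville--Green approximation to the solution that equals
  1 at \<open>\<eta> = 0\<close>; the factor \<open>1 + o(1)\<close> depends on \<open>m\<close> and \<open>\<kappa>\<close> only and comes from Stirling's formula
  for \<open>C\<^sub>m\<close>.

  The quotient \<open>h = F/M\<close> satisfies \<open>D\<^sup>2h + (m R + O(1)) Dh + O(\<eta>) h = 0\<close>, where \<open>R\<close> is the square root in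
  the formula for \<open>t\<^sub>j\<close>. Along a path from 0 on which \<open>D\<close> is \<open>r d/dr\<close>, that is a ray in \<open>\<eta>\<close> for \<open>j = 1\<close>
  and a ray in \<open>\<eta>/(1 - \<eta>)\<close> for \<open>j = 2\<close>, the choice of the square root gives \<open>Re R \<ge> 0\<close>; this is
  where \<open>Re \<eta> \<ge> 1 - 2\<kappa>\<close> enters. So no solution of the equation for \<open>Dh\<close> grows, and \<open>h - 1 = O(1/m)\<close>.
\<close>

section \<open>Liouville--Green estimate along a path\<close>

text \<open>At 0 both equations have a regular singular point with exponents 0 and -m, and
  \<open>F\<close> is the solution regular there. Starting every path at 0 therefore fixes
  \<open>F\<close> by its value 1, and no connection coefficients have to be found. The
  approximation \<open>M\<close> comes from writing \<open>D log M = m u + l\<close>. Order m^2 of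
  the equation is a quadratic for \<open>u\<close>, whose discriminant is the square of the root
  \<open>R\<close> (for j = 1, u is \<eta> times the saddle point); order m is a linear equation for
  \<open>l\<close> with leading coefficient \<open>R\<close>; what is left does not depend on m. The
  obstacle is that Re \<open>R\<close> has no positive lower bound: for j = 1 and Re \<eta> = 1 -
  2\<kappa> the root becomes purely imaginary at the end of the ray. So \<open>Dh / R\<close> can be
  shown to be bounded but not small, and h - 1 = O(1/m) has to come from an exact cancellation in
  \<open>h + G/m\<close>. Uniformity costs little: \<open>R\<close> has no zero on the cut domains,
  so the remaining coefficients are continuous on a compact set determined by \<delta>.\<close>

text \<open>With D = r d/dr the hypotheses read Dh = R G and DG = -(m R + \<sigma>) G - e h. The
  bounds \<open>K * r\<close> compensate the singular factor 1/r. In \<open>C\<close> the first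
  summand comes from \<open>h + G/m\<close>, the second from subtracting \<open>G/m\<close>
  again.\<close>

lemma liouville_green_estimate:
  fixes h G R \<sigma> e :: "real \<Rightarrow> complex" and K m :: real
  defines "C \<equiv> K * (exp K + 1) + exp K"
  assumes K: "K > 0" and m: "m \<ge> 2 * C"
    and h_cont: "continuous_on {0..1} h" and G_cont: "continuous_on {0..1} G"
    and h0: "h 0 = 1" and G0: "G 0 = 0"
    and h_deriv: "\<And>r. 0 < r \<Longrightarrow> r < 1 \<Longrightarrow>
           (h has_vector_derivative (R r * G r / of_real r)) (at r)"
    and G_deriv: "\<And>r. 0 < r \<Longrightarrow> r < 1 \<Longrightarrow>
           (G has_vector_derivative ((- (of_real m * R r + \<sigma> r) * G r - e r * h r) / of_real r)) (at r)"
    and R_bound: "\<And>r. 0 < r \<Longrightarrow> r < 1 \<Longrightarrow> Re (R r) \<ge> 0"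
    and \<sigma>_bound: "\<And>r. 0 < r \<Longrightarrow> r < 1 \<Longrightarrow> cmod (\<sigma> r) \<le> K * r"
    and e_bound: "\<And>r. 0 < r \<Longrightarrow> r < 1 \<Longrightarrow> cmod (e r) \<le> K * r"
  shows "cmod (h 1 - 1) \<le> 2 * C / m"
proof -
  have C: "C > 0" unfolding C_def using K by (simp add: add_pos_pos)
  have m0: "m > 0" using m C by linarith
  have "\<exists>x0\<in>{0..1}. \<forall>y\<in>{0..1}. cmod (h y) \<le> cmod (h x0)"
    by (rule continuous_attains_sup) (auto intro!: continuous_intros h_cont)
  then obtain x0 where x0: "x0 \<in> {0..1}" "\<And>y. y \<in> {0..1} \<Longrightarrow> cmod (h y) \<le> cmod (h x0)"
    by blast
  \<comment> \<open>All bounds are first proved relative to the unknown maximum \<open>H\<close> of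
    |h|; it is absorbed at the end.\<close>
  define H where "H = cmod (h x0)"
  have hH: "cmod (h y) \<le> H" if "0 \<le> y" "y \<le> 1" for y
    using x0(2)[of y] that by (simp add: H_def)
  have H1: "H \<ge> 1" using hH[of 0] h0 by simp
  have G_bound: "cmod (G r) \<le> H * exp K" if r: "0 \<le> r" "r \<le> 1" for r
  proof (cases "r = 0")
    case True
    then show ?thesis using G0 H1 by simp
  next
    case False
    with r have r0: "0 < r" by simp
    have *: "cmod (G r) \<le> H * exp K + \<epsilon> * exp K" if \<epsilon>: "\<epsilon> > 0" for \<epsilon>
    proof -
      \<comment> \<open>A differentiable substitute for |G|, which need not be differentiable at
        zeros of \<open>G\<close>. The weight in \<open>f\<close> turns the Gronwall inequality N'
        \<le> K (N + H) into monotonicity.\<close>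
      define N where "N = (\<lambda>x. sqrt (G x \<bullet> G x + \<epsilon>\<^sup>2))"
      define f where "f = (\<lambda>x. (N x + H) * exp (- K * x))"
      have pos: "G x \<bullet> G x + \<epsilon>\<^sup>2 > 0" for x
        using \<epsilon> by (simp add: add_nonneg_pos)
      have GN: "cmod (G x) \<le> N x" for x
        unfolding N_def by (rule real_le_rsqrt) (simp add: dot_square_norm)
      have N0: "N x > 0" for x unfolding N_def using pos by simp
      have "f r \<le> f 0"
      proof (rule DERIV_nonpos_imp_decreasing_open[OF r(1)])
        fix x assume x: "0 < x" "x < r"
        then have x1: "0 < x" "x < 1" using r by auto
        define G' where "G' = (- (of_real m * R x + \<sigma> x) * G x - e x * h x) / of_real x"
        have dG: "(G has_vector_derivative G') (at x)"
          unfolding G'_def by (rule G_deriv) (use x1 in auto)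
        have "((\<lambda>x. G x \<bullet> G x) has_vector_derivative (G x \<bullet> G' + G' \<bullet> G x)) (at x)"
          by (rule bounded_bilinear.has_vector_derivative[OF bounded_bilinear_inner dG dG])
        then have d1: "((\<lambda>x. G x \<bullet> G x) has_real_derivative (2 * (G x \<bullet> G'))) (at x)"
          by (simp add: has_real_derivative_iff_has_vector_derivative inner_commute)
        have dN: "(N has_real_derivative (G x \<bullet> G') / N x) (at x)"
          unfolding N_def using pos[of x]
          by (auto intro!: derivative_eq_intros d1 simp: field_simps)
        have df: "(f has_real_derivative ((G x \<bullet> G') / N x - K * (N x + H)) * exp (- K * x)) (at x)"
          unfolding f_def by (auto intro!: derivative_eq_intros dN simp: algebra_simps)
        have "G' = - ((m / x) *\<^sub>R (R x * G x)) - (\<sigma> x / of_real x) * G x - (e x / of_real x) * h x"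
          using x1 by (simp add: G'_def scaleR_conv_of_real field_simps)
        then have split: "G x \<bullet> G' = - ((m / x) * (G x \<bullet> (R x * G x))) - G x \<bullet> ((\<sigma> x / of_real x) * G x)
              - G x \<bullet> ((e x / of_real x) * h x)"
          by (simp only: inner_diff_right inner_minus_right inner_scaleR_right)
        have "G x \<bullet> (R x * G x) = Re (R x) * (cmod (G x))\<^sup>2"
          unfolding cmod_power2 by (simp add: inner_complex_def power2_eq_square algebra_simps)
        \<comment> \<open>The only term with a factor m has a favourable sign and is dropped, so the
          bound on \<open>G\<close> is free of m.\<close>
        then have le1: "- ((m / x) * (G x \<bullet> (R x * G x))) \<le> 0"
          using m0 x1 R_bound[OF x1] by simp
        have le2: "- (G x \<bullet> ((\<sigma> x / of_real x) * G x)) \<le> N x * (K * N x)"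
        proof -
          have "- (G x \<bullet> ((\<sigma> x / of_real x) * G x)) \<le> cmod (G x) * cmod ((\<sigma> x / of_real x) * G x)"
            using Cauchy_Schwarz_ineq2[of "G x" "(\<sigma> x / of_real x) * G x"] by linarith
          also have "\<dots> \<le> N x * (K * N x)"
            unfolding norm_mult using \<sigma>_bound[OF x1] x1 K N0[of x]
            by (intro mult_mono GN) (auto simp: norm_divide field_simps)
          finally show ?thesis .
        qed
        have le3: "- (G x \<bullet> ((e x / of_real x) * h x)) \<le> N x * (K * H)"
        proof -
          have "- (G x \<bullet> ((e x / of_real x) * h x)) \<le> cmod (G x) * cmod ((e x / of_real x) * h x)"
            using Cauchy_Schwarz_ineq2[of "G x" "(e x / of_real x) * h x"] by linarith
          also have "\<dots> \<le> N x * (K * H)"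
            unfolding norm_mult using e_bound[OF x1] x1 K H1 N0[of x] hH[of x]
            by (intro mult_mono GN) (auto simp: norm_divide field_simps)
          finally show ?thesis .
        qed
        have "G x \<bullet> G' \<le> N x * (K * (N x + H))"
          using split le1 le2 le3 by (simp add: algebra_simps)
        then have "(G x \<bullet> G') / N x \<le> K * (N x + H)"
          using N0[of x] by (simp add: field_simps)
        then have "((G x \<bullet> G') / N x - K * (N x + H)) * exp (- K * x) \<le> 0"
          by (simp add: mult_nonpos_nonneg)
        with df show "\<exists>y. (f has_real_derivative y) (at x) \<and> y \<le> 0" by blast
      next
        show "continuous_on {0..r} f"
          unfolding f_def N_def
          by (intro continuous_intros continuous_on_subset[OF G_cont]) (use r in auto)
      qed
      then have "(N r + H) * exp (- K * r) \<le> \<epsilon> + H"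
        using \<epsilon> by (simp add: f_def N_def G0)
      then have "N r + H \<le> (\<epsilon> + H) * exp (K * r)"
        by (simp add: exp_minus field_simps)
      also have "\<dots> \<le> (\<epsilon> + H) * exp K"
        using \<epsilon> H1 K r by (intro mult_left_mono) (auto intro: mult_left_le)
      finally show ?thesis using GN[of r] H1 by (simp add: algebra_simps)
    qed
    show ?thesis
    proof (rule field_le_epsilon)
      fix d :: real assume "d > 0"
      then show "cmod (G r) \<le> H * exp K + d" using *[of "d / exp K"] by simp
    qed
  qed
  \<comment> \<open>In the derivative of \<^term>\<open>h r + G r / m\<close> the large terms \<^term>\<open>R r * G r\<close> cancel.\<close>
  define k where "k = (\<lambda>r. h r + G r / of_real m)"
  have k_bound: "cmod (k r - 1) \<le> K * H * (exp K + 1) / m" if r: "0 \<le> r" "r \<le> 1" for r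
  proof (cases "r = 0")
    case True
    then show ?thesis using G0 h0 H1 K m0 by (simp add: k_def)
  next
    case False
    with r have r0: "0 < r" by simp
    have "\<exists>x\<in>{0<..<r}. norm (k r - k 0) \<le> norm ((r - 0) *\<^sub>R (- (\<sigma> x * G x + e x * h x) / of_real (x * m)))"
    proof (rule mvt_general[OF r0])
      show "continuous_on {0..r} k"
        unfolding k_def using m0
        by (intro continuous_intros continuous_on_subset[OF G_cont] continuous_on_subset[OF h_cont])
          (use r in auto)
    next
      fix x assume x: "0 < x" "x < r"
      then have x1: "0 < x" "x < 1" using r by auto
      have "(k has_vector_derivative (R x * G x / of_real x +
              ((- (of_real m * R x + \<sigma> x) * G x - e x * h x) / of_real x) / of_real m)) (at x)"
        unfolding k_def by (intro derivative_intros h_deriv G_deriv x1)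
      also have "R x * G x / of_real x +
              ((- (of_real m * R x + \<sigma> x) * G x - e x * h x) / of_real x) / of_real m
            = - (\<sigma> x * G x + e x * h x) / of_real (x * m)"
        using x1 m0 by (simp add: field_simps)
      finally show "(k has_derivative (\<lambda>y. y *\<^sub>R (- (\<sigma> x * G x + e x * h x) / of_real (x * m)))) (at x)"
        by (simp add: has_vector_derivative_def)
    qed
    then obtain x where x: "0 < x" "x < r"
      and le: "norm (k r - k 0) \<le> norm ((r - 0) *\<^sub>R (- (\<sigma> x * G x + e x * h x) / of_real (x * m)))"
      by auto
    have x1: "0 < x" "x < 1" using x r by auto
    have "norm ((r - 0) *\<^sub>R (- (\<sigma> x * G x + e x * h x) / of_real (x * m)))
        = r * cmod (\<sigma> x * G x + e x * h x) / (x * m)"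
    proof -
      have "cmod (- (\<sigma> x * G x + e x * h x)) = cmod (\<sigma> x * G x + e x * h x)"
        by (rule norm_minus_cancel)
      then show ?thesis
        unfolding norm_scaleR norm_divide norm_of_real using r x m0 by simp
    qed
    also have "\<dots> \<le> 1 * (K * x * (H * exp K) + K * x * H) / (x * m)"
    proof (intro divide_right_mono mult_mono)
      show "cmod (\<sigma> x * G x + e x * h x) \<le> K * x * (H * exp K) + K * x * H"
        by (rule order_trans[OF norm_triangle_ineq], unfold norm_mult, intro add_mono mult_mono)
          (use G_bound[of x] \<sigma>_bound[OF x1] e_bound[OF x1] hH[of x] x1 K H1 in auto)
    qed (use r x m0 in auto)
    also have "\<dots> = K * H * (exp K + 1) / m"
      using x m0 by (simp add: field_simps)
    finally show ?thesis using le by (simp add: k_def h0 G0)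
  qed
  have h_bound: "cmod (h r - 1) \<le> H * C / m" if r: "0 \<le> r" "r \<le> 1" for r
  proof -
    have "cmod (h r - 1) = cmod ((k r - 1) - G r / of_real m)" by (simp add: k_def)
    also have "\<dots> \<le> cmod (k r - 1) + cmod (G r) / m"
      using norm_triangle_ineq4[of "k r - 1" "G r / of_real m"] m0 by (simp add: norm_divide)
    also have "\<dots> \<le> K * H * (exp K + 1) / m + H * exp K / m"
      by (intro add_mono k_bound divide_right_mono G_bound) (use r m0 in auto)
    also have "\<dots> = H * C / m" by (simp add: C_def add_divide_distrib algebra_simps)
    finally show ?thesis .
  qed
  \<comment> \<open>Since m \<ge> 2C the right side is at most 1 + H/2, which gives H \<le> 2 and
    explains the factor 2 in the conclusion.\<close>
  have "H \<le> 1 + H * C / m"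
    using h_bound[of x0] x0(1) norm_triangle_sub[of "h x0" 1] by (simp add: H_def)
  also have "H * C / m \<le> H * (1 / 2)"
    using H1 m m0 mult_left_mono[of "2 * C" m H] by (simp add: field_simps)
  finally have "H \<le> 2" by simp
  then have "H * C / m \<le> 2 * C / m"
    using C m0 by (intro divide_right_mono mult_right_mono) auto
  then show ?thesis using h_bound[of 1] by simp
qed

text \<open>
  \<open>M\<close> is the approximate solution and \<open>lam\<close> its logarithmic derivative; \<open>e R\<close> is the residual of \<open>M\<close>
  in the equation, divided by \<open>M\<close>. The estimate is applied to \<open>h = F/M\<close> and \<open>G = Dh/R\<close>.
\<close>

lemma wkb_along_path:
  fixes F DF M R lam P Q g \<sigma> e :: "complex \<Rightarrow> complex" and \<gamma> :: "real \<Rightarrow> complex" and K m :: real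
  defines "C \<equiv> K * (exp K + 1) + exp K"
  assumes K: "K > 0" and m: "m \<ge> 2 * C"
    and \<gamma>0: "\<gamma> 0 = 0" and \<gamma>_cont: "continuous_on {0..1} \<gamma>"
    and \<gamma>_deriv: "\<And>r. 0 < r \<Longrightarrow> r < 1 \<Longrightarrow> (\<gamma> has_vector_derivative (g (\<gamma> r) / of_real r)) (at r)"
    and F_deriv: "\<And>z. z \<in> \<gamma> ` {0..1} \<Longrightarrow> (F has_field_derivative F' z) (at z)"
    and DF_deriv: "\<And>z. z \<in> \<gamma> ` {0..1} \<Longrightarrow> (DF has_field_derivative DF' z) (at z)"
    and M_deriv: "\<And>z. z \<in> \<gamma> ` {0..1} \<Longrightarrow> (M has_field_derivative M' z) (at z)"
    and R_deriv: "\<And>z. z \<in> \<gamma> ` {0..1} \<Longrightarrow> (R has_field_derivative R' z) (at z)"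
    and lam_deriv: "\<And>z. z \<in> \<gamma> ` {0..1} \<Longrightarrow> (lam has_field_derivative lam' z) (at z)"
    and DF: "\<And>z. z \<in> \<gamma> ` {0..1} \<Longrightarrow> g z * F' z = DF z"
    and ode: "\<And>z. z \<in> \<gamma> ` {0..1} \<Longrightarrow> g z * DF' z + P z * DF z + Q z * F z = 0"
    and lam: "\<And>z. z \<in> \<gamma> ` {0..1} \<Longrightarrow> g z * M' z = lam z * M z"
    and M_nz: "\<And>z. z \<in> \<gamma> ` {0..1} \<Longrightarrow> M z \<noteq> 0"
    and R_nz: "\<And>z. z \<in> \<gamma> ` {0..1} \<Longrightarrow> R z \<noteq> 0"
    and zero: "F 0 = 1" "DF 0 = 0" "M 0 = 1" "lam 0 = 0"
    and sigma: "\<And>z. z \<in> \<gamma> ` {0..1} \<Longrightarrow> 2 * lam z + P z + g z * R' z / R z = of_real m * R z + \<sigma> z"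
    and err: "\<And>z. z \<in> \<gamma> ` {0..1} \<Longrightarrow> g z * lam' z + lam z ^ 2 + P z * lam z + Q z = e z * R z"
    and R_bound: "\<And>r. 0 < r \<Longrightarrow> r < 1 \<Longrightarrow> Re (R (\<gamma> r)) \<ge> 0"
    and \<sigma>_bound: "\<And>r. 0 < r \<Longrightarrow> r < 1 \<Longrightarrow> cmod (\<sigma> (\<gamma> r)) \<le> K * r"
    and e_bound: "\<And>r. 0 < r \<Longrightarrow> r < 1 \<Longrightarrow> cmod (e (\<gamma> r)) \<le> K * r"
  shows "cmod (F (\<gamma> 1) / M (\<gamma> 1) - 1) \<le> 2 * C / m"
proof -
  define h where "h = (\<lambda>r. F (\<gamma> r) / M (\<gamma> r))"
  define G where "G = (\<lambda>r. (DF (\<gamma> r) / M (\<gamma> r) - lam (\<gamma> r) * h r) / R (\<gamma> r))"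
  have cont: "continuous_on {0..1} (\<lambda>r. f (\<gamma> r))"
    if "\<And>z. z \<in> \<gamma> ` {0..1} \<Longrightarrow> (f has_field_derivative f' z) (at z)" for f f' :: "complex \<Rightarrow> complex"
    by (rule continuous_on_compose2[OF _ \<gamma>_cont subset_refl], rule DERIV_continuous_on)
      (rule has_field_derivative_at_within, rule that)
  have hvd: "((\<lambda>r. f (\<gamma> r)) has_vector_derivative (g (\<gamma> r) * f' (\<gamma> r) / of_real r)) (at r)"
    if "\<And>z. z \<in> \<gamma> ` {0..1} \<Longrightarrow> (f has_field_derivative f' z) (at z)" "0 < r" "r < 1"
    for f f' :: "complex \<Rightarrow> complex" and r
    using field_vector_diff_chain_at[OF \<gamma>_deriv[OF that(2,3)] that(1)[of "\<gamma> r"]] that(2,3)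
    by (simp add: o_def mult_ac)
  have "cmod (h 1 - 1) \<le> 2 * C / m"
    unfolding C_def
  proof (rule liouville_green_estimate[OF K m[unfolded C_def], of h G "\<lambda>r. R (\<gamma> r)" "\<lambda>r. \<sigma> (\<gamma> r)" "\<lambda>r. e (\<gamma> r)"])
    show "continuous_on {0..1} h"
      unfolding h_def
      by (intro continuous_on_divide cont[OF F_deriv] cont[OF M_deriv]) (use M_nz in auto)
    then show "continuous_on {0..1} G"
      unfolding G_def
      by (intro continuous_on_divide continuous_on_diff continuous_on_mult cont[OF DF_deriv]
          cont[OF M_deriv] cont[OF lam_deriv] cont[OF R_deriv]) (use M_nz R_nz in auto)
    show "h 0 = 1" "G 0 = 0" using zero \<gamma>0 by (simp_all add: h_def G_def)
  next
    fix r :: real assume r: "0 < r" "r < 1"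
    then have z: "\<gamma> r \<in> \<gamma> ` {0..1}" by auto
    note d = hvd[OF F_deriv r] hvd[OF DF_deriv r] hvd[OF M_deriv r] hvd[OF R_deriv r] hvd[OF lam_deriv r]
    have nz: "M (\<gamma> r) \<noteq> 0" "R (\<gamma> r) \<noteq> 0" using M_nz R_nz z by auto
    have div: "((\<lambda>r. f r / k r) has_vector_derivative (f' / k r - f r / k r * (k' / k r))) (at r)"
      if "(f has_vector_derivative f') (at r)" "(k has_vector_derivative k') (at r)" "k r \<noteq> 0"
      for f k :: "real \<Rightarrow> complex" and f' k'
    proof -
      have "((\<lambda>r. f r / k r) has_vector_derivative (f' * inverse (k r) + f r * - (inverse (k r) * k' * inverse (k r)))) (at r)"
        unfolding divide_inverse
        using that unfolding has_vector_derivative_def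
        by (auto intro!: derivative_eq_intros simp: algebra_simps fun_eq_iff)
      then show ?thesis by (simp add: divide_inverse mult_ac)
    qed
    have "(h has_vector_derivative (g (\<gamma> r) * F' (\<gamma> r) / of_real r / M (\<gamma> r)
        - F (\<gamma> r) / M (\<gamma> r) * (g (\<gamma> r) * M' (\<gamma> r) / of_real r / M (\<gamma> r)))) (at r)"
      unfolding h_def by (rule div[OF d(1,3) nz(1)])
    also have "g (\<gamma> r) * F' (\<gamma> r) / of_real r / M (\<gamma> r)
        - F (\<gamma> r) / M (\<gamma> r) * (g (\<gamma> r) * M' (\<gamma> r) / of_real r / M (\<gamma> r)) = R (\<gamma> r) * G r / of_real r"
      unfolding DF[OF z] lam[OF z] G_def h_def using r nz by (simp add: field_simps)
    finally show dh: "(h has_vector_derivative (R (\<gamma> r) * G r / of_real r)) (at r)" .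
    define f1 where "f1 = DF (\<gamma> r) / M (\<gamma> r)"
    have f1: "f1 = R (\<gamma> r) * G r + lam (\<gamma> r) * h r"
      unfolding f1_def G_def using nz by simp
    have d1: "((\<lambda>r. DF (\<gamma> r) / M (\<gamma> r)) has_vector_derivative
         (g (\<gamma> r) * DF' (\<gamma> r) / of_real r / M (\<gamma> r)
        - DF (\<gamma> r) / M (\<gamma> r) * (g (\<gamma> r) * M' (\<gamma> r) / of_real r / M (\<gamma> r)))) (at r)"
      by (rule div[OF d(2,3) nz(1)])
    \<comment> \<open>The differential equation removes the second derivative of
      \<open>F\<close>.\<close>
    have gDF: "g (\<gamma> r) * DF' (\<gamma> r) = - (P (\<gamma> r) * DF (\<gamma> r) + Q (\<gamma> r) * F (\<gamma> r))"
      using ode[OF z] by (simp add: algebra_simps eq_neg_iff_add_eq_0)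
    have d1_eq: "g (\<gamma> r) * DF' (\<gamma> r) / of_real r / M (\<gamma> r)
        - DF (\<gamma> r) / M (\<gamma> r) * (g (\<gamma> r) * M' (\<gamma> r) / of_real r / M (\<gamma> r))
        = - (P (\<gamma> r) * f1 + Q (\<gamma> r) * h r + lam (\<gamma> r) * f1) / of_real r"
      unfolding gDF lam[OF z] f1_def h_def using r nz by (simp add: field_simps)
    have d2: "((\<lambda>r. DF (\<gamma> r) / M (\<gamma> r) - lam (\<gamma> r) * h r) has_vector_derivative
        (- (P (\<gamma> r) * f1 + Q (\<gamma> r) * h r + lam (\<gamma> r) * f1) / of_real r
         - (lam (\<gamma> r) * (R (\<gamma> r) * G r / of_real r) + g (\<gamma> r) * lam' (\<gamma> r) / of_real r * h r))) (at r)"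
      by (intro has_vector_derivative_diff d1[unfolded d1_eq] has_vector_derivative_mult d(5) dh)
    \<comment> \<open>Once \<open>f1 = R G + lam h\<close> is inserted, the coefficient of
      \<open>G\<close> becomes 2 lam + P + g R'/R and that of \<open>h\<close> becomes the residual
      of \<open>M\<close> over \<open>R\<close>; \<open>sigma\<close> and \<open>err\<close> rewrite
      exactly these two.\<close>
    have "(G has_vector_derivative
        ((- (P (\<gamma> r) * f1 + Q (\<gamma> r) * h r + lam (\<gamma> r) * f1) / of_real r
         - (lam (\<gamma> r) * (R (\<gamma> r) * G r / of_real r) + g (\<gamma> r) * lam' (\<gamma> r) / of_real r * h r)) / R (\<gamma> r)
         - G r * (g (\<gamma> r) * R' (\<gamma> r) / of_real r / R (\<gamma> r)))) (at r)"
      using div[OF d2 d(4) nz(2)] unfolding G_def .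
    also have "(- (P (\<gamma> r) * f1 + Q (\<gamma> r) * h r + lam (\<gamma> r) * f1) / of_real r
         - (lam (\<gamma> r) * (R (\<gamma> r) * G r / of_real r) + g (\<gamma> r) * lam' (\<gamma> r) / of_real r * h r)) / R (\<gamma> r)
         - G r * (g (\<gamma> r) * R' (\<gamma> r) / of_real r / R (\<gamma> r))
      = (- (2 * lam (\<gamma> r) + P (\<gamma> r) + g (\<gamma> r) * R' (\<gamma> r) / R (\<gamma> r)) * G r
         - (g (\<gamma> r) * lam' (\<gamma> r) + lam (\<gamma> r) ^ 2 + P (\<gamma> r) * lam (\<gamma> r) + Q (\<gamma> r)) / R (\<gamma> r) * h r) / of_real r"
      unfolding f1 using r nz by (simp add: field_simps power2_eq_square)
    also have "\<dots> = (- (of_real m * R (\<gamma> r) + \<sigma> (\<gamma> r)) * G r - e (\<gamma> r) * h r) / of_real r"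
      unfolding sigma[OF z] err[OF z] using nz by simp
    finally show "(G has_vector_derivative (- (of_real m * R (\<gamma> r) + \<sigma> (\<gamma> r)) * G r - e (\<gamma> r) * h r) / of_real r) (at r)" .
  qed (use R_bound \<sigma>_bound e_bound in auto)
  then show ?thesis by (simp add: h_def)
qed

section \<open>The saddle point term\<close>

text \<open>
  The branch condition makes \<open>\<omega> + 2\<omega>\<^sub>0\<close> the principal argument of \<open>X\<close>, so the phase factor and the
  modulus combine to a principal square root.
\<close>

lemma laplace_main_eq:
  assumes m: "m > 0" and t: "t \<noteq> 1" and X: "X = - ((t - 1)\<^sup>2 * deriv (deriv \<phi>) t)" "X \<noteq> 0" "Re X \<ge> 0"
  shows "laplace_main m \<kappa> \<phi> \<psi> t
       = of_real (C_const m \<kappa> / sqrt (2 * pi * m)) * (\<psi> t * (t - 1)) / csqrt X * exp (- of_real m * \<phi> t)"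
proof -
  define d where "d = deriv (deriv \<phi>) t"
  define \<theta> where "\<theta> = Im (Ln X)"
  define \<omega>0 where "\<omega>0 = Arg (t - 1)"
  \<comment> \<open>This witness satisfies the branch condition because Re X \<ge> 0 gives
    |\<theta>| \<le> pi/2; \<open>exp_omega_eq\<close> then passes to the value chosen in
    \<open>omega\<close>.\<close>
  define \<omega> where "\<omega> = \<theta> - 2 * \<omega>0"
  have d0: "d \<noteq> 0" using X by (auto simp: d_def)
  have X_polar: "X = of_real (cmod X) * exp (\<i> * of_real \<theta>)"
    using X(2) Arg_eq[of X] by (simp add: \<theta>_def Arg_eq_Im_Ln mult.commute)
  have t_polar: "t - 1 = of_real (cmod (t - 1)) * exp (\<i> * of_real \<omega>0)"
    using t Arg_eq[of "t - 1"] by (simp add: \<omega>0_def)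
  have normX: "cmod X = (cmod (t - 1))\<^sup>2 * cmod d"
    by (simp add: X(1) d_def norm_mult norm_power)
  have d_polar: "d = of_real (cmod d) * exp (\<i> * of_real (\<omega> - pi))"
  proof -
    have "- ((t - 1)\<^sup>2 * d) = of_real ((cmod (t - 1))\<^sup>2 * cmod d) * exp (\<i> * of_real \<theta>)"
      using X_polar unfolding normX by (simp add: X(1) d_def)
    moreover have "(t - 1)\<^sup>2 = of_real ((cmod (t - 1))\<^sup>2) * exp (\<i> * of_real (2 * \<omega>0))"
      by (subst t_polar) (simp add: power_mult_distrib exp_double[symmetric] mult.left_commute)
    \<comment> \<open>The minus sign in X is the shift by pi between \<omega> and the argument of
      the second derivative.\<close>
    moreover have "exp (\<i> * of_real \<theta>) = - (exp (\<i> * of_real (2 * \<omega>0)) * exp (\<i> * of_real (\<omega> - pi)))"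
    proof -
      have "\<i> * of_real (2 * \<omega>0) + \<i> * of_real (\<omega> - pi) = \<i> * of_real \<theta> - \<i> * pi"
        by (simp add: \<omega>_def algebra_simps)
      then show ?thesis by (simp add: exp_add[symmetric] exp_diff)
    qed
    ultimately have "of_real ((cmod (t - 1))\<^sup>2) * exp (\<i> * of_real (2 * \<omega>0)) * d
        = of_real ((cmod (t - 1))\<^sup>2) * exp (\<i> * of_real (2 * \<omega>0)) * (of_real (cmod d) * exp (\<i> * of_real (\<omega> - pi)))"
      by (simp add: algebra_simps)
    then show ?thesis using t by simp
  qed
  have "omega_branch \<phi> t \<omega> \<omega>0"
    unfolding omega_branch_def is_Arg_def d_def[symmetric]
  proof (intro conjI)
    have "\<bar>\<theta>\<bar> \<le> pi / 2" unfolding \<theta>_def using Re_Ln_pos_le[OF X(2)] X(3) by blast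
    then show "\<bar>\<omega> + 2 * \<omega>0\<bar> \<le> pi / 2" by (simp add: \<omega>_def)
  qed (use d_polar t_polar in auto)
  from exp_omega_eq[OF this] have omega: "exp (- \<i> * of_real (omega \<phi> t) / 2) = exp (- \<i> * of_real \<omega> / 2)"
    using t d0 by (simp add: d_def)
  \<comment> \<open>The numerator will complete |t - 1| to t - 1, the denominator sqrt |X| to
    \<open>csqrt X\<close>.\<close>
  have e1: "exp (- \<i> * of_real \<omega> / 2) = exp (\<i> * of_real \<omega>0) / exp (\<i> * of_real \<theta> / 2)"
    by (simp add: \<omega>_def exp_diff[symmetric] field_simps)
  have e2: "cmod (2 * of_real pi * of_real m * d) powr (- 1 / 2) = cmod (t - 1) / (sqrt (2 * pi * m) * sqrt (cmod X))"
  proof -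
    have "cmod (2 * of_real pi * of_real m * d) = 2 * pi * m * cmod d" using m by (simp add: norm_mult)
    moreover have "(2 * pi * m * cmod d) powr (- 1 / 2) = 1 / sqrt (2 * pi * m * cmod d)"
      using m d0 by (simp add: powr_minus_divide powr_half_sqrt)
    moreover have "sqrt (cmod X) = cmod (t - 1) * sqrt (cmod d)"
      unfolding normX by (simp add: real_sqrt_mult)
    ultimately show ?thesis using t by (simp add: real_sqrt_mult)
  qed
  have e3: "csqrt X = of_real (sqrt (cmod X)) * exp (\<i> * of_real \<theta> / 2)"
  proof -
    have "Ln X = of_real (ln (cmod X)) + \<i> * of_real \<theta>"
      using X(2) by (simp add: \<theta>_def complex_eq_iff)
    then have "csqrt X = exp (of_real (ln (cmod X) / 2)) * exp (\<i> * of_real \<theta> / 2)"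
      using X(2) by (simp add: csqrt_exp_Ln exp_add[symmetric] add_divide_distrib)
    also have "exp (of_real (ln (cmod X) / 2)) = complex_of_real (sqrt (cmod X))"
      using X(2) by (simp only: exp_of_real) (simp add: ln_sqrt[symmetric])
    finally show ?thesis .
  qed
  have "exp (- \<i> * of_real (omega \<phi> t) / 2) *
     of_real (cmod (2 * of_real pi * of_real m * d) powr (- 1 / 2))
    = (t - 1) / (of_real (sqrt (2 * pi * m)) * csqrt X)"
  proof -
    note arg_cong[OF t_polar, of "\<lambda>x. x / (of_real (sqrt (2 * pi * m)) * csqrt X)"]
    moreover have "exp (- \<i> * of_real (omega \<phi> t) / 2) *
       of_real (cmod (2 * of_real pi * of_real m * d) powr (- 1 / 2))
      = of_real (cmod (t - 1)) * exp (\<i> * of_real \<omega>0) / (of_real (sqrt (2 * pi * m)) * csqrt X)"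
      unfolding omega e1 e2 e3 by (simp add: field_simps)
    ultimately show ?thesis by (simp only:)
  qed
  then show ?thesis
    unfolding laplace_main_def d_def[symmetric] by (simp add: field_simps)
qed

section \<open>Stirling's formula\<close>

text \<open>
  That this remainder tends to some constant follows from its telescoping differences and Gauss's
  product; the duplication formula identifies the constant as 0.
\<close>

definition stirling_rem :: "real \<Rightarrow> real" where
  "stirling_rem x = ln (Gamma x) - ((x - 1/2) * ln x - x + ln (2 * pi) / 2)"

text \<open>The difference is (x + 1/2) (ln (x + 1) - ln x) - 1. As 1/t is convex, the midpoint rule
  bounds its integral over [x, x + 1] from below and the trapezoidal rule from above; the upper
  bound is written so that it telescopes.\<close>

lemma stirling_rem_plus1:
  assumes "x > 0"
  shows "0 \<le> stirling_rem x - stirling_rem (x + 1)"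
    and "stirling_rem x - stirling_rem (x + 1) \<le> (1 / x - 1 / (x + 1)) / 4"
proof -
  have "Gamma (x + 1) = x * Gamma x"
    using assms by (intro Gamma_plus1) (auto simp: nonpos_Ints_def)
  then have "ln (Gamma (x + 1)) = ln x + ln (Gamma x)"
    using assms Gamma_real_pos[OF assms] by (simp add: ln_mult less_imp_neq[THEN not_sym])
  then have eq: "stirling_rem x - stirling_rem (x + 1) = (x + 1/2) * (ln (x + 1) - ln x) - 1"
    by (simp add: stirling_rem_def algebra_simps)
  have "2 / (2 * x + 1) \<le> ln (x + 1) - ln x"
    using ln_inverse_approx_ge[of x "x + 1"] assms by (simp add: add_ac)
  then have "(x + 1/2) * (2 / (2 * x + 1)) \<le> (x + 1/2) * (ln (x + 1) - ln x)"
    using assms by (intro mult_left_mono) auto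
  also have "(x + 1/2) * (2 / (2 * x + 1)) = 1" using assms by (simp add: field_simps)
  finally show "0 \<le> stirling_rem x - stirling_rem (x + 1)" using eq by simp
  have "ln (x + 1) - ln x \<le> (1 / x + 1 / (x + 1)) / 2"
    using ln_inverse_approx_le[of x 1] assms by (simp add: inverse_eq_divide)
  then have "(x + 1/2) * (ln (x + 1) - ln x) \<le> (x + 1/2) * ((1 / x + 1 / (x + 1)) / 2)"
    using assms by (intro mult_left_mono) auto
  also have "\<dots> = 1 + (1 / x - 1 / (x + 1)) / 4"
    using assms by (simp add: divide_simps) (simp add: algebra_simps)
  finally show "stirling_rem x - stirling_rem (x + 1) \<le> (1 / x - 1 / (x + 1)) / 4"
    using eq by linarith
qed

lemma stirling_rem_plus_nat:
  assumes "x > 0"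
  shows "0 \<le> stirling_rem x - stirling_rem (x + real n) \<and>
         stirling_rem x - stirling_rem (x + real n) \<le> (1 / x - 1 / (x + real n)) / 4"
proof (induction n)
  case (Suc n)
  have "x + real (Suc n) = (x + real n) + 1" by simp
  then show ?case
    using Suc stirling_rem_plus1[of "x + real n"] assms by (auto simp: add_ac)
qed auto

text \<open>Gauss's product compares Gamma at x + n + 1 and at n + 1. Hence the limit of the
  remainder along x + n does not depend on x.\<close>

lemma stirling_rem_diff_tendsto:
  assumes "x > 0"
  shows "(\<lambda>n. stirling_rem (real n + 1) - stirling_rem (x + real n + 1)) \<longlonglongrightarrow> 0"
proof -
  have x: "x \<notin> \<int>\<^sub>\<le>\<^sub>0" using assms by (auto simp: nonpos_Ints_def)
  have Gx: "Gamma x > 0" by (rule Gamma_real_pos[OF assms])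
  have "(\<lambda>n. ln (Gamma_series x n / Gamma x)) \<longlonglongrightarrow> ln (Gamma x / Gamma x)"
    using Gx by (intro tendsto_intros) auto
  then have lim: "(\<lambda>n. ln (Gamma_series x n / Gamma x)) \<longlonglongrightarrow> 0" using Gx by simp
  have ev: "eventually (\<lambda>n. ln (Gamma_series x n / Gamma x) +
        ((x + real n + 1/2) * ln (x + real n + 1) - (real n + 1/2) * ln (real n + 1) - x - x * ln (real n))
      = stirling_rem (real n + 1) - stirling_rem (x + real n + 1)) sequentially"
    using eventually_gt_at_top[of 0]
  proof eventually_elim
    case (elim n)
    have p: "pochhammer x (n + 1) = Gamma (x + real n + 1) / Gamma x"
      using pochhammer_Gamma[OF x, of "n + 1"] by (simp add: add_ac)
    have f: "fact n = Gamma (real n + 1)"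
      using Gamma_fact[of n, where ?'a = real] by (simp add: add_ac)
    have pos: "Gamma (x + real n + 1) > 0" "Gamma (real n + 1) > 0"
      using assms by (auto intro!: Gamma_real_pos)
    have "Gamma_series x n / Gamma x
        = Gamma (real n + 1) * exp (x * ln (real n)) / Gamma (x + real n + 1)"
      unfolding Gamma_series_def p f using Gx pos by (simp add: field_simps)
    then have "ln (Gamma_series x n / Gamma x)
        = ln (Gamma (real n + 1)) + x * ln (real n) - ln (Gamma (x + real n + 1))"
      using pos less_imp_neq[OF pos(2)] by (simp add: ln_mult ln_div)
    then show ?case by (simp add: stirling_rem_def algebra_simps)
  qed
  have "(\<lambda>n. (x + real n + 1/2) * ln (x + real n + 1) - (real n + 1/2) * ln (real n + 1)
          - x - x * ln (real n)) \<longlonglongrightarrow> 0"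
    by real_asymp
  from tendsto_add[OF lim this] show ?thesis
    using tendsto_cong[OF ev] by simp
qed

text \<open>Legendre's formula makes this combination elementary. Its limit is 0, while a common
  limit L of the three remainders would make it L + L - L.\<close>

lemma stirling_rem_duplication:
  assumes "z > 0"
  shows "stirling_rem z + stirling_rem (z + 1/2) - stirling_rem (2 * z)
       = (1 - 2 * z) * ln 2 + ln pi / 2 - (z - 1/2) * ln z - z * ln (z + 1/2)
         + (2 * z - 1/2) * ln (2 * z) + 1/2 - ln (2 * pi) / 2"
proof -
  have "complex_of_real z \<notin> \<int>\<^sub>\<le>\<^sub>0" "complex_of_real z + 1/2 \<notin> \<int>\<^sub>\<le>\<^sub>0"
    using assms by (auto elim!: nonpos_Ints_cases simp: complex_eq_iff)
  from Gamma_legendre_duplication[OF this]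
  have "complex_of_real (Gamma z * Gamma (z + 1/2))
      = complex_of_real (exp ((1 - 2 * z) * ln 2) * sqrt pi * Gamma (2 * z))"
    by (simp flip: Gamma_complex_of_real exp_of_real)
  then have "Gamma z * Gamma (z + 1/2) = exp ((1 - 2 * z) * ln 2) * sqrt pi * Gamma (2 * z)"
    by (simp only: of_real_eq_iff)
  then have "ln (Gamma z * Gamma (z + 1/2)) = ln (exp ((1 - 2 * z) * ln 2) * sqrt pi * Gamma (2 * z))"
    by simp
  moreover have "Gamma z > 0" "Gamma (z + 1/2) > 0" "Gamma (2 * z) > 0"
    using assms by (auto intro!: Gamma_real_pos)
  ultimately have "ln (Gamma z) + ln (Gamma (z + 1/2)) = (1 - 2 * z) * ln 2 + ln pi / 2 + ln (Gamma (2 * z))"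
    by (simp add: ln_mult ln_sqrt)
  then show ?thesis by (simp add: stirling_rem_def algebra_simps)
qed

text \<open>Along the integers the remainder decreases and is bounded below, so it has a limit L,
  shared by every sequence y + n. Telescoping from y traps the remainder between L and L + 1/(4y),
  so L is also the limit over the reals, and duplication gives L = 0.\<close>

lemma stirling_rem_bounds:
  assumes x: "x > 0"
  shows "0 \<le> stirling_rem x" "stirling_rem x \<le> 1 / (4 * x)"
proof -
  have "decseq (\<lambda>n. stirling_rem (real n + 1))"
    using stirling_rem_plus1(1)[of "real n + 1" for n] by (intro decseq_SucI) (auto simp: add_ac)
  moreover have "stirling_rem (real n + 1) \<ge> stirling_rem 1 - 1/4" for n
  proof -
    have "1 / (1 + real n) \<ge> 0" by simp
    moreover have "stirling_rem 1 - stirling_rem (real n + 1) \<le> (1 - 1 / (1 + real n)) / 4"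
      using stirling_rem_plus_nat[of 1 n] by (simp add: add_ac)
    ultimately show ?thesis by argo
  qed
  ultimately obtain L where L: "(\<lambda>n. stirling_rem (real n + 1)) \<longlonglongrightarrow> L"
    using decseq_convergent[of "\<lambda>n. stirling_rem (real n + 1)" "stirling_rem 1 - 1/4"] by blast
  have Lx: "(\<lambda>n. stirling_rem (y + real n + 1)) \<longlonglongrightarrow> L" if "y > 0" for y
    using tendsto_diff[OF L stirling_rem_diff_tendsto[OF that]] by simp
  have bounds: "L \<le> stirling_rem y \<and> stirling_rem y \<le> L + 1 / (4 * y)" if y: "y > 0" for y
  proof
    have *: "stirling_rem (y + real n + 1) \<le> stirling_rem y"
      "stirling_rem y - 1 / (4 * y) \<le> stirling_rem (y + real n + 1)" for n
    proof -
      have eq: "y + real n + 1 = y + real (Suc n)" by simp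
      have "stirling_rem y - stirling_rem (y + real (Suc n)) \<le> (1 / y - 1 / (y + real (Suc n))) / 4"
        using stirling_rem_plus_nat[OF y, of "Suc n"] by (rule conjunct2)
      also have "\<dots> \<le> (1 / y) / 4"
        using y by (intro divide_right_mono) auto
      also have "\<dots> = 1 / (4 * y)" by simp
      finally have "stirling_rem y - stirling_rem (y + real (Suc n)) \<le> 1 / (4 * y)" .
      then show "stirling_rem y - 1 / (4 * y) \<le> stirling_rem (y + real n + 1)"
        unfolding eq by linarith
      show "stirling_rem (y + real n + 1) \<le> stirling_rem y"
        unfolding eq using stirling_rem_plus_nat[OF y, of "Suc n"] by linarith
    qed
    show "L \<le> stirling_rem y"
      by (rule tendsto_upperbound[OF Lx[OF y]]) (use * in auto)
    have "stirling_rem y - 1 / (4 * y) \<le> L"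
      by (rule tendsto_lowerbound[OF Lx[OF y]]) (use * in auto)
    then show "stirling_rem y \<le> L + 1 / (4 * y)" by simp
  qed
  have lim: "(stirling_rem \<longlongrightarrow> L) at_top"
  proof (rule tendsto_sandwich)
    show "eventually (\<lambda>y. L \<le> stirling_rem y) at_top"
      using eventually_gt_at_top[of "0::real"] by eventually_elim (use bounds in auto)
    show "eventually (\<lambda>y. stirling_rem y \<le> L + 1 / (4 * y)) at_top"
      using eventually_gt_at_top[of "0::real"] by eventually_elim (use bounds in auto)
    show "((\<lambda>y. L + 1 / (4 * y)) \<longlongrightarrow> L) at_top" by real_asymp
  qed simp
  have "((\<lambda>z. stirling_rem z + stirling_rem (z + 1/2) - stirling_rem (2 * z)) \<longlongrightarrow> L + L - L) at_top"
    by (intro tendsto_intros lim filterlim_compose[OF lim]; real_asymp)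
  moreover have "((\<lambda>z. stirling_rem z + stirling_rem (z + 1/2) - stirling_rem (2 * z)) \<longlongrightarrow> 0) at_top"
  proof (rule Lim_transform_eventually)
    show "((\<lambda>z::real. (1 - 2 * z) * ln 2 + ln pi / 2 - (z - 1/2) * ln z - z * ln (z + 1/2)
         + (2 * z - 1/2) * ln (2 * z) + 1/2 - ln (2 * pi) / 2) \<longlongrightarrow> 0) at_top"
      unfolding ln_mult_pos[OF zero_less_numeral pi_gt_zero] by real_asymp
    show "eventually (\<lambda>z. (1 - 2 * z) * ln 2 + ln pi / 2 - (z - 1/2) * ln z - z * ln (z + 1/2)
         + (2 * z - 1/2) * ln (2 * z) + 1/2 - ln (2 * pi) / 2
        = stirling_rem z + stirling_rem (z + 1/2) - stirling_rem (2 * z)) at_top"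
      using eventually_gt_at_top[of "0::real"] by eventually_elim (simp only: stirling_rem_duplication)
  qed
  ultimately have "L = 0"
    using tendsto_unique[OF trivial_limit_at_top_linorder] by fastforce
  then show "0 \<le> stirling_rem x" "stirling_rem x \<le> 1 / (4 * x)" using bounds[OF x] by auto
qed

lemma Gamma_plus1_stirling:
  assumes "x > 0"
  shows "Gamma (x + 1) = sqrt (2 * pi * x) * exp (x * ln x - x + stirling_rem x)"
proof -
  have "ln (Gamma x) = x * ln x - x + stirling_rem x + ln (2 * pi) / 2 - ln x / 2"
    by (simp add: stirling_rem_def algebra_simps)
  then have "Gamma x = exp (x * ln x - x + stirling_rem x + ln (2 * pi) / 2 - ln x / 2)"
    using Gamma_real_pos[OF assms] by (metis exp_ln)
  moreover have "Gamma (x + 1) = x * Gamma x"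
    using assms by (intro Gamma_plus1) (auto simp: nonpos_Ints_def)
  moreover have "sqrt y = exp (ln y / 2)" if "y > 0" for y
    using that by (simp add: exp_ln_iff ln_sqrt[symmetric])
  moreover have "x = exp (ln x)" using assms by simp
  moreover have "ln (2 * pi * x) = ln (2 * pi) + ln x"
    using assms by (intro ln_mult_pos) auto
  ultimately have "Gamma (x + 1) = exp (ln x) * exp (x * ln x - x + stirling_rem x + ln (2 * pi) / 2 - ln x / 2)"
    and "sqrt (2 * pi * x) = exp ((ln (2 * pi) + ln x) / 2)"
    using assms by simp_all
  then show ?thesis by (simp add: exp_add[symmetric] field_simps)
qed

text \<open>At \<eta> = 0 the saddle point is \<kappa>, where both phase functions equal -(\<kappa>
  ln \<kappa> - (\<kappa> - 1) ln (\<kappa> - 1)); so the large exponential here is the one that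
  cancels the saddle point exponential at \<eta> = 0. The last factor is the 1 + o(1) depending on m
  and \<kappa> only.\<close>

lemma C_const_stirling:
  assumes m: "m > 0" and \<kappa>: "\<kappa> > 1"
  shows "C_const m \<kappa> = sqrt (2 * pi * m * ((\<kappa> - 1) / \<kappa>))
           * exp (- m * (\<kappa> * ln \<kappa> - (\<kappa> - 1) * ln (\<kappa> - 1)))
           * exp (stirling_rem m + stirling_rem (m * (\<kappa> - 1)) - stirling_rem (m * \<kappa>))"
proof -
  define n where "n = m * (\<kappa> - 1)"
  have n: "n > 0" and mk: "m * \<kappa> = m + n" "m + n > 0"
    using m \<kappa> by (auto simp: n_def algebra_simps)
  have split: "(a * exp A) * (b * exp B) / (c * exp C) = a * b / c * exp (A + B - C)" for a b c A B C :: real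
    by (simp add: exp_add exp_diff)
  have "C_const m \<kappa> = (sqrt (2 * pi * m) * sqrt (2 * pi * n) / sqrt (2 * pi * (m + n))) *
     exp ((m * ln m - m + stirling_rem m) + (n * ln n - n + stirling_rem n)
          - ((m + n) * ln (m + n) - (m + n) + stirling_rem (m + n)))"
    unfolding C_const_def n_def[symmetric] mk(1)
      Gamma_plus1_stirling[OF m] Gamma_plus1_stirling[OF n] Gamma_plus1_stirling[OF mk(2)] split ..
  also have "sqrt (2 * pi * m) * sqrt (2 * pi * n) / sqrt (2 * pi * (m + n))
      = sqrt ((2 * pi * m) * (2 * pi * n) / (2 * pi * (m + n)))"
    by (simp only: real_sqrt_mult real_sqrt_divide)
  also have "(2 * pi * m) * (2 * pi * n) / (2 * pi * (m + n)) = 2 * pi * m * ((\<kappa> - 1) / \<kappa>)"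
    unfolding mk(1)[symmetric] using m \<kappa> by (simp add: n_def)
  also have "(m * ln m - m + stirling_rem m) + (n * ln n - n + stirling_rem n)
          - ((m + n) * ln (m + n) - (m + n) + stirling_rem (m + n))
      = - m * (\<kappa> * ln \<kappa> - (\<kappa> - 1) * ln (\<kappa> - 1))
        + (stirling_rem m + stirling_rem n - stirling_rem (m + n))"
  proof -
    have "ln n = ln m + ln (\<kappa> - 1)" unfolding n_def using m \<kappa> by (intro ln_mult_pos) auto
    moreover have "ln (m + n) = ln m + ln \<kappa>"
      unfolding mk(1)[symmetric] using m \<kappa> by (intro ln_mult_pos) auto
    ultimately show ?thesis by (simp add: n_def algebra_simps)
  qed
  finally show ?thesis
    unfolding mk(1) n_def[symmetric] by (simp only: exp_add mult.assoc)
qed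

text \<open>The lower bound on \<kappa> - 1 keeps m (\<kappa> - 1) at least m \<delta>, so that all
  three remainders are O(1/m) uniformly in \<kappa>.\<close>

lemma stirling_rem_combination_bound:
  assumes m: "m > 0" and \<kappa>: "\<kappa> - 1 \<ge> \<delta>" and \<delta>: "\<delta> > 0"
  shows "\<bar>stirling_rem m + stirling_rem (m * (\<kappa> - 1)) - stirling_rem (m * \<kappa>)\<bar> \<le> (1 + 1 / \<delta>) / m"
proof -
  have k: "\<kappa> > 1" using assms by linarith
  have pos: "m * (\<kappa> - 1) > 0" "m * \<kappa> > 0" using m k by auto
  have "1 / (4 * (m * (\<kappa> - 1))) \<le> 1 / (m * \<delta>)"
    using m \<kappa> \<delta> pos by (intro divide_left_mono) (auto intro: order_trans[of _ "m * (\<kappa> - 1)"])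
  moreover have "1 / (4 * (m * \<kappa>)) \<le> 1 / m"
    using m k pos by (intro divide_left_mono) (auto intro: order_trans[of _ "m * \<kappa>"])
  moreover have "1 / (4 * m) \<le> 1 / m" using m by (simp add: field_simps)
  moreover have "1 / m + 1 / (m * \<delta>) = (1 + 1 / \<delta>) / m" using m \<delta> by (simp add: field_simps)
  moreover have "1 / (m * \<delta>) \<ge> 0" using m \<delta> by simp
  ultimately show ?thesis
    using stirling_rem_bounds[OF m] stirling_rem_bounds[OF pos(1)] stirling_rem_bounds[OF pos(2)] by linarith
qed

section \<open>Hypergeometric functions\<close>

lemma fps_conv_radius_hypergeo_1_1:
  assumes "a > 0" "b > 0"
  shows "fps_conv_radius (fps_hypergeo [complex_of_real a] [complex_of_real b] 1) = \<infinity>"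
proof -
  let ?H = "fps_hypergeo [complex_of_real a] [complex_of_real b] 1"
  have pos: "pochhammer (complex_of_real x) n \<noteq> 0" if "x > 0" for x n
    using pochhammer_pos[OF that, of n] by (simp add: pochhammer_of_real)
  have nz: "?H $ n \<noteq> 0" for n using assms by (simp add: pos)
  have eq: "norm (?H $ n) / norm (?H $ Suc n) = (b + real n) * (real n + 1) / (a + real n)" for n
  proof -
    have "norm (complex_of_real a + of_nat n) = a + real n" "norm (complex_of_real b + of_nat n) = b + real n"
      using assms norm_of_real[of "a + real n", where ?'a=complex] norm_of_real[of "b + real n", where ?'a=complex] by auto
    moreover have "norm (of_nat (Suc n) :: complex) = real n + 1" unfolding norm_of_nat by simp
    moreover have "?H $ Suc n = (of_real a + of_nat n) / (of_nat (Suc n) * (of_real b + of_nat n)) * ?H $ n"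
      unfolding fps_hypergeo_rec[of _ _ _ n] by simp
    ultimately have "norm (?H $ Suc n) = (a + real n) / ((real n + 1) * (b + real n)) * norm (?H $ n)"
      by (simp only: norm_mult norm_divide)
    then show ?thesis
      using nz[of n] assms by (simp add: mult_ac del: fps_hypergeo_nth)
  qed
  have "filterlim (\<lambda>n. (b + real n) * (real n + 1) / (a + real n)) at_top sequentially"
    by real_asymp
  then have "(\<lambda>n. ereal (norm (?H $ n) / norm (?H $ Suc n))) \<longlonglongrightarrow> \<infinity>"
    unfolding eq by (rule tendsto_PInfty_eq_at_top[THEN iffD2])
  then show ?thesis
    unfolding fps_conv_radius_def by (rule conv_radius_ratio_limit_ereal_nonzero[rotated]) simp
qed

lemma fps_conv_radius_hypergeo_2_1:
  assumes "a > 0" "b > 0" "c > 0"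
  shows "fps_conv_radius (fps_hypergeo [complex_of_real a, complex_of_real b] [complex_of_real c] 1) = 1"
proof -
  let ?H = "fps_hypergeo [complex_of_real a, complex_of_real b] [complex_of_real c] 1"
  have pos: "pochhammer (complex_of_real x) n \<noteq> 0" if "x > 0" for x n
    using pochhammer_pos[OF that, of n] by (simp add: pochhammer_of_real)
  have nz: "?H $ n \<noteq> 0" for n using assms by (simp add: pos)
  have eq: "norm (?H $ n) / norm (?H $ Suc n)
      = (c + real n) * (real n + 1) / ((a + real n) * (b + real n))" for n
  proof -
    have "norm (complex_of_real x + of_nat n) = x + real n" if "x > 0" for x
      using that norm_of_real[of "x + real n", where ?'a=complex] by simp
    note this[OF assms(1)] this[OF assms(2)] this[OF assms(3)]
    moreover have "norm (of_nat (Suc n) :: complex) = real n + 1" unfolding norm_of_nat by simp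
    moreover have "?H $ Suc n = (of_real a + of_nat n) * (of_real b + of_nat n) / (of_nat (Suc n) * (of_real c + of_nat n)) * ?H $ n"
      unfolding fps_hypergeo_rec[of _ _ _ n] by simp
    ultimately have "norm (?H $ Suc n)
        = (a + real n) * (b + real n) / ((real n + 1) * (c + real n)) * norm (?H $ n)"
      by (simp only: norm_mult norm_divide)
    then show ?thesis
      using nz[of n] assms by (simp add: mult_ac del: fps_hypergeo_nth)
  qed
  have "(\<lambda>n. (c + real n) * (real n + 1) / ((a + real n) * (b + real n))) \<longlonglongrightarrow> 1"
    by real_asymp
  then show ?thesis
    unfolding fps_conv_radius_def eq[symmetric]
    by (intro conv_radius_ratio_limit_nonzero[where c = 1]) (auto simp: one_ereal_def)
qed

text \<open>Coefficientwise this is the recurrence (b + n) (n + 1) H_(n+1) = (a + n) H_n.\<close>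

lemma hypergeo_1_1_fps_ode:
  fixes a b :: real
  assumes "b > 0"
  defines "H \<equiv> fps_hypergeo [complex_of_real a] [complex_of_real b] 1"
  shows "fps_X * fps_deriv (fps_deriv H) + fps_const (of_real b) * fps_deriv H
         - fps_X * fps_deriv H - fps_const (of_real a) * H = 0"
proof (rule fps_ext)
  fix n
  have b: "complex_of_real b + of_nat n \<noteq> 0"
    using assms(1) of_real_eq_0_iff[of "b + real n", where ?'a=complex] by auto
  have rec: "(of_real b + of_nat n) * (of_nat (Suc n) * H $ Suc n) = (of_real a + of_nat n) * H $ n"
  proof -
    have "complex_of_nat (Suc n) \<noteq> 0" by (simp del: of_nat_Suc)
    moreover have "H $ Suc n = (of_real a + of_nat n) / (of_nat (Suc n) * (of_real b + of_nat n)) * H $ n"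
      unfolding H_def fps_hypergeo_rec[of _ _ _ n] by simp
    ultimately show ?thesis using b by (simp del: of_nat_Suc)
  qed
  show "(fps_X * fps_deriv (fps_deriv H) + fps_const (of_real b) * fps_deriv H
         - fps_X * fps_deriv H - fps_const (of_real a) * H) $ n = 0 $ n"
    using rec by (cases n) (simp_all add: algebra_simps)
qed

lemma hypergeo_2_1_fps_ode:
  fixes a b c :: real
  assumes "c > 0"
  defines "H \<equiv> fps_hypergeo [complex_of_real a, complex_of_real b] [complex_of_real c] 1"
  shows "fps_X * fps_deriv (fps_deriv H) - fps_X * (fps_X * fps_deriv (fps_deriv H))
         + fps_const (of_real c) * fps_deriv H - fps_const (of_real (a + b + 1)) * (fps_X * fps_deriv H)
         - fps_const (of_real (a * b)) * H = 0"
proof (rule fps_ext)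
  fix n
  have c: "complex_of_real c + of_nat n \<noteq> 0"
    using assms(1) of_real_eq_0_iff[of "c + real n", where ?'a=complex] by auto
  have rec: "(of_real c + of_nat n) * (of_nat (Suc n) * H $ Suc n)
      = (of_real a + of_nat n) * (of_real b + of_nat n) * H $ n"
  proof -
    have "complex_of_nat (Suc n) \<noteq> 0" by (simp del: of_nat_Suc)
    moreover have "H $ Suc n = (of_real a + of_nat n) * (of_real b + of_nat n) / (of_nat (Suc n) * (of_real c + of_nat n)) * H $ n"
      unfolding H_def fps_hypergeo_rec[of _ _ _ n] by simp
    ultimately show ?thesis using c by (simp del: of_nat_Suc)
  qed
  show "(fps_X * fps_deriv (fps_deriv H) - fps_X * (fps_X * fps_deriv (fps_deriv H))
         + fps_const (of_real c) * fps_deriv H - fps_const (of_real (a + b + 1)) * (fps_X * fps_deriv H)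
         - fps_const (of_real (a * b)) * H) $ n = 0 $ n"
  proof (cases n)
    case (Suc k)
    \<comment> \<open>The term with two factors X starts at degree 2, so degree 1 has to be
      separated as well.\<close>
    show ?thesis using rec unfolding Suc by (cases k) (simp_all add: algebra_simps)
  qed (use rec in simp)
qed

text \<open>The identity theorem in the form in which identities between power series at 0 are
  carried to the whole domain.\<close>

lemma has_fps_expansion_0_imp_zero:
  assumes "g has_fps_expansion 0" "g holomorphic_on S" "open S" "connected S" "0 \<in> S" "z \<in> S"
  shows "g z = 0"
proof -
  have "eventually (\<lambda>z. g z = 0) (nhds 0)"
    using assms(1) by (auto simp: has_fps_expansion_def elim!: eventually_mono)
  then obtain U where U: "open U" "0 \<in> U" "\<And>z. z \<in> U \<Longrightarrow> g z = 0"
    by (auto simp: eventually_nhds)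
  show ?thesis
    by (rule analytic_continuation_open[of "U \<inter> S" S g "\<lambda>_. 0"]) (use U assms in auto)
qed

section \<open>Continuation of the Gauss function to the cut plane by Euler's integral\<close>

definition slit_right :: "complex set" where
  "slit_right = - (complex_of_real ` {1..})"

lemma slit_right: "open slit_right" "connected slit_right" "0 \<in> slit_right" "ball 0 1 \<subseteq> slit_right"
proof -
  show "open slit_right" unfolding slit_right_def using closed_slot_right by (simp add: open_Compl)
  show "connected slit_right" unfolding slit_right_def
    by (intro starlike_imp_connected starlike_slotted_complex_plane_right)
  show "ball 0 1 \<subseteq> slit_right" unfolding slit_right_def by auto
  then show "0 \<in> slit_right" by auto
qed

lemma one_minus_slit_right:
  assumes "z \<in> slit_right" "0 \<le> t" "t \<le> 1"
  shows "1 - z * of_real t \<notin> \<real>\<^sub>\<le>\<^sub>0"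
proof
  assume "1 - z * of_real t \<in> \<real>\<^sub>\<le>\<^sub>0"
  then obtain r where r: "1 - z * of_real t = of_real r" "r \<le> 0" by (elim nonpos_Reals_cases)
  then have eq: "z * of_real t = of_real (1 - r)" by (simp add: algebra_simps)
  with r have t0: "t \<noteq> 0" by auto
  have "z = of_real ((1 - r) / t)" unfolding of_real_divide eq[symmetric] using t0 by simp
  moreover have "(1 - r) / t \<ge> 1" using r assms t0 by (simp add: field_simps)
  ultimately have "z \<in> complex_of_real ` {1..}" by (intro image_eqI[of _ _ "(1 - r) / t"]) simp_all
  then show False using assms(1) unfolding slit_right_def by simp
qed

text \<open>The weight of Euler's integral, with d = c - b. It is used for exponents b - 1 and d - 1
  that are positive, which makes it continuous on the closed interval and the integral
  proper.\<close>

definition euler_weight :: "real \<Rightarrow> real \<Rightarrow> real \<Rightarrow> real" where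
  "euler_weight b d t = t powr (b - 1) * (1 - t) powr (d - 1)"

lemma euler_weight_continuous:
  assumes "b > 1" "d > 1"
  shows "continuous_on {0..1} (euler_weight b d)"
  unfolding euler_weight_def using assms
  by (intro continuous_on_mult continuous_on_powr' continuous_on_id continuous_on_const
      continuous_on_diff) auto

lemma euler_weight_bound:
  assumes "b > 1" "d > 1" "t \<in> {0..1}"
  shows "\<bar>euler_weight b d t\<bar> \<le> 1"
proof -
  have "t powr (b - 1) \<le> 1" "(1 - t) powr (d - 1) \<le> 1"
    using assms by (auto intro!: powr_le1)
  then show ?thesis unfolding euler_weight_def by (simp add: abs_mult mult_le_one)
qed

definition euler_integral :: "real \<Rightarrow> real \<Rightarrow> real \<Rightarrow> complex \<Rightarrow> complex" where
  "euler_integral a b d z = integral {0..1} (\<lambda>t. of_real (euler_weight b d t) * exp (- of_real a * Ln (1 - z * of_real t)))"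

lemma euler_integral_holomorphic:
  assumes b: "b > 1" and d: "d > 1"
  shows "euler_integral a b d holomorphic_on slit_right"
proof -
  have cw: "continuous_on {0..1} (euler_weight b d)" by (rule euler_weight_continuous[OF b d])
  \<comment> \<open>Differentiation under the integral sign is carried out on convex sets; the cut
    plane is not convex but is covered by balls.\<close>
  have "euler_integral a b d holomorphic_on ball z e" if "ball z e \<subseteq> slit_right" for z e
  proof -
    let ?f = "\<lambda>z t. of_real (euler_weight b d t) * exp (- of_real a * Ln (1 - z * of_real t))"
    let ?fx = "\<lambda>z t. of_real (euler_weight b d t) * (exp (- of_real a * Ln (1 - z * of_real t)) *
        (- of_real a * (- of_real t / (1 - z * of_real t))))"
    have nz: "1 - x * of_real t \<notin> \<real>\<^sub>\<le>\<^sub>0" "1 - x * of_real t \<noteq> 0"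
      if "x \<in> ball z e" "t \<in> {0..1}" for x t
      using one_minus_slit_right[of x t] that \<open>ball z e \<subseteq> slit_right\<close> by auto
    have "(\<lambda>x. integral (cbox 0 1) (?f x)) holomorphic_on ball z e"
    proof (rule leibniz_rule_holomorphic)
      fix x t assume "x \<in> ball z e" "t \<in> cbox (0::real) 1"
      then show "((\<lambda>x. ?f x t) has_field_derivative ?fx x t) (at x within ball z e)"
        using nz[of x t] by (auto intro!: derivative_eq_intros simp: divide_inverse)
    next
      fix x assume x: "x \<in> ball z e"
      show "?f x integrable_on cbox 0 1"
        unfolding cbox_interval
        by (intro integrable_continuous_real continuous_intros cw continuous_on_Ln')
          (use nz[OF x] in auto)
    next
      show "continuous_on (ball z e \<times> cbox 0 1) (\<lambda>(x, t). ?fx x t)"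
        unfolding case_prod_beta cbox_interval
        by (intro continuous_intros continuous_on_Ln' continuous_on_compose2[OF cw]) (use nz in auto)
    qed auto
    then show ?thesis unfolding euler_integral_def[abs_def] cbox_interval .
  qed
  then show ?thesis
    using slit_right(1) by (metis analytic_on_def analytic_imp_holomorphic openE)
qed

text \<open>Moments of the weight: relative to the zeroth one they are the quotients (b)_n / (b +
  d)_n in the coefficients of the Gauss series.\<close>

lemma Beta_add_nat:
  assumes "b > 0" "d > (0::real)"
  shows "Beta (b + real n) d = Beta b d * pochhammer b n / pochhammer (b + d) n"
proof (induction n)
  case (Suc n)
  have p: "pochhammer (b + d) k > 0" for k using assms by (intro pochhammer_pos) auto
  have "b + real n \<notin> \<int>\<^sub>\<le>\<^sub>0" using assms by (auto simp: nonpos_Ints_def)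
  from Beta_plus1_left[OF this, of d]
  have "Beta (b + real (Suc n)) d = (b + real n) * Beta (b + real n) d / (b + d + real n)"
    using assms by (simp add: field_simps)
  also have "\<dots> = Beta b d * pochhammer b (Suc n) / pochhammer (b + d) (Suc n)"
    unfolding Suc.IH pochhammer_Suc using p[of n] assms by (simp add: field_simps)
  finally show ?case .
qed auto

text \<open>For |z| < 1 the binomial series of (1 - z t)^(-a) converges uniformly in t, dominated by
  its absolute series at |z|, so it may be integrated term by term against the weight.\<close>

lemma euler_integral_fps:
  assumes a: "a > 0" and b: "b > 1" and d: "d > 1"
  shows "(\<lambda>z. euler_integral a b d z / of_real (Beta b d)) has_fps_expansion
           fps_hypergeo [complex_of_real a, complex_of_real b] [complex_of_real (b + d)] 1"
proof -
  let ?H = "fps_hypergeo [complex_of_real a, complex_of_real b] [complex_of_real (b + d)] 1"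
  have B: "Beta b d > 0" unfolding Beta_def using b d by (simp add: Gamma_real_pos)
  have eval: "eval_fps ?H z = euler_integral a b d z / of_real (Beta b d)" if z: "norm z < 1" for z
  proof -
    define g where "g n = (- complex_of_real a) gchoose n" for n
    have g: "g n * (- 1) ^ n = of_real (pochhammer a n / fact n)" for n
      unfolding g_def by (simp add: gbinomial_pochhammer pochhammer_of_real flip: power_mult_distrib)
    have "summable (\<lambda>n. norm (g n * (- z) ^ n))"
      using norm_summable_fps[of "- z" "fps_binomial (- complex_of_real a)"] z
      by (auto simp: g_def fps_conv_radius_binomial)
    then have summ: "summable (\<lambda>n. norm (g n) * norm z ^ n)" by (simp add: norm_mult norm_power)
    let ?w = "\<lambda>t. complex_of_real (euler_weight b d t)"
    have "uniform_limit {0..1} (\<lambda>N t. \<Sum>n<N. ?w t * (g n * (- (z * of_real t)) ^ n))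
            (\<lambda>t. \<Sum>n. ?w t * (g n * (- (z * of_real t)) ^ n)) sequentially"
    proof (rule Weierstrass_m_test[OF _ summ])
      fix n and t :: real assume t: "t \<in> {0..1}"
      have "norm (?w t * (g n * (- (z * of_real t)) ^ n)) = \<bar>euler_weight b d t\<bar> * (norm (g n) * (norm z * t) ^ n)"
        using t by (simp add: norm_mult norm_power)
      also have "\<dots> \<le> 1 * (norm (g n) * norm z ^ n)"
        using euler_weight_bound[OF b d t] t
        by (intro mult_mono power_mono) (auto intro: mult_left_le)
      finally show "norm (?w t * (g n * (- (z * of_real t)) ^ n)) \<le> norm (g n) * norm z ^ n" by simp
    qed
    also have "?this \<longleftrightarrow> uniform_limit {0..1} (\<lambda>N t. \<Sum>n<N. ?w t * (g n * (- (z * of_real t)) ^ n))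
            (\<lambda>t. ?w t * exp (- of_real a * Ln (1 - z * of_real t))) sequentially"
    proof (rule uniform_limit_cong')
      fix t :: real assume t: "t \<in> {0..1}"
      have n1: "norm (- (z * of_real t)) < 1"
        using t z mult_left_le[of t "norm z"] by (auto simp: norm_mult)
      have nz: "1 - z * of_real t \<noteq> 0"
        using n1 by auto
      have "(\<lambda>n. g n * (- (z * of_real t)) ^ n) sums (1 + (- (z * of_real t))) powr (- of_real a)"
        unfolding g_def by (rule gen_binomial_complex[OF n1])
      then have "(\<lambda>n. ?w t * (g n * (- (z * of_real t)) ^ n)) sums (?w t * (1 + (- (z * of_real t))) powr (- of_real a))"
        by (rule sums_mult)
      then show "(\<Sum>n. ?w t * (g n * (- (z * of_real t)) ^ n)) = ?w t * exp (- of_real a * Ln (1 - z * of_real t))"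
        using nz by (simp add: sums_iff powr_def)
    qed auto
    finally have ul: "uniform_limit {0..1} (\<lambda>N t. \<Sum>n<N. ?w t * (g n * (- (z * of_real t)) ^ n))
            (\<lambda>t. ?w t * exp (- of_real a * Ln (1 - z * of_real t))) sequentially" .
    have cont: "continuous_on {0..1} (\<lambda>t. \<Sum>n<N. ?w t * (g n * (- (z * of_real t)) ^ n))" for N
      by (intro continuous_intros euler_weight_continuous b d)
    obtain I J where I: "\<And>N. ((\<lambda>t. \<Sum>n<N. ?w t * (g n * (- (z * of_real t)) ^ n)) has_integral I N) {0..1}"
      and J: "((\<lambda>t. ?w t * exp (- of_real a * Ln (1 - z * of_real t))) has_integral J) {0..1}"
      and IJ: "I \<longlonglongrightarrow> J"
      using uniform_limit_integral[OF ul cont] by auto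
    have "((\<lambda>t. of_real (t powr (b + real n - 1) * (1 - t) powr (d - 1))) has_integral
        complex_of_real (Beta (b + real n) d)) {0..1}" for n
      by (intro has_integral_of_real has_integral_Beta_real) (use b d in auto)
    moreover have "t powr (b + real n - 1) * (1 - t) powr (d - 1) = euler_weight b d t * t ^ n"
      if "t \<in> {0..1}" for t n
    \<comment> \<open>At t = 0 both sides vanish even for n = 0, because 0 \<open>powr\<close>
      anything is 0.\<close>
    proof (cases "t = 0")
      case False
      then have "t powr (b + real n - 1) = t powr (b - 1) * t ^ n"
        using that by (simp add: powr_realpow[symmetric] powr_add[symmetric] algebra_simps)
      then show ?thesis by (simp add: euler_weight_def)
    qed (use b in \<open>auto simp: euler_weight_def\<close>)
    ultimately have "((\<lambda>t. of_real (euler_weight b d t * t ^ n)) has_integral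
        complex_of_real (Beta (b + real n) d)) {0..1}" for n
      by (subst has_integral_cong[where g = "\<lambda>t. of_real (t powr (b + real n - 1) * (1 - t) powr (d - 1))"]) auto
    from has_integral_mult_right[OF this, of "g n * (- z) ^ n" n for n]
    have "((\<lambda>t. ?w t * (g n * (- (z * of_real t)) ^ n)) has_integral
        (g n * (- z) ^ n * of_real (Beta (b + real n) d))) {0..1}" for n
      by (rule has_integral_eq[rotated])
        (simp only: minus_mult_left power_mult_distrib of_real_mult of_real_power mult_ac)
    then have "((\<lambda>t. \<Sum>n<N. ?w t * (g n * (- (z * of_real t)) ^ n)) has_integral
        (\<Sum>n<N. g n * (- z) ^ n * of_real (Beta (b + real n) d))) {0..1}" for N
      by (intro has_integral_sum) auto
    then have "I N = (\<Sum>n<N. g n * (- z) ^ n * of_real (Beta (b + real n) d))" for N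
      using I[of N] by (rule has_integral_unique[rotated])
    then have "I = (\<lambda>N. \<Sum>n<N. of_real (Beta b d) * (?H $ n * z ^ n))"
    proof (intro ext)
      fix N assume IN: "\<And>N. I N = (\<Sum>n<N. g n * (- z) ^ n * of_real (Beta (b + real n) d))"
      have "g n * (- z) ^ n * of_real (Beta (b + real n) d) = of_real (Beta b d) * (?H $ n * z ^ n)" for n
      proof -
        have "g n * (- z) ^ n = of_real (pochhammer a n / fact n) * z ^ n"
          unfolding g[symmetric] by (subst power_minus) (simp add: mult_ac)
        then show ?thesis
          using b d by (simp add: Beta_add_nat pochhammer_of_real mult_ac flip: of_real_add)
      qed
      then show "I N = (\<Sum>n<N. of_real (Beta b d) * (?H $ n * z ^ n))" unfolding IN by simp
    qed
    with IJ have "(\<lambda>n. of_real (Beta b d) * (?H $ n * z ^ n)) sums J" by (simp add: sums_def)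
    then have "(\<lambda>n. of_real (Beta b d) * (?H $ n * z ^ n) / of_real (Beta b d)) sums (J / of_real (Beta b d))"
      by (rule sums_divide)
    then have "(\<lambda>n. ?H $ n * z ^ n) sums (J / of_real (Beta b d))" using B by simp
    moreover have "euler_integral a b d z = J"
      unfolding euler_integral_def using J by (rule integral_unique)
    ultimately show ?thesis by (simp add: eval_fps_def sums_iff)
  qed
  have "eventually (\<lambda>z::complex. z \<in> ball 0 1) (nhds 0)"
    by (intro eventually_nhds_in_open) auto
  then have "eventually (\<lambda>z. eval_fps ?H z = euler_integral a b d z / of_real (Beta b d)) (nhds 0)"
    by eventually_elim (use eval in auto)
  moreover have "fps_conv_radius ?H > 0"
    using fps_conv_radius_hypergeo_2_1[of a b "b + d"] a b d by simp
  ultimately show ?thesis by (simp add: has_fps_expansion_def)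
qed

text \<open>
  Euler's integral requires \<open>c > b\<close>, whereas the case of interest has \<open>c < b\<close>. The operator
  \<open>1 + z/c d/dz\<close> lowers the parameter \<open>c + 1\<close> to \<open>c\<close>.
\<close>

lemma hypergeo_2_1_fps_lower:
  fixes a b :: complex and c :: real
  assumes c: "c > 0"
  defines "H \<equiv> fps_hypergeo [a, b] [complex_of_real (c + 1)] 1"
  shows "H + fps_const (1 / of_real c) * (fps_X * fps_deriv H) = fps_hypergeo [a, b] [complex_of_real c] 1"
proof (rule fps_ext)
  fix n
  have "pochhammer c n * (c + real n) = c * pochhammer (c + 1) n"
    by (metis pochhammer_Suc pochhammer_rec)
  then have "complex_of_real (pochhammer c n * (c + real n)) = of_real (c * pochhammer (c + 1) n)"
    by simp
  then have eq: "complex_of_real (pochhammer c n) * (of_real c + of_nat n) = of_real c * of_real (pochhammer (c + 1) n)"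
    by simp
  have nz: "complex_of_real (pochhammer c n) \<noteq> 0" "complex_of_real (pochhammer (c + 1) n) \<noteq> 0"
    using pochhammer_pos[of c n] pochhammer_pos[of "c + 1" n] c by auto
  have "(H + fps_const (1 / of_real c) * (fps_X * fps_deriv H)) $ n = H $ n * ((of_real c + of_nat n) / of_real c)"
    using c by (cases n) (simp_all add: field_simps del: fps_hypergeo_nth)
  also have "\<dots> = fps_hypergeo [a, b] [complex_of_real c] 1 $ n"
    unfolding H_def fps_hypergeo_nth using eq nz c
    by (simp add: pochhammer_of_real divide_simps del: of_real_add) (simp add: algebra_simps)
  finally show "(H + fps_const (1 / of_real c) * (fps_X * fps_deriv H)) $ n
      = fps_hypergeo [a, b] [complex_of_real c] 1 $ n" .
qed

text \<open>Here n counts the lowering steps: c + n - b > 1 is the range of Euler's integral, and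
  every step applies the operator 1 + z/c d/dz, which preserves holomorphy.\<close>

lemma hypergeo_2_1_continuation:
  assumes a: "a > 0" and b: "b > 1" and c: "c > 0" and n: "c + real n > b + 1"
  shows "\<exists>f. f holomorphic_on slit_right \<and>
           f has_fps_expansion fps_hypergeo [complex_of_real a, complex_of_real b] [complex_of_real c] 1"
  using c n
proof (induction n arbitrary: c)
  case 0
  then have "c - b > 1" by simp
  have "(\<lambda>z. euler_integral a b (c - b) z / of_real (Beta b (c - b))) holomorphic_on slit_right"
  proof -
    have "Beta b (c - b) > 0" unfolding Beta_def using b \<open>c - b > 1\<close> by (simp add: Gamma_real_pos)
    then show ?thesis
      by (intro holomorphic_intros euler_integral_holomorphic b \<open>c - b > 1\<close>) auto
  qed
  then show ?case using euler_integral_fps[OF a b \<open>c - b > 1\<close>] by auto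
next
  case (Suc n)
  from Suc.IH[of "c + 1"] Suc.prems obtain f where f: "f holomorphic_on slit_right"
    "f has_fps_expansion fps_hypergeo [complex_of_real a, complex_of_real b] [complex_of_real (c + 1)] 1"
    by (auto simp: add_ac)
  have "(\<lambda>z. f z + 1 / of_real c * (z * deriv f z)) holomorphic_on slit_right"
    by (intro holomorphic_intros f slit_right)
  moreover have "(\<lambda>z. f z + 1 / of_real c * (z * deriv f z)) has_fps_expansion
      fps_hypergeo [complex_of_real a, complex_of_real b] [complex_of_real c] 1"
    unfolding hypergeo_2_1_fps_lower[OF Suc.prems(1), symmetric]
    by (intro fps_expansion_intros f)
  ultimately show ?case by blast
qed

text \<open>The choice operator in \<open>hyp2F1\<close> has meaning only if a continuation exists.
  The one just constructed provides it, and by uniqueness \<open>hyp2F1\<close> agrees with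
  it.\<close>

lemma hyp2F1_holomorphic_fps:
  assumes a: "a > 0" and b: "b > 1" and c: "c > 0"
  shows "hyp2F1 (of_real a) (of_real b) (of_real c) holomorphic_on slit_right"
    and "hyp2F1 (of_real a) (of_real b) (of_real c) has_fps_expansion
           fps_hypergeo [of_real a, of_real b] [of_real c] 1"
proof -
  let ?H = "fps_hypergeo [complex_of_real a, complex_of_real b] [complex_of_real c] 1"
  let ?F = "hyp2F1 (of_real a) (of_real b) (of_real c)"
  obtain n where "real n > b + 1 - c" using reals_Archimedean2 by blast
  then have "c + real n > b + 1" by simp
  from hypergeo_2_1_continuation[OF a b c this] obtain f
    where f: "f holomorphic_on slit_right" "f has_fps_expansion ?H" by blast
  have r: "fps_conv_radius ?H = 1" using fps_conv_radius_hypergeo_2_1 a b c by simp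
  have ser: "f z = eval_fps ?H z" if "z \<in> ball 0 1" for z
  proof -
    have "(\<lambda>z. f z - eval_fps ?H z) has_fps_expansion (?H - ?H)"
      by (intro fps_expansion_intros f eval_fps_has_fps_expansion) (simp add: r)
    moreover have "(\<lambda>z. f z - eval_fps ?H z) holomorphic_on ball 0 1"
      by (intro holomorphic_intros holomorphic_on_subset[OF f(1)] slit_right) (auto simp: r one_ereal_def)
    ultimately show ?thesis
      using has_fps_expansion_0_imp_zero[of "\<lambda>z. f z - eval_fps ?H z" "ball 0 1" z] that by auto
  qed
  have eq: "?F z = f z" if "z \<in> slit_right" for z
    by (rule hyp2F1_eqI) (use f ser that in \<open>auto simp: slit_right_def\<close>)
  show "?F holomorphic_on slit_right" using f(1) eq by (metis holomorphic_transform)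
  have "eventually (\<lambda>z. z \<in> slit_right) (nhds 0)"
    by (intro eventually_nhds_in_open slit_right)
  then have ev: "eventually (\<lambda>z. ?F z = f z) (nhds 0)" by eventually_elim (rule eq)
  have "eventually (\<lambda>z. eval_fps ?H z = f z) (nhds 0)"
    using f(2) by (simp add: has_fps_expansion_def)
  with ev have "eventually (\<lambda>z. eval_fps ?H z = ?F z) (nhds 0)" by eventually_elim simp
  then show "?F has_fps_expansion ?H" using f(2) by (simp add: has_fps_expansion_def)
qed

text \<open>The series identity says that the left side has zero expansion at 0; the identity
  theorem extends this to the cut plane, beyond the disc of convergence.\<close>

lemma hyp2F1_ode:
  fixes a b c :: real
  assumes a: "a > 0" and b: "b > 1" and c: "c > 0" and z: "z \<in> slit_right"
  defines "f \<equiv> hyp2F1 (of_real a) (of_real b) (of_real c)"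
  shows "z * (1 - z) * deriv (deriv f) z + (of_real c - of_real (a + b + 1) * z) * deriv f z - of_real (a * b) * f z = 0"
proof -
  note f = hyp2F1_holomorphic_fps[OF a b c, folded f_def]
  let ?g = "\<lambda>z. z * deriv (deriv f) z - z * (z * deriv (deriv f) z)
         + of_real c * deriv f z - of_real (a + b + 1) * (z * deriv f z) - of_real (a * b) * f z"
  have "?g holomorphic_on slit_right"
    by (intro holomorphic_intros f slit_right)
  moreover have "?g has_fps_expansion 0"
    unfolding hypergeo_2_1_fps_ode[OF c, of a b, symmetric]
    by (intro fps_expansion_intros f)
  ultimately have "?g z = 0"
    using has_fps_expansion_0_imp_zero slit_right z by blast
  then show ?thesis by (simp add: algebra_simps)
qed

lemma hyp1F1_fps:
  assumes "a > 0" "b > 0"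
  shows "hyp1F1 (of_real a) (of_real b) holomorphic_on UNIV"
    and "hyp1F1 (of_real a) (of_real b) has_fps_expansion fps_hypergeo [of_real a] [of_real b] 1"
proof -
  have eq: "hyp1F1 (of_real a) (of_real b) = eval_fps (fps_hypergeo [of_real a] [of_real b] 1)"
    by (simp add: fun_eq_iff hyp1F1_def)
  note r = fps_conv_radius_hypergeo_1_1[OF assms]
  show "hyp1F1 (of_real a) (of_real b) holomorphic_on UNIV"
    unfolding eq by (intro holomorphic_on_eval_fps) (simp add: r)
  show "hyp1F1 (of_real a) (of_real b) has_fps_expansion fps_hypergeo [of_real a] [of_real b] 1"
    unfolding eq by (intro eval_fps_has_fps_expansion) (simp add: r)
qed

lemma hyp1F1_ode:
  fixes a b :: real
  assumes a: "a > 0" and b: "b > 0"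
  defines "f \<equiv> hyp1F1 (of_real a) (of_real b)"
  shows "z * deriv (deriv f) z + (of_real b - z) * deriv f z - of_real a * f z = 0"
proof -
  note f = hyp1F1_fps[OF a b, folded f_def]
  let ?g = "\<lambda>z. z * deriv (deriv f) z + of_real b * deriv f z - z * deriv f z - of_real a * f z"
  have "?g holomorphic_on UNIV"
    by (intro holomorphic_intros f open_UNIV)
  moreover have "?g has_fps_expansion 0"
    unfolding hypergeo_1_1_fps_ode[OF b, of a, symmetric]
    by (intro fps_expansion_intros f)
  ultimately have "?g z = 0"
    using has_fps_expansion_0_imp_zero open_UNIV connected_UNIV UNIV_I by blast
  then show ?thesis by (simp add: algebra_simps)
qed

lemma hypergeometric_at_0:
  assumes "a > 0" "b > 1" "c > 0"
  shows "hyp1F1 (of_real a) (of_real c) 0 = 1" "hyp2F1 (of_real a) (of_real b) (of_real c) 0 = 1"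
proof -
  show "hyp1F1 (of_real a) (of_real c) 0 = 1"
    using has_fps_expansion_imp_0_eq_fps_nth_0[OF hyp1F1_fps(2)[OF assms(1,3)]]
    unfolding fps_hypergeo_0 .
  show "hyp2F1 (of_real a) (of_real b) (of_real c) 0 = 1"
    using has_fps_expansion_imp_0_eq_fps_nth_0[OF hyp2F1_holomorphic_fps(2)[OF assms]]
    unfolding fps_hypergeo_0 .
qed

section \<open>The confluent case\<close>

text \<open>The point 0 is put back because all paths start there. The set is not open at 0, but the
  radicands below stay off the cut there, so the roots are differentiable at 0 in the full
  sense.\<close>

definition slit_left :: "complex set" where
  "slit_left = insert 0 (- \<real>\<^sub>\<le>\<^sub>0)"

lemma Re_csqrt_pos:
  assumes "z \<notin> \<real>\<^sub>\<le>\<^sub>0"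
  shows "Re (csqrt z) > 0"
proof -
  have "z \<noteq> 0" using assms by auto
  have "Re (csqrt z) \<noteq> 0"
  proof
    assume "Re (csqrt z) = 0"
    then have "csqrt z ^ 2 = of_real (- (Im (csqrt z))\<^sup>2)"
      by (simp add: complex_eq_iff power2_eq_square)
    then have "z = of_real (- (Im (csqrt z))\<^sup>2)" by simp
    then have "z \<in> \<real>\<^sub>\<le>\<^sub>0" by (metis nonpos_Reals_of_real_iff neg_le_0_iff_le zero_le_power2)
    with assms show False by simp
  qed
  with csqrt_principal[of z] show ?thesis by auto
qed

text \<open>
  \<open>(\<eta> - 1)\<^sup>2 + 4\<kappa>\<eta> = A\<^sup>2 - 4\<kappa>(\<kappa> - 1)\<close> with \<open>A = \<eta> + 2\<kappa> - 1\<close>. Written as \<open>A\<close> times a principal square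
  root, the root is holomorphic across the line \<open>Re \<eta> = 1 - 2\<kappa>\<close>, so its values there need no limit.
\<close>

definition shift1 :: "real \<Rightarrow> complex \<Rightarrow> complex" where
  "shift1 \<kappa> z = z + (2 * of_real \<kappa> - 1)"

definition radicand1 :: "real \<Rightarrow> complex \<Rightarrow> complex" where
  "radicand1 \<kappa> z = 1 - 4 * of_real \<kappa> * (of_real \<kappa> - 1) / (shift1 \<kappa> z)\<^sup>2"

definition rt1 :: "real \<Rightarrow> complex \<Rightarrow> complex" where
  "rt1 \<kappa> z = shift1 \<kappa> z * csqrt (radicand1 \<kappa> z)"

text \<open>The formula for \<open>t1\<close> with its numerator rationalised, which removes the
  division by z and makes sense at z = 0.\<close>

definition saddle1 :: "real \<Rightarrow> complex \<Rightarrow> complex" where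
  "saddle1 \<kappa> z = 2 * of_real \<kappa> / (rt1 \<kappa> z + 1 - z)"

text \<open>The quantity X of \<open>laplace_main_eq\<close> at the saddle point, expressed by the
  root; see \<open>X1_eq_deriv2\<close>.\<close>

definition X1 :: "real \<Rightarrow> complex \<Rightarrow> complex" where
  "X1 \<kappa> z = rt1 \<kappa> z * (shift1 \<kappa> z - rt1 \<kappa> z) / (2 * of_real \<kappa>)"

text \<open>The constants normalise to the value 1 at z = 0, where the saddle point is \<kappa> and
  \<open>X1\<close> is (\<kappa> - 1)/\<kappa>.\<close>

definition wkb1 :: "real \<Rightarrow> real \<Rightarrow> complex \<Rightarrow> complex" where
  "wkb1 m \<kappa> z = of_real (sqrt ((\<kappa> - 1) / \<kappa>)) / csqrt (X1 \<kappa> z) *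
     exp (of_real m * (- phi1 \<kappa> z (saddle1 \<kappa> z) - of_real (\<kappa> * ln \<kappa> - (\<kappa> - 1) * ln (\<kappa> - 1))))"

context
  fixes \<kappa> :: real
  assumes \<kappa>: "\<kappa> > 1"
begin

lemma shift1_nz:
  assumes "z \<in> slit_left"
  shows "shift1 \<kappa> z \<noteq> 0"
proof
  assume "shift1 \<kappa> z = 0"
  then have "z = of_real (- (2 * \<kappa> - 1))" by (simp add: shift1_def algebra_simps eq_neg_iff_add_eq_0)
  moreover have "- (2 * \<kappa> - 1) < 0" using \<kappa> by simp
  ultimately show False
    using assms by (auto simp: slit_left_def complex_eq_iff complex_nonpos_Reals_iff)
qed

text \<open>A value r \<le> 0 would give A^2 = 4\<kappa>(\<kappa> - 1)/(1 - r) for the shifted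
  variable A. So A would be real with |A| < 2\<kappa> - 1, that is, z real and negative.\<close>

lemma radicand1_slit:
  assumes z: "z \<in> slit_left"
  shows "radicand1 \<kappa> z \<notin> \<real>\<^sub>\<le>\<^sub>0"
proof
  assume "radicand1 \<kappa> z \<in> \<real>\<^sub>\<le>\<^sub>0"
  then obtain r where r: "radicand1 \<kappa> z = of_real r" "r \<le> 0" by (elim nonpos_Reals_cases)
  define B where "B = 4 * \<kappa> * (\<kappa> - 1)"
  have B: "0 < B" "B < (2 * \<kappa> - 1)\<^sup>2" using \<kappa> by (auto simp: B_def power2_eq_square algebra_simps)
  define s where "s = B / (1 - r)"
  have "B * r \<le> 0" using r B by (simp add: mult_nonneg_nonpos)
  then have s: "0 \<le> s" "s \<le> B" using r B by (auto simp: s_def field_simps)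
  have "(shift1 \<kappa> z)\<^sup>2 * of_real (1 - r) = of_real B"
    using r(1) shift1_nz[OF z] by (simp add: radicand1_def B_def field_simps)
  then have "(shift1 \<kappa> z)\<^sup>2 = of_real s"
    using r unfolding s_def of_real_divide by (simp add: eq_divide_eq complex_eq_iff)
  also have "\<dots> = (of_real (sqrt s))\<^sup>2" using s by (simp flip: of_real_power)
  finally have "shift1 \<kappa> z = of_real (sqrt s) \<or> shift1 \<kappa> z = of_real (- sqrt s)"
    by (simp add: power2_eq_iff)
  then obtain x where x: "shift1 \<kappa> z = of_real x" "\<bar>x\<bar> = sqrt s" using s by auto
  have "sqrt s < sqrt ((2 * \<kappa> - 1)\<^sup>2)" using s B by (intro real_sqrt_less_mono) auto
  then have "x < 2 * \<kappa> - 1" using x \<kappa> by simp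
  moreover have "z = of_real (x - (2 * \<kappa> - 1))" using x(1) by (simp add: shift1_def algebra_simps)
  ultimately show False using z by (auto simp: slit_left_def complex_eq_iff complex_nonpos_Reals_iff)
qed

lemma rt1_square:
  assumes "z \<in> slit_left"
  shows "(rt1 \<kappa> z)\<^sup>2 = (shift1 \<kappa> z)\<^sup>2 - 4 * of_real \<kappa> * (of_real \<kappa> - 1)"
    and "(rt1 \<kappa> z)\<^sup>2 = (z - 1)\<^sup>2 + 4 * of_real \<kappa> * z"
proof -
  show *: "(rt1 \<kappa> z)\<^sup>2 = (shift1 \<kappa> z)\<^sup>2 - 4 * of_real \<kappa> * (of_real \<kappa> - 1)"
    using shift1_nz[OF assms] by (simp add: rt1_def power_mult_distrib radicand1_def field_simps)
  show "(rt1 \<kappa> z)\<^sup>2 = (z - 1)\<^sup>2 + 4 * of_real \<kappa> * z"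
    unfolding * by (simp add: shift1_def power2_eq_square algebra_simps)
qed

lemma rt1_nz:
  assumes "z \<in> slit_left"
  shows "rt1 \<kappa> z \<noteq> 0"
  using shift1_nz[OF assms] radicand1_slit[OF assms] by (auto simp: rt1_def)

lemma shift1_minus_rt1_nz:
  assumes "z \<in> slit_left"
  shows "shift1 \<kappa> z - rt1 \<kappa> z \<noteq> 0"
proof
  assume "shift1 \<kappa> z - rt1 \<kappa> z = 0"
  with rt1_square(1)[OF assms] have "complex_of_real (4 * \<kappa> * (\<kappa> - 1)) = 0" by simp
  then show False using \<kappa> by (simp only: of_real_eq_0_iff) simp
qed

text \<open>Behind the computation: R^2 - A^2 is constant and A' = 1, so R R' = A.\<close>

lemma rt1_deriv:
  assumes "z \<in> slit_left"
  shows "(rt1 \<kappa> has_field_derivative (shift1 \<kappa> z / rt1 \<kappa> z)) (at z)"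
proof -
  define b where "b = 4 * complex_of_real \<kappa> * (of_real \<kappa> - 1)"
  define c where "c = csqrt (radicand1 \<kappa> z)"
  have nz: "shift1 \<kappa> z \<noteq> 0" "c \<noteq> 0"
    using shift1_nz[OF assms] radicand1_slit[OF assms] by (auto simp: c_def)
  have "(shift1 \<kappa> has_field_derivative 1) (at z)"
    unfolding shift1_def[abs_def] by (auto intro!: derivative_eq_intros)
  then have "(radicand1 \<kappa> has_field_derivative (2 * b / (shift1 \<kappa> z) ^ 3)) (at z)"
    unfolding radicand1_def[abs_def] b_def[symmetric] using nz
    by (auto intro!: derivative_eq_intros simp: power2_eq_square power3_eq_cube field_simps)
  note d = DERIV_chain2[OF has_field_derivative_csqrt this, OF radicand1_slit[OF assms]]
  have "(rt1 \<kappa> has_field_derivative (c + shift1 \<kappa> z * (inverse (2 * c) * (2 * b / (shift1 \<kappa> z) ^ 3)))) (at z)"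
    unfolding rt1_def[abs_def]
    by (rule DERIV_cong[OF DERIV_mult[OF \<open>(shift1 \<kappa> has_field_derivative 1) (at z)\<close> d]])
      (simp add: c_def mult_ac)
  also have "c + shift1 \<kappa> z * (inverse (2 * c) * (2 * b / (shift1 \<kappa> z) ^ 3)) = (c\<^sup>2 + b / (shift1 \<kappa> z)\<^sup>2) / c"
    using nz by (simp add: field_simps power2_eq_square power3_eq_cube)
  also have "c\<^sup>2 + b / (shift1 \<kappa> z)\<^sup>2 = 1" by (simp add: c_def b_def radicand1_def)
  also have "1 / c = shift1 \<kappa> z / rt1 \<kappa> z" using nz by (simp add: rt1_def c_def)
  finally show ?thesis .
qed

lemma rt1_0: "rt1 \<kappa> 0 = 1"
proof -
  have "1 - 4 * \<kappa> * (\<kappa> - 1) / (2 * \<kappa> - 1)\<^sup>2 = 1 / (2 * \<kappa> - 1)\<^sup>2"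
    using \<kappa> by (simp add: divide_simps) (simp add: algebra_simps power2_eq_square)
  then have "complex_of_real (1 - 4 * \<kappa> * (\<kappa> - 1) / (2 * \<kappa> - 1)\<^sup>2) = of_real (1 / (2 * \<kappa> - 1)\<^sup>2)"
    by (simp only:)
  then have "radicand1 \<kappa> 0 = of_real (1 / (2 * \<kappa> - 1)\<^sup>2)"
    by (simp add: radicand1_def shift1_def)
  then have "csqrt (radicand1 \<kappa> 0) = of_real (1 / (2 * \<kappa> - 1))"
    using \<kappa> by (simp only: of_real_sqrt[symmetric] csqrt_of_real_nonneg) (simp add: real_sqrt_divide csqrt_of_real_nonneg)
  moreover have "shift1 \<kappa> 0 = of_real (2 * \<kappa> - 1)" by (simp add: shift1_def)
  ultimately show ?thesis
    unfolding rt1_def using \<kappa> by (simp only: of_real_mult[symmetric]) simp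
qed

text \<open>R is A times a number with positive real part, so P = Re (R cnj A) > 0; and R^2 and A^2
  have the same imaginary part. Together, Re R * P = Re A * ((Re R)^2 + (Im A)^2), so Re R inherits
  its sign from Re A.\<close>

lemma Re_rt1:
  assumes z: "z \<in> slit_left" and "Re z \<ge> 1 - 2 * \<kappa>"
  shows "Re (rt1 \<kappa> z) \<ge> 0" and "Re z > 1 - 2 * \<kappa> \<Longrightarrow> Re (rt1 \<kappa> z) > 0"
proof -
  define A where "A = shift1 \<kappa> z"
  define R where "R = rt1 \<kappa> z"
  define P where "P = Re R * Re A + Im R * Im A"
  have A: "Re A \<ge> 0" "A \<noteq> 0" using assms shift1_nz[OF z] by (auto simp: A_def shift1_def)
  have "Re (a * c * cnj a) = (cmod a)\<^sup>2 * Re c" for a c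
    unfolding cmod_power2 by (simp add: algebra_simps power2_eq_square)
  then have "Re (R * cnj A) = (cmod A)\<^sup>2 * Re (csqrt (radicand1 \<kappa> z))"
    unfolding R_def rt1_def A_def .
  then have pos: "P > 0"
    using Re_csqrt_pos[OF radicand1_slit[OF z]] A(2) by (simp add: P_def)
  have "Im (R\<^sup>2) = Im (A\<^sup>2)" unfolding R_def A_def rt1_square(1)[OF z] by simp
  then have im: "Re R * Im R = Re A * Im A" by (simp add: power2_eq_square mult.commute)
  have "Re R * P = Re A * (Re R)\<^sup>2 + Im A * (Re R * Im R)"
    by (simp add: P_def algebra_simps power2_eq_square)
  also have "\<dots> = Re A * ((Re R)\<^sup>2 + (Im A)\<^sup>2)" unfolding im by (simp add: algebra_simps power2_eq_square)
  finally have eq: "Re R * P = Re A * ((Re R)\<^sup>2 + (Im A)\<^sup>2)" .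
  then have "Re R * P \<ge> 0" using A by simp
  then show R0: "Re (rt1 \<kappa> z) \<ge> 0" using pos by (simp add: R_def zero_le_mult_iff)
  show "Re (rt1 \<kappa> z) > 0" if "Re z > 1 - 2 * \<kappa>"
  proof (rule ccontr)
    assume "\<not> Re (rt1 \<kappa> z) > 0"
    with R0 have "Re R = 0" by (simp add: R_def)
    moreover have "Re A > 0" using that by (simp add: A_def shift1_def)
    ultimately have "Im A = 0" using eq by simp
    with \<open>Re R = 0\<close> pos show False by (simp add: P_def)
  qed
qed

lemma saddle1_denom_nz:
  assumes z: "z \<in> slit_left"
  shows "rt1 \<kappa> z + 1 - z \<noteq> 0"
proof (cases "z = 0")
  case False
  have "(rt1 \<kappa> z + 1 - z) * (rt1 \<kappa> z - 1 + z) = (rt1 \<kappa> z)\<^sup>2 - (z - 1)\<^sup>2"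
    by (simp add: algebra_simps power2_eq_square)
  also have "\<dots> \<noteq> 0" unfolding rt1_square(2)[OF z] using False \<kappa> by simp
  finally show ?thesis by auto
qed (simp add: rt1_0)

text \<open>The product on the left is the order-m part u of the logarithmic derivative of
  \<open>wkb1\<close>; the right side also links \<open>saddle1\<close> to
  \<open>t1\<close>.\<close>

lemma saddle1_mult:
  assumes z: "z \<in> slit_left"
  shows "z * saddle1 \<kappa> z = (rt1 \<kappa> z - 1 + z) / 2"
proof -
  have "(rt1 \<kappa> z + 1 - z) * (rt1 \<kappa> z - 1 + z) = (rt1 \<kappa> z)\<^sup>2 - (z - 1)\<^sup>2"
    by (simp add: algebra_simps power2_eq_square)
  also have "\<dots> = 4 * of_real \<kappa> * z" unfolding rt1_square(2)[OF z] by simp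
  finally show ?thesis
    unfolding saddle1_def using saddle1_denom_nz[OF z] by (simp add: field_simps)
qed

lemma saddle1_nz: "z \<in> slit_left \<Longrightarrow> saddle1 \<kappa> z \<noteq> 0"
  unfolding saddle1_def using saddle1_denom_nz[of z] \<kappa> by simp

text \<open>This is the saddle point equation for \<open>phi1\<close>, multiplied by -t (t -
  1).\<close>

lemma saddle1_quadratic:
  assumes z: "z \<in> slit_left"
  shows "z * (saddle1 \<kappa> z)\<^sup>2 + (1 - z) * saddle1 \<kappa> z - of_real \<kappa> = 0"
proof -
  have "z * (saddle1 \<kappa> z)\<^sup>2 + (1 - z) * saddle1 \<kappa> z = (z * saddle1 \<kappa> z + (1 - z)) * saddle1 \<kappa> z"
    by (simp add: algebra_simps power2_eq_square)
  also have "z * saddle1 \<kappa> z + (1 - z) = (rt1 \<kappa> z + 1 - z) / 2"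
    unfolding saddle1_mult[OF z] by (simp add: field_simps)
  also have "\<dots> * saddle1 \<kappa> z = of_real \<kappa>"
    unfolding saddle1_def using saddle1_denom_nz[OF z] by simp
  finally show ?thesis by simp
qed

text \<open>Keeps the principal logarithms in \<open>phi1\<close> holomorphic at the saddle point.
  The quadratic recovers z from a real saddle point x \<le> 1: for 0 < x < 1 it is negative, which
  is excluded; for x < 0 it is positive, but then Re R \<ge> 0 selects the positive root and hence a
  positive saddle point.\<close>

lemma saddle1_slit:
  assumes z: "z \<in> slit_left" and Re: "Re z \<ge> 1 - 2 * \<kappa>"
  shows "saddle1 \<kappa> z - 1 \<notin> \<real>\<^sub>\<le>\<^sub>0" "saddle1 \<kappa> z \<notin> \<real>\<^sub>\<le>\<^sub>0" "saddle1 \<kappa> z \<noteq> 1"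
proof -
  show *: "saddle1 \<kappa> z - 1 \<notin> \<real>\<^sub>\<le>\<^sub>0"
  proof
    assume "saddle1 \<kappa> z - 1 \<in> \<real>\<^sub>\<le>\<^sub>0"
    then obtain x' where "saddle1 \<kappa> z - 1 = of_real x'" "x' \<le> 0" by (elim nonpos_Reals_cases)
    then obtain x where x: "saddle1 \<kappa> z = of_real x" "x \<le> 1"
      by (intro that[of "x' + 1"]) (auto simp: algebra_simps)
    have q: "z * of_real (x * (x - 1)) = of_real (\<kappa> - x)"
      using saddle1_quadratic[OF z] unfolding x by (simp add: algebra_simps power2_eq_square)
    have x0: "x \<noteq> 0" "x \<noteq> 1" using q \<kappa> by auto
    define y where "y = (\<kappa> - x) / (x * (x - 1))"
    have zy: "z = of_real y" unfolding y_def of_real_divide q[symmetric] using x0 by simp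
    show False
    proof (cases "x > 0")
      case True
      then have "x * (x - 1) < 0" using x x0 by (simp add: mult_less_0_iff)
      then have "y < 0" unfolding y_def using \<kappa> x by (intro divide_pos_neg) auto
      then show False using z zy by (auto simp: slit_left_def)
    next
      case False
      then have "x < 0" using x0 by simp
      then have y: "y > 0" unfolding y_def using \<kappa> by (intro divide_pos_pos mult_neg_neg) auto
      define w where "w = (y - 1)\<^sup>2 + 4 * \<kappa> * y"
      have w: "w > (y - 1)\<^sup>2" using y \<kappa> by (simp add: w_def)
      then have w0: "w > 0" using zero_le_power2[of "y - 1"] by linarith
      have "(rt1 \<kappa> z)\<^sup>2 = of_real w" by (subst rt1_square(2)[OF z]) (simp add: zy w_def)
      also have "\<dots> = (of_real (sqrt w))\<^sup>2" using w0 by (simp flip: of_real_power)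
      finally have "rt1 \<kappa> z = of_real (sqrt w) \<or> rt1 \<kappa> z = of_real (- sqrt w)"
        by (simp add: power2_eq_iff)
      then have rw: "rt1 \<kappa> z = of_real (sqrt w)" using Re_rt1(1)[OF z Re] w0 by auto
      have "sqrt ((y - 1)\<^sup>2) < sqrt w" using w by (rule real_sqrt_less_mono)
      then have p: "sqrt w + 1 - y > 0" by simp
      have "saddle1 \<kappa> z = of_real (2 * \<kappa> / (sqrt w + 1 - y))"
        unfolding saddle1_def rw by (simp add: zy)
      then have "x = 2 * \<kappa> / (sqrt w + 1 - y)" unfolding x by (simp only: of_real_eq_iff)
      then have "x > 0" using p \<kappa> by simp
      with \<open>x < 0\<close> show False by simp
    qed
  qed
  then show "saddle1 \<kappa> z \<notin> \<real>\<^sub>\<le>\<^sub>0"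
    by (auto simp: complex_nonpos_Reals_iff)
  show "saddle1 \<kappa> z \<noteq> 1" using * by auto
qed

lemma saddle1_deriv:
  assumes z: "z \<in> slit_left"
  shows "\<exists>d. (saddle1 \<kappa> has_field_derivative d) (at z)"
  unfolding saddle1_def[abs_def]
  using DERIV_divide[OF DERIV_const DERIV_diff[OF DERIV_add[OF rt1_deriv[OF z] DERIV_const] DERIV_ident]
      saddle1_denom_nz[OF z]]
  by blast

text \<open>At a stationary point the motion of t contributes nothing, so only the explicit
  dependence of -\<open>phi1\<close> on \<eta> remains, whose derivative is t.\<close>

lemma phi1_saddle_deriv:
  assumes z: "z \<in> slit_left" and Re: "Re z \<ge> 1 - 2 * \<kappa>"
  shows "((\<lambda>z. - phi1 \<kappa> z (saddle1 \<kappa> z)) has_field_derivative saddle1 \<kappa> z) (at z)"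
proof -
  obtain d where d: "(saddle1 \<kappa> has_field_derivative d) (at z)" using saddle1_deriv[OF z] by blast
  define t where "t = saddle1 \<kappa> z"
  have t: "t \<notin> \<real>\<^sub>\<le>\<^sub>0" "t - 1 \<notin> \<real>\<^sub>\<le>\<^sub>0" using saddle1_slit[OF z Re] by (auto simp: t_def)
  then have nz: "t \<noteq> 0" "t - 1 \<noteq> 0" by auto
  have "((\<lambda>z. - phi1 \<kappa> z (saddle1 \<kappa> z)) has_field_derivative
      (t + d * (z + of_real \<kappa> / t - of_real (\<kappa> - 1) / (t - 1)))) (at z)"
    unfolding phi1_def
    by (rule derivative_eq_intros d refl t[unfolded t_def])+ (simp add: t_def field_simps)
  also have "z + of_real \<kappa> / t - of_real (\<kappa> - 1) / (t - 1) = (z * t\<^sup>2 + (1 - z) * t - of_real \<kappa>) / (t * (t - 1))"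
    using nz by (simp add: field_simps power2_eq_square)
  also have "\<dots> = 0" using saddle1_quadratic[OF z] by (simp add: t_def)
  finally show ?thesis by (simp add: t_def)
qed

text \<open>This form exhibits the half-plane: c/(1 + c) has positive real part whenever c
  has.\<close>

lemma X1_eq:
  assumes z: "z \<in> slit_left"
  shows "X1 \<kappa> z = of_real (2 * (\<kappa> - 1)) * (csqrt (radicand1 \<kappa> z) / (1 + csqrt (radicand1 \<kappa> z)))"
proof -
  define c where "c = csqrt (radicand1 \<kappa> z)"
  define A where "A = shift1 \<kappa> z"
  have "Re c > 0" unfolding c_def by (rule Re_csqrt_pos[OF radicand1_slit[OF z]])
  then have c1: "1 + c \<noteq> 0" by (auto simp: complex_eq_iff)
  have "A\<^sup>2 * (1 - c) * (1 + c) = A\<^sup>2 - (rt1 \<kappa> z)\<^sup>2"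
    by (simp add: rt1_def A_def c_def algebra_simps power2_eq_square)
  also have "\<dots> = 4 * of_real \<kappa> * (of_real \<kappa> - 1)" unfolding rt1_square(1)[OF z] A_def by simp
  finally have "A\<^sup>2 * (1 - c) = 4 * of_real \<kappa> * (of_real \<kappa> - 1) / (1 + c)" using c1 by (simp add: field_simps)
  moreover have "X1 \<kappa> z = A\<^sup>2 * (1 - c) * c / (2 * of_real \<kappa>)"
    by (simp add: X1_def rt1_def A_def c_def algebra_simps power2_eq_square)
  ultimately have "X1 \<kappa> z = 4 * of_real \<kappa> * (of_real \<kappa> - 1) / (1 + c) * c / (2 * of_real \<kappa>)"
    by (simp only:)
  also have "4 * of_real \<kappa> * (of_real \<kappa> - 1) / (1 + c) * c
      = (2 * of_real \<kappa>) * (of_real (2 * (\<kappa> - 1)) * (c / (1 + c)))" by simp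
  also have "\<dots> / (2 * of_real \<kappa>) = of_real (2 * (\<kappa> - 1)) * (c / (1 + c))"
    using \<kappa> by (intro nonzero_mult_div_cancel_left) simp
  finally show ?thesis unfolding c_def .
qed

text \<open>Serves twice: \<open>csqrt (X1 \<kappa> z)\<close> stays off its cut, and the branch
  condition on \<omega> can be met.\<close>

lemma X1_pos:
  assumes z: "z \<in> slit_left"
  shows "Re (X1 \<kappa> z) > 0"
proof -
  define c where "c = csqrt (radicand1 \<kappa> z)"
  have c: "Re c > 0" unfolding c_def by (rule Re_csqrt_pos[OF radicand1_slit[OF z]])
  define w where "w = c / (1 + c)"
  have "Re w > 0"
    unfolding w_def using c by (auto simp: Re_divide algebra_simps intro!: divide_pos_pos add_pos_nonneg sum_power2_gt_zero_iff[THEN iffD2])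
  then show ?thesis unfolding X1_eq[OF z] c_def[symmetric] w_def[symmetric] using \<kappa> by simp
qed

lemma X1_deriv:
  assumes z: "z \<in> slit_left"
  shows "(X1 \<kappa> has_field_derivative ((shift1 \<kappa> z - rt1 \<kappa> z)\<^sup>2 / (2 * of_real \<kappa> * rt1 \<kappa> z))) (at z)"
proof -
  have "(shift1 \<kappa> has_field_derivative 1) (at z)"
    unfolding shift1_def[abs_def] by (auto intro!: derivative_eq_intros)
  from DERIV_cdivide[OF DERIV_mult[OF rt1_deriv[OF z] DERIV_diff[OF this rt1_deriv[OF z]]]]
  show ?thesis
    unfolding X1_def[abs_def]
    by (rule DERIV_cong) (use rt1_nz[OF z] \<kappa> in \<open>simp add: field_simps power2_eq_square\<close>)
qed

text \<open>The exponential contributes m t and the amplitude -X'/(2X) with X = \<open>X1\<close>,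
  in which the factor A - R cancels once.\<close>

lemma wkb1_deriv:
  assumes z: "z \<in> slit_left" and Re: "Re z \<ge> 1 - 2 * \<kappa>"
  shows "(wkb1 m \<kappa> has_field_derivative
     ((of_real m * saddle1 \<kappa> z - (shift1 \<kappa> z - rt1 \<kappa> z) / (2 * (rt1 \<kappa> z)\<^sup>2)) * wkb1 m \<kappa> z)) (at z)"
proof -
  have X: "X1 \<kappa> z \<notin> \<real>\<^sub>\<le>\<^sub>0" using X1_pos[OF z] by (auto simp: complex_nonpos_Reals_iff)
  then have X0: "X1 \<kappa> z \<noteq> 0" "csqrt (X1 \<kappa> z) \<noteq> 0" by auto
  define s where "s = csqrt (X1 \<kappa> z)"
  have s2: "s\<^sup>2 = X1 \<kappa> z" "s \<noteq> 0" using X0 by (auto simp: s_def)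
  define D where "D = (shift1 \<kappa> z - rt1 \<kappa> z)\<^sup>2 / (2 * of_real \<kappa> * rt1 \<kappa> z)"
  note ds = DERIV_chain2[OF has_field_derivative_csqrt[OF X] X1_deriv[OF z], folded s_def D_def]
  define q where "q = complex_of_real (sqrt ((\<kappa> - 1) / \<kappa>))"
  define c0 where "c0 = complex_of_real (\<kappa> * ln \<kappa> - (\<kappa> - 1) * ln (\<kappa> - 1))"
  define e where "e = exp (of_real m * (- phi1 \<kappa> z (saddle1 \<kappa> z) - c0))"
  have "(wkb1 m \<kappa> has_field_derivative
     (- (inverse (2 * s) * D) / s\<^sup>2 * q * e + q / s * (of_real m * saddle1 \<kappa> z * e))) (at z)"
  proof -
    have "((\<lambda>z. exp (of_real m * (- phi1 \<kappa> z (saddle1 \<kappa> z) - c0))) has_field_derivative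
        (of_real m * saddle1 \<kappa> z * e)) (at z)"
      unfolding e_def
      by (rule derivative_eq_intros phi1_saddle_deriv[OF z Re] refl)+ simp
    from DERIV_mult[OF DERIV_divide[OF DERIV_const ds X0(2)] this]
    show ?thesis
      unfolding wkb1_def[abs_def] q_def[symmetric] c0_def[symmetric]
      by (rule DERIV_cong) (simp add: s_def[symmetric] e_def[symmetric] power2_eq_square mult_ac)
  qed
  also have "- (inverse (2 * s) * D) / s\<^sup>2 * q * e + q / s * (of_real m * saddle1 \<kappa> z * e)
      = (of_real m * saddle1 \<kappa> z - D / (2 * s\<^sup>2)) * (q / s * e)"
    using s2 by (simp add: field_simps power2_eq_square)
  also have "D / (2 * s\<^sup>2) = (shift1 \<kappa> z - rt1 \<kappa> z) / (2 * (rt1 \<kappa> z)\<^sup>2)"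
    unfolding s2 D_def X1_def using rt1_nz[OF z] shift1_minus_rt1_nz[OF z] \<kappa>
    by (simp add: field_simps power2_eq_square)
  also have "q / s * e = wkb1 m \<kappa> z" by (simp add: wkb1_def q_def s_def e_def c0_def)
  finally show ?thesis .
qed

lemma wkb1_nz:
  assumes z: "z \<in> slit_left"
  shows "wkb1 m \<kappa> z \<noteq> 0"
proof -
  have "X1 \<kappa> z \<noteq> 0" using X1_pos[OF z] by auto
  then show ?thesis using \<kappa> by (simp add: wkb1_def)
qed

lemma wkb1_0: "wkb1 m \<kappa> 0 = 1"
proof -
  have t: "saddle1 \<kappa> 0 = of_real \<kappa>" by (simp add: saddle1_def rt1_0)
  have "X1 \<kappa> 0 = of_real ((\<kappa> - 1) / \<kappa>)" using \<kappa> by (simp add: X1_def rt1_0 shift1_def field_simps)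
  then have "csqrt (X1 \<kappa> 0) = of_real (sqrt ((\<kappa> - 1) / \<kappa>))"
    using \<kappa> by (simp only: csqrt_of_real_nonneg of_real_sqrt) simp
  moreover have "phi1 \<kappa> 0 (of_real \<kappa>) = of_real (- (\<kappa> * ln \<kappa> - (\<kappa> - 1) * ln (\<kappa> - 1)))"
  proof -
    have "Ln (complex_of_real \<kappa> - 1) = of_real (ln (\<kappa> - 1))"
      using Ln_of_real[of "\<kappa> - 1"] \<kappa> by simp
    then show ?thesis using \<kappa> by (simp add: phi1_def Ln_of_real)
  qed
  ultimately show ?thesis using \<kappa> by (simp add: wkb1_def t)
qed

end

section \<open>Identification with the saddle point term, confluent case\<close>

text \<open>To the right of the critical line Re \<open>rt1\<close> > 0 makes it the principal root;
  on the line the prescribed limit is its value by continuity.\<close>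

lemma root1_eq_rt1:
  assumes \<kappa>: "\<kappa> > 1" and z: "z \<in> slit_left" "z \<noteq> 0" and Re: "Re z \<ge> 1 - 2 * \<kappa>"
  shows "root1 \<kappa> z = rt1 \<kappa> z"
proof -
  have eq: "csqrt ((w - 1)\<^sup>2 + 4 * of_real \<kappa> * w) = rt1 \<kappa> w"
    if "w \<in> slit_left" "Re w > 1 - 2 * \<kappa>" for w
    unfolding rt1_square(2)[OF \<kappa> that(1), symmetric] using Re_rt1(2)[OF \<kappa> that(1) _ that(2)] that
    by (intro csqrt_square) auto
  show ?thesis
  proof (cases "Re z = 1 - 2 * \<kappa>")
    case False
    then show ?thesis using eq[OF z(1)] Re by (simp add: root1_def)
  next
    case True
    let ?S = "{w. Re w > 1 - 2 * \<kappa>}"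
    \<comment> \<open>\<open>Lim\<close> has a determined value only where limits are unique, so z
      must be a limit point of the half-plane.\<close>
    have "z \<in> closure (?S - {z})"
    proof -
      have "?S - {z} = {w. (1::complex) \<bullet> w > 1 - 2 * \<kappa>}" using True by (auto simp: inner_complex_def)
      moreover have "closure {w. (1::complex) \<bullet> w > 1 - 2 * \<kappa>} = {w. (1::complex) \<bullet> w \<ge> 1 - 2 * \<kappa>}"
        by (rule closure_halfspace_gt) simp
      ultimately show ?thesis using True by (simp add: inner_complex_def)
    qed
    then have nt: "at z within ?S \<noteq> bot" by (simp add: trivial_limit_within islimpt_in_closure)
    have "open (- \<real>\<^sub>\<le>\<^sub>0 :: complex set)" by (simp add: open_Compl)
    moreover have "z \<in> - \<real>\<^sub>\<le>\<^sub>0" using z by (simp add: slit_left_def)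
    ultimately have "eventually (\<lambda>w. w \<in> - \<real>\<^sub>\<le>\<^sub>0) (at z within ?S)"
      using eventually_at_topological by blast
    moreover have "eventually (\<lambda>w. w \<in> ?S) (at z within ?S)" by (simp add: eventually_at_filter)
    ultimately have "eventually (\<lambda>w. rt1 \<kappa> w = csqrt ((w - 1)\<^sup>2 + 4 * of_real \<kappa> * w)) (at z within ?S)"
      by eventually_elim (subst eq, auto simp: slit_left_def)
    moreover have "(rt1 \<kappa> \<longlongrightarrow> rt1 \<kappa> z) (at z within ?S)"
      using DERIV_isCont[OF rt1_deriv[OF \<kappa> z(1)]] by (metis continuous_at_imp_continuous_at_within continuous_within)
    ultimately have "((\<lambda>w. csqrt ((w - 1)\<^sup>2 + 4 * of_real \<kappa> * w)) \<longlongrightarrow> rt1 \<kappa> z) (at z within ?S)"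
      by (rule Lim_transform_eventually[rotated])
    then show ?thesis using tendsto_Lim[OF nt] True by (simp add: root1_def)
  qed
qed

lemma t1_eq_saddle1:
  assumes "\<kappa> > 1" "z \<in> slit_left" "z \<noteq> 0" "Re z \<ge> 1 - 2 * \<kappa>"
  shows "t1 \<kappa> z = saddle1 \<kappa> z"
proof -
  have "saddle1 \<kappa> z = z * saddle1 \<kappa> z / z" using assms(3) by simp
  then show ?thesis
    unfolding t1_def root1_eq_rt1[OF assms] saddle1_mult[OF assms(1,2)] by (simp add: field_simps)
qed

lemma phi1_deriv2:
  assumes t: "t - 1 \<notin> \<real>\<^sub>\<le>\<^sub>0"
  shows "deriv (deriv (phi1 \<kappa> \<eta>)) t = of_real \<kappa> / t\<^sup>2 - of_real (\<kappa> - 1) / (t - 1)\<^sup>2"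
proof -
  let ?S = "(\<lambda>s. s - 1) -` (- \<real>\<^sub>\<le>\<^sub>0 :: complex set)"
  have op: "open ?S"
    by (intro open_vimage) (auto intro!: continuous_intros simp: open_Compl)
  have slit: "s \<notin> \<real>\<^sub>\<le>\<^sub>0" "s - 1 \<notin> \<real>\<^sub>\<le>\<^sub>0" "s \<noteq> 0" "s - 1 \<noteq> 0" if "s \<in> ?S" for s
    using that by (auto simp: complex_nonpos_Reals_iff)
  have d1: "deriv (phi1 \<kappa> \<eta>) s = - \<eta> - of_real \<kappa> / s + of_real (\<kappa> - 1) / (s - 1)" if "s \<in> ?S" for s
  proof (rule DERIV_imp_deriv)
    show "(phi1 \<kappa> \<eta> has_field_derivative - \<eta> - of_real \<kappa> / s + of_real (\<kappa> - 1) / (s - 1)) (at s)"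
      unfolding phi1_def[abs_def] using slit[OF that]
      by (auto intro!: derivative_eq_intros simp: divide_inverse)
  qed
  have "((\<lambda>s. - \<eta> - of_real \<kappa> / s + of_real (\<kappa> - 1) / (s - 1)) has_field_derivative
      (of_real \<kappa> / t\<^sup>2 - of_real (\<kappa> - 1) / (t - 1)\<^sup>2)) (at t)"
    using slit[of t] t
    by (auto intro!: derivative_eq_intros simp: power2_eq_square diff_divide_distrib)
  then have "(deriv (phi1 \<kappa> \<eta>) has_field_derivative
      (of_real \<kappa> / t\<^sup>2 - of_real (\<kappa> - 1) / (t - 1)\<^sup>2)) (at t)"
    by (rule has_field_derivative_transform_within_open[OF _ op]) (use t d1 in auto)
  then show ?thesis by (rule DERIV_imp_deriv)
qed

text \<open>With t the saddle point, (t - 1)/t = (A - R)/(2\<kappa>), so -(t - 1)^2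
  \<open>phi1\<close>'' = (\<kappa> - 1) - \<kappa> ((t - 1)/t)^2 becomes polynomial in A and R, and
  4\<kappa>(\<kappa> - 1) = A^2 - R^2.\<close>

lemma X1_eq_deriv2:
  assumes \<kappa>: "\<kappa> > 1" and z: "z \<in> slit_left" and Re: "Re z \<ge> 1 - 2 * \<kappa>"
  shows "X1 \<kappa> z = - ((saddle1 \<kappa> z - 1)\<^sup>2 * deriv (deriv (phi1 \<kappa> z)) (saddle1 \<kappa> z))"
proof -
  define t where "t = saddle1 \<kappa> z"
  define A where "A = shift1 \<kappa> z"
  define R where "R = rt1 \<kappa> z"
  define k where "k = complex_of_real \<kappa>"
  have k: "k \<noteq> 0" using \<kappa> by (simp add: k_def)
  have t: "t \<noteq> 0" "t - 1 \<noteq> 0"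
    using saddle1_nz[OF \<kappa> z] saddle1_slit(3)[OF \<kappa> z Re] by (auto simp: t_def)
  have "t * (R + 1 - z) = 2 * k"
    unfolding t_def saddle1_def R_def k_def using saddle1_denom_nz[OF \<kappa> z] by simp
  then have w: "(t - 1) / t = (A - R) / (2 * k)"
    using t k by (simp add: A_def shift1_def k_def[symmetric] field_simps)
  have "- ((t - 1)\<^sup>2 * deriv (deriv (phi1 \<kappa> z)) t) = (k - 1) - k * ((t - 1) / t)\<^sup>2"
    unfolding t_def phi1_deriv2[OF saddle1_slit(1)[OF \<kappa> z Re]] unfolding t_def[symmetric]
    using t by (simp add: k_def power_divide right_diff_distrib mult_ac)
  also have "\<dots> = (4 * k * (k - 1) - (A - R)\<^sup>2) / (4 * k)"
    unfolding w using k by (simp add: field_simps power2_eq_square)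
  also have "4 * k * (k - 1) = A\<^sup>2 - R\<^sup>2"
    unfolding A_def R_def k_def rt1_square(1)[OF \<kappa> z] by simp
  also have "(A\<^sup>2 - R\<^sup>2 - (A - R)\<^sup>2) / (4 * k) = X1 \<kappa> z"
    unfolding X1_def A_def[symmetric] R_def[symmetric] k_def[symmetric] using k
    by (simp add: field_simps power2_eq_square)
  finally show ?thesis by (simp add: t_def)
qed

text \<open>Here \<open>psi1 t * (t - 1) = 1\<close>, and Stirling's formula turns
  \<open>C_const\<close> into exactly the normalising constants of \<open>wkb1\<close>.\<close>

lemma laplace_main_wkb1:
  assumes m: "m > 0" and \<kappa>: "\<kappa> > 1" and z: "z \<in> slit_left" "z \<noteq> 0" and Re: "Re z \<ge> 1 - 2 * \<kappa>"
  shows "laplace_main m \<kappa> (phi1 \<kappa> z) psi1 (t1 \<kappa> z)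
     = of_real (exp (stirling_rem m + stirling_rem (m * (\<kappa> - 1)) - stirling_rem (m * \<kappa>))) * wkb1 m \<kappa> z"
proof -
  define \<rho> where "\<rho> = stirling_rem m + stirling_rem (m * (\<kappa> - 1)) - stirling_rem (m * \<kappa>)"
  define c0 where "c0 = \<kappa> * ln \<kappa> - (\<kappa> - 1) * ln (\<kappa> - 1)"
  define t where "t = saddle1 \<kappa> z"
  have t: "t \<noteq> 1" using saddle1_slit(3)[OF \<kappa> z(1) Re] by (simp add: t_def)
  have X: "X1 \<kappa> z \<noteq> 0" "Re (X1 \<kappa> z) \<ge> 0" using X1_pos[OF \<kappa> z(1)] by auto
  have C: "C_const m \<kappa> / sqrt (2 * pi * m) = sqrt ((\<kappa> - 1) / \<kappa>) * exp (- m * c0) * exp \<rho>"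
    unfolding C_const_stirling[OF m \<kappa>] c0_def[symmetric] \<rho>_def[symmetric] real_sqrt_mult[of "2 * pi * m"]
    using m by simp
  have "laplace_main m \<kappa> (phi1 \<kappa> z) psi1 t
     = of_real (C_const m \<kappa> / sqrt (2 * pi * m)) * (psi1 t * (t - 1)) / csqrt (X1 \<kappa> z) * exp (- of_real m * phi1 \<kappa> z t)"
    by (rule laplace_main_eq[OF m t _ X]) (use X1_eq_deriv2[OF \<kappa> z(1) Re] in \<open>simp add: t_def\<close>)
  also have "psi1 t * (t - 1) = 1" using t by (simp add: psi1_def)
  also have "of_real (C_const m \<kappa> / sqrt (2 * pi * m)) * 1 / csqrt (X1 \<kappa> z) * exp (- of_real m * phi1 \<kappa> z t)
    = of_real (exp \<rho>) * (of_real (sqrt ((\<kappa> - 1) / \<kappa>)) / csqrt (X1 \<kappa> z)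
       * (exp (of_real (- m * c0)) * exp (- of_real m * phi1 \<kappa> z t)))"
    unfolding C exp_of_real by simp
  also have "exp (of_real (- m * c0)) * exp (- of_real m * phi1 \<kappa> z t) = exp (of_real m * (- phi1 \<kappa> z t - of_real c0))"
    unfolding exp_add[symmetric] by (rule arg_cong[of _ _ exp]) (simp add: algebra_simps)
  finally show ?thesis
    unfolding t1_eq_saddle1[OF \<kappa> z Re] \<rho>_def wkb1_def t_def c0_def .
qed

text \<open>
  The residual of the approximate solution, divided by \<open>z R\<close>, as a function of the value \<open>R\<close> of the
  root; uniform bounds then need only compactness of a set of triples \<open>(\<kappa>, z, R)\<close>.
\<close>

definition err1 :: "real \<Rightarrow> complex \<Rightarrow> complex \<Rightarrow> complex" where
  "err1 \<kappa> z R = (let A = shift1 \<kappa> z in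
     ((R - A) / (2 * R ^ 2) + z * ((A - R) / (2 * R ^ 3) - (R - A) * A / R ^ 4) + z * (R - A) ^ 2 / (4 * R ^ 4)) / R)"

text \<open>Applies \<open>wkb_along_path\<close> on the ray z = r \<eta>. Both error coefficients
  carry a factor z, so their bounds by K r reduce to bounds with \<eta> in front.\<close>

lemma F1_wkb1_estimate:
  fixes m \<kappa> K :: real and \<eta> :: complex
  defines "C \<equiv> K * (exp K + 1) + exp K"
  assumes K: "K > 0" and m: "m \<ge> 2 * C" and \<kappa>: "\<kappa> > 1"
    and \<eta>: "\<eta> \<in> slit_left" and Re: "Re \<eta> \<ge> 1 - 2 * \<kappa>"
    and bound1: "\<And>r. 0 < r \<Longrightarrow> r < 1 \<Longrightarrow> cmod (\<eta> / rt1 \<kappa> (of_real r * \<eta>)) \<le> K"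
    and bound2: "\<And>r. 0 < r \<Longrightarrow> r < 1 \<Longrightarrow> cmod (\<eta> * err1 \<kappa> (of_real r * \<eta>) (rt1 \<kappa> (of_real r * \<eta>))) \<le> K"
  shows "cmod (F1 m \<kappa> \<eta> / wkb1 m \<kappa> \<eta> - 1) \<le> 2 * C / m"
proof -
  have C: "C > 0" unfolding C_def using K by (simp add: add_pos_pos)
  have m0: "m > 0" using m C by linarith
  define f where "f = hyp1F1 (of_real (m * \<kappa> + 1)) (of_real (m + 1))"
  have ab: "m * \<kappa> + 1 > 0" "m + 1 > 0" using m0 \<kappa> by (auto intro!: add_pos_pos)
  note fh = hyp1F1_fps(1)[OF ab, folded f_def]
  define \<gamma> where "\<gamma> = (\<lambda>r. of_real r * \<eta>)"
  define M :: complex where "M = of_real m"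
  define k :: complex where "k = of_real \<kappa>"
  let ?R = "rt1 \<kappa>" and ?A = "shift1 \<kappa>"
  \<comment> \<open>The part of D log \<open>wkb1\<close> free of m, due to the amplitude;
    \<open>l'\<close> is its derivative.\<close>
  define l where "l = (\<lambda>z. z * (?R z - ?A z) / (2 * (?R z)\<^sup>2))"
  define l' where "l' = (\<lambda>z. (?R z - ?A z) / (2 * (?R z)\<^sup>2) +
     z * ((?A z - ?R z) / (2 * ?R z ^ 3) - (?R z - ?A z) * ?A z / ?R z ^ 4))"
  have Z: "z \<in> slit_left \<and> Re z \<ge> 1 - 2 * \<kappa>" if z: "z \<in> \<gamma> ` {0..1}" for z
  proof
    from z obtain r where r: "0 \<le> r" "r \<le> 1" "z = of_real r * \<eta>" by (auto simp: \<gamma>_def)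
    show "z \<in> slit_left"
      using \<eta> r by (auto simp: slit_left_def complex_nonpos_Reals_iff mult_le_0_iff)
    have "r * (1 - 2 * \<kappa>) \<le> r * Re \<eta>" using r Re by (intro mult_left_mono) auto
    moreover have "1 * (1 - 2 * \<kappa>) \<le> r * (1 - 2 * \<kappa>)" using r \<kappa> by (intro mult_right_mono_neg) auto
    ultimately show "Re z \<ge> 1 - 2 * \<kappa>" by (simp add: r(3))
  qed
  have dA: "(?A has_field_derivative 1) (at z)" for z
    unfolding shift1_def[abs_def] by (auto intro!: derivative_eq_intros)
  have df: "(f has_field_derivative deriv f z) (at z)" "(deriv f has_field_derivative deriv (deriv f) z) (at z)" for z
    using fh by (auto intro!: holomorphic_derivI[of _ UNIV] holomorphic_intros)
  have dfm: "((\<lambda>z. f (M * z)) has_field_derivative M * deriv f (M * z)) (at z)"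
    "((\<lambda>z. deriv f (M * z)) has_field_derivative M * deriv (deriv f) (M * z)) (at z)" for z
    by (rule DERIV_cong[OF DERIV_chain2[OF df(1) DERIV_cmult_Id]], simp)
      (rule DERIV_cong[OF DERIV_chain2[OF df(2) DERIV_cmult_Id]], simp)
  have "cmod (f (M * \<gamma> 1) / wkb1 m \<kappa> (\<gamma> 1) - 1) \<le> 2 * C / m"
    unfolding C_def
  proof (rule wkb_along_path[OF K m[unfolded C_def],
        where g = "\<lambda>z. z" and F = "\<lambda>z. f (M * z)" and DF = "\<lambda>z. z * (M * deriv f (M * z))"
          and M = "wkb1 m \<kappa>" and R = ?R and lam = "\<lambda>z. M * ((?R z - 1 + z) / 2) + l z"
          and P = "\<lambda>z. M * (1 - z)" and Q = "\<lambda>z. - (M * z * (M * k + 1))"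
          and \<sigma> = "\<lambda>z. z / ?R z" and e = "\<lambda>z. z * err1 \<kappa> z (?R z)"
          and F' = "\<lambda>z. M * deriv f (M * z)"
          and DF' = "\<lambda>z. M * deriv f (M * z) + z * (M * (M * deriv (deriv f) (M * z)))"
          and M' = "\<lambda>z. (M * saddle1 \<kappa> z - (?A z - ?R z) / (2 * (?R z)\<^sup>2)) * wkb1 m \<kappa> z"
          and R' = "\<lambda>z. ?A z / ?R z" and lam' = "\<lambda>z. M * ((?A z / ?R z + 1) / 2) + l' z"])
    show "\<gamma> 0 = 0" "continuous_on {0..1} \<gamma>" by (auto simp: \<gamma>_def intro!: continuous_intros)
    show "(\<gamma> has_vector_derivative \<gamma> r / of_real r) (at r)" if "0 < r" "r < 1" for r
      unfolding \<gamma>_def using that by (auto intro!: derivative_eq_intros)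
    fix z assume "z \<in> \<gamma> ` {0..1}"
    then have z: "z \<in> slit_left" "Re z \<ge> 1 - 2 * \<kappa>" using Z by auto
    define A where "A = ?A z"
    define R where "R = ?R z"
    have R0: "R \<noteq> 0" unfolding R_def by (rule rt1_nz[OF \<kappa> z(1)])
    have R2: "R\<^sup>2 = (z - 1)\<^sup>2 + 4 * k * z" unfolding R_def k_def by (rule rt1_square(2)[OF \<kappa> z(1)])
    have A: "A = z + 2 * k - 1" by (simp add: A_def shift1_def k_def)
    show "((\<lambda>z. f (M * z)) has_field_derivative M * deriv f (M * z)) (at z)" by (rule dfm)
    show "((\<lambda>z. z * (M * deriv f (M * z))) has_field_derivative
        M * deriv f (M * z) + z * (M * (M * deriv (deriv f) (M * z)))) (at z)"
      by (auto intro!: derivative_eq_intros dfm)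
    show "(wkb1 m \<kappa> has_field_derivative
        (M * saddle1 \<kappa> z - (?A z - ?R z) / (2 * (?R z)\<^sup>2)) * wkb1 m \<kappa> z) (at z)"
      unfolding M_def by (rule wkb1_deriv[OF \<kappa> z])
    show dR: "(?R has_field_derivative ?A z / ?R z) (at z)" by (rule rt1_deriv[OF \<kappa> z(1)])
    have "(l has_field_derivative l' z) (at z)"
    proof -
      have "(l has_field_derivative
        ((1 * (R - A) + (A / R - 1) * z) * (2 * R\<^sup>2) - z * (R - A) * (2 * (2 * R * (A / R)))) / ((2 * R\<^sup>2) * (2 * R\<^sup>2))) (at z)"
        unfolding l_def R_def A_def
        by (rule derivative_eq_intros refl dR dA | use R0 in \<open>simp add: R_def\<close>)+
      also have "((1 * (R - A) + (A / R - 1) * z) * (2 * R\<^sup>2) - z * (R - A) * (2 * (2 * R * (A / R)))) / ((2 * R\<^sup>2) * (2 * R\<^sup>2))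
          = l' z"
        unfolding l'_def R_def[symmetric] A_def[symmetric] using R0
        by (simp add: field_simps power2_eq_square power3_eq_cube power4_eq_xxxx)
      finally show ?thesis .
    qed
    then show "((\<lambda>z. M * ((?R z - 1 + z) / 2) + l z) has_field_derivative M * ((?A z / ?R z + 1) / 2) + l' z) (at z)"
      by (auto intro!: derivative_eq_intros dR)
    show "z * (M * deriv f (M * z) + z * (M * (M * deriv (deriv f) (M * z)))) +
         M * (1 - z) * (z * (M * deriv f (M * z))) + - (M * z * (M * k + 1)) * f (M * z) = 0"
    proof -
      have "z * (M * deriv f (M * z) + z * (M * (M * deriv (deriv f) (M * z)))) +
         M * (1 - z) * (z * (M * deriv f (M * z))) + - (M * z * (M * k + 1)) * f (M * z)
        = M * z * ((M * z) * deriv (deriv f) (M * z) + (of_real (m + 1) - M * z) * deriv f (M * z)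
            - of_real (m * \<kappa> + 1) * f (M * z))"
        by (simp add: M_def k_def algebra_simps)
      also have "\<dots> = 0" unfolding f_def hyp1F1_ode[OF ab] by simp
      finally show ?thesis .
    qed
    show "z * ((M * saddle1 \<kappa> z - (?A z - ?R z) / (2 * (?R z)\<^sup>2)) * wkb1 m \<kappa> z)
        = (M * ((?R z - 1 + z) / 2) + l z) * wkb1 m \<kappa> z"
      unfolding l_def saddle1_mult[OF \<kappa> z(1), symmetric] by (simp add: algebra_simps diff_divide_distrib)
    show "wkb1 m \<kappa> z \<noteq> 0" by (rule wkb1_nz[OF \<kappa> z(1)])
    show "?R z \<noteq> 0" by (rule rt1_nz[OF \<kappa> z(1)])
    show "2 * (M * ((?R z - 1 + z) / 2) + l z) + M * (1 - z) + z * (?A z / ?R z) / ?R z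
        = of_real m * ?R z + z / ?R z"
      unfolding l_def R_def[symmetric] A_def[symmetric] M_def[symmetric] using R0
      by (simp add: field_simps power2_eq_square)
    show "z * (M * ((?A z / ?R z + 1) / 2) + l' z) + (M * ((?R z - 1 + z) / 2) + l z)\<^sup>2
        + M * (1 - z) * (M * ((?R z - 1 + z) / 2) + l z) + - (M * z * (M * k + 1))
        = z * err1 \<kappa> z (?R z) * ?R z"
    proof -
      \<comment> \<open>The residual is sorted by powers of m: order m^2 vanishes by the quadratic
        for u (\<open>m2\<close>), order m by the linear equation for l (\<open>m1\<close>), and
        order 1 is the error term (\<open>m00\<close>).\<close>
      define u where "u = (R - 1 + z) / 2"
      have m2: "u\<^sup>2 + (1 - z) * u - k * z = 0"
      proof -
        have "4 * (u\<^sup>2 + (1 - z) * u - k * z) = R\<^sup>2 - ((z - 1)\<^sup>2 + 4 * k * z)"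
          by (simp add: u_def field_simps power2_eq_square)
        then have "4 * (u\<^sup>2 + (1 - z) * u - k * z) = 0" unfolding R2 by simp
        then show ?thesis by (simp only: mult_eq_0_iff) simp
      qed
      have u: "2 * u + (1 - z) = R" by (simp add: u_def field_simps)
      have Rl: "R * l z = z * (R - A) / (2 * R)"
        unfolding l_def A_def[symmetric] R_def[symmetric] using R0 by (simp add: power2_eq_square)
      have m1: "z * ((A / R + 1) / 2) + (2 * u + (1 - z)) * l z - z = 0"
        unfolding u Rl using R0 by (simp add: field_simps)
      have e: "err1 \<kappa> z R * R = l' z + z * (R - A)\<^sup>2 / (4 * R ^ 4)"
        unfolding err1_def Let_def l'_def A_def[symmetric] R_def[symmetric] using R0 by simp
      have "(2 * R\<^sup>2)\<^sup>2 = 4 * R ^ 4" by (simp add: power_mult_distrib)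
      then have l2: "(l z)\<^sup>2 = z * (z * (R - A)\<^sup>2 / (4 * R ^ 4))"
        unfolding l_def A_def[symmetric] R_def[symmetric]
        by (simp add: power_divide power_mult_distrib power2_eq_square[of z] mult_ac)
      have m00: "z * l' z + (l z)\<^sup>2 = z * err1 \<kappa> z R * R"
        unfolding l2 mult.assoc[of z "err1 \<kappa> z R"] e by (simp add: distrib_left)
      have "z * (M * ((A / R + 1) / 2) + l' z) + (M * u + l z)\<^sup>2
        + M * (1 - z) * (M * u + l z) + - (M * z * (M * k + 1))
        = M\<^sup>2 * (u\<^sup>2 + (1 - z) * u - k * z) + M * (z * ((A / R + 1) / 2) + (2 * u + (1 - z)) * l z - z)
          + (z * l' z + (l z)\<^sup>2)"
        by (simp add: algebra_simps power2_eq_square)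
      also have "\<dots> = z * err1 \<kappa> z R * R" unfolding m2 m1 m00 by simp
      finally show ?thesis unfolding u_def R_def A_def .
    qed
  next
    show "f (M * 0) = 1" using hypergeometric_at_0(1)[of "m * \<kappa> + 1" 2 "m + 1"] ab by (simp add: f_def)
    show "wkb1 m \<kappa> 0 = 1" by (rule wkb1_0[OF \<kappa>])
    show "M * ((?R 0 - 1 + 0) / 2) + l 0 = 0" by (simp add: rt1_0[OF \<kappa>] l_def)
  next
    fix r :: real assume r: "0 < r" "r < 1"
    then have z: "\<gamma> r \<in> slit_left \<and> Re (\<gamma> r) \<ge> 1 - 2 * \<kappa>" by (intro Z) auto
    show "Re (?R (\<gamma> r)) \<ge> 0" using Re_rt1(1)[OF \<kappa>] z by blast
    show "cmod (\<gamma> r / ?R (\<gamma> r)) \<le> K * r"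
      using mult_left_mono[OF bound1[OF r], of r] r by (simp add: \<gamma>_def norm_mult norm_divide mult.commute)
    show "cmod (\<gamma> r * err1 \<kappa> (\<gamma> r) (?R (\<gamma> r))) \<le> K * r"
      using mult_left_mono[OF bound2[OF r], of r] r by (simp add: \<gamma>_def norm_mult mult_ac)
  qed auto
  then show ?thesis by (simp add: F1_def f_def M_def \<gamma>_def)
qed

section \<open>The Gauss case\<close>

definition slit_both :: "complex set" where
  "slit_both = {z. z \<in> slit_left \<and> z \<notin> complex_of_real ` {1..}}"

definition rt2 :: "real \<Rightarrow> complex \<Rightarrow> complex" where
  "rt2 \<kappa> z = csqrt (1 + 4 * of_real \<kappa> * of_real (\<kappa> - 1) * z)"

definition saddle2 :: "real \<Rightarrow> complex \<Rightarrow> complex" where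
  "saddle2 \<kappa> z = 2 * of_real \<kappa> / (1 + rt2 \<kappa> z)"

text \<open>The fraction without the square root is 1/(1 - z t), the part of \<open>psi2\<close>
  left after multiplication by t - 1; the root comes from the second derivative. At z = 0 the value
  is again 1.\<close>

definition wkb2 :: "real \<Rightarrow> real \<Rightarrow> complex \<Rightarrow> complex" where
  "wkb2 m \<kappa> z = 2 * (of_real \<kappa> - 1) / ((2 * of_real \<kappa> - 1 - rt2 \<kappa> z) * csqrt (rt2 \<kappa> z)) *
     exp (of_real m * (- phi2 \<kappa> z (saddle2 \<kappa> z) - of_real (\<kappa> * ln \<kappa> - (\<kappa> - 1) * ln (\<kappa> - 1))))"

context
  fixes \<kappa> :: real
  assumes \<kappa>: "\<kappa> > 1"
begin

lemma radicand2_slit: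
  assumes z: "z \<in> slit_left"
  shows "1 + 4 * of_real \<kappa> * of_real (\<kappa> - 1) * z \<notin> \<real>\<^sub>\<le>\<^sub>0"
proof
  define b where "b = 4 * \<kappa> * (\<kappa> - 1)"
  have b: "b > 0" using \<kappa> by (simp add: b_def)
  assume "1 + 4 * of_real \<kappa> * of_real (\<kappa> - 1) * z \<in> \<real>\<^sub>\<le>\<^sub>0"
  then have "1 + of_real b * z \<in> \<real>\<^sub>\<le>\<^sub>0" by (simp add: b_def)
  then have "b * Re z \<le> -1" "b * Im z = 0" by (auto simp: complex_nonpos_Reals_iff)
  then have "b * Re z < 0" "Im z = 0" using b by auto
  then have "Re z < 0" "Im z = 0" using b by (auto simp: mult_less_0_iff)
  then show False using z by (auto simp: slit_left_def complex_nonpos_Reals_iff)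
qed

lemma rt2_square: "(rt2 \<kappa> z)\<^sup>2 = 1 + 4 * of_real \<kappa> * (of_real \<kappa> - 1) * z"
  by (simp add: rt2_def)

lemma Re_rt2: "z \<in> slit_left \<Longrightarrow> Re (rt2 \<kappa> z) > 0"
  unfolding rt2_def by (intro Re_csqrt_pos radicand2_slit)

lemma rt2_nz:
  assumes "z \<in> slit_left"
  shows "rt2 \<kappa> z \<noteq> 0" "1 + rt2 \<kappa> z \<noteq> 0"
  using Re_rt2[OF assms] by (auto simp: complex_eq_iff)

lemma rt2_0: "rt2 \<kappa> 0 = 1"
  by (simp add: rt2_def)

lemma rt2_ne:
  assumes "z \<in> slit_both"
  shows "2 * of_real \<kappa> - 1 - rt2 \<kappa> z \<noteq> 0"
proof
  assume "2 * of_real \<kappa> - 1 - rt2 \<kappa> z = 0"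
  then have "rt2 \<kappa> z = 2 * of_real \<kappa> - 1" by simp
  then have "(2 * of_real \<kappa> - 1)\<^sup>2 = 1 + 4 * of_real \<kappa> * (of_real \<kappa> - 1) * z"
    using rt2_square[of z] by simp
  then have "4 * of_real \<kappa> * (of_real \<kappa> - 1) * (z - 1) = 0" by (simp add: algebra_simps power2_eq_square)
  then have "z = complex_of_real 1" using \<kappa> by auto
  then show False using assms by (auto simp: slit_both_def)
qed

lemma rt2_deriv:
  assumes "z \<in> slit_left"
  shows "(rt2 \<kappa> has_field_derivative (2 * of_real \<kappa> * (of_real \<kappa> - 1) / rt2 \<kappa> z)) (at z)"
proof -
  have "((\<lambda>z. 1 + 4 * of_real \<kappa> * of_real (\<kappa> - 1) * z) has_field_derivative 4 * of_real \<kappa> * of_real (\<kappa> - 1)) (at z)"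
    by (auto intro!: derivative_eq_intros)
  note d = DERIV_chain2[OF has_field_derivative_csqrt[OF radicand2_slit[OF assms]] this]
  have eq: "inverse (2 * s) * (4 * a * b) = 2 * a * b / s" for a b s :: complex
    by (cases "s = 0") (simp_all add: field_simps)
  show ?thesis
    using d unfolding rt2_def[abs_def] of_real_diff of_real_1 eq .
qed

text \<open>A real root s makes z real, and the end point z = 1 of the domain corresponds to s =
  2\<kappa> - 1.\<close>

lemma rt2_real_bound:
  assumes z: "z \<in> slit_both" and s: "rt2 \<kappa> z = of_real s"
  shows "0 < s" "s < 2 * \<kappa> - 1"
proof -
  have zl: "z \<in> slit_left" using z by (simp add: slit_both_def)
  show s0: "0 < s" using Re_rt2[OF zl] s by simp
  define y where "y = (s\<^sup>2 - 1) / (4 * \<kappa> * (\<kappa> - 1))"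
  have "of_real (s\<^sup>2 - 1) = of_real (4 * \<kappa> * (\<kappa> - 1)) * z"
    using rt2_square[of z] unfolding s by simp
  then have "z = of_real y" unfolding y_def of_real_divide using \<kappa> by simp
  then have "y < 1" using z by (auto simp: slit_both_def not_le[symmetric])
  then have "s\<^sup>2 - 1 < 4 * \<kappa> * (\<kappa> - 1)" unfolding y_def using \<kappa> by (simp add: divide_less_eq)
  then have "s\<^sup>2 < (2 * \<kappa> - 1)\<^sup>2" by (simp add: algebra_simps power2_eq_square)
  then show "s < 2 * \<kappa> - 1" using \<kappa> by (intro power2_less_imp_less[of s]) auto
qed

lemma saddle2_mult:
  assumes z: "z \<in> slit_left"
  shows "1 - z * saddle2 \<kappa> z = (2 * of_real \<kappa> - 1 - rt2 \<kappa> z) / (2 * (of_real \<kappa> - 1))"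
proof -
  define S where "S = rt2 \<kappa> z"
  have S: "1 + S \<noteq> 0" using rt2_nz[OF z] by (simp add: S_def)
  have k: "complex_of_real \<kappa> - 1 \<noteq> 0" using \<kappa> by (simp add: complex_eq_iff)
  have "(1 + S) * (S - 1) = 4 * of_real \<kappa> * (of_real \<kappa> - 1) * z"
    using rt2_square[of z] by (simp add: S_def algebra_simps power2_eq_square)
  then have "2 * (of_real \<kappa> - 1) * (z * (2 * of_real \<kappa>)) = (1 + S) * (S - 1)" by (simp add: mult_ac)
  then have *: "z * (2 * of_real \<kappa>) = (1 + S) * ((S - 1) / (2 * (of_real \<kappa> - 1)))"
    using k by (simp add: field_simps)
  have "z * saddle2 \<kappa> z = z * (2 * of_real \<kappa>) / (1 + S)"
    unfolding saddle2_def S_def[symmetric] by simp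
  also have "\<dots> = (S - 1) / (2 * (of_real \<kappa> - 1))"
    unfolding * using S by (rule nonzero_mult_div_cancel_left)
  finally have "z * saddle2 \<kappa> z = (S - 1) / (2 * (of_real \<kappa> - 1))" .
  then show ?thesis using k by (simp add: S_def[symmetric] field_simps)
qed

lemma saddle2_minus_1:
  assumes z: "z \<in> slit_left"
  shows "saddle2 \<kappa> z - 1 = (2 * of_real \<kappa> - 1 - rt2 \<kappa> z) / (1 + rt2 \<kappa> z)"
  unfolding saddle2_def diff_diff_eq diff_divide_distrib using rt2_nz(2)[OF z] by simp

lemma saddle2_quotient:
  assumes z: "z \<in> slit_left"
  shows "saddle2 \<kappa> z / (1 - z * saddle2 \<kappa> z)
    = 4 * of_real \<kappa> * (of_real \<kappa> - 1) / ((1 + rt2 \<kappa> z) * (2 * of_real \<kappa> - 1 - rt2 \<kappa> z))"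
proof -
  have "2 * k / a / (b / (2 * j)) = 4 * k * j / (a * b)" for a b j k :: complex by simp
  then show ?thesis unfolding saddle2_mult[OF z] unfolding saddle2_def .
qed

text \<open>Keeps the principal logarithms in \<open>phi2\<close> holomorphic at the saddle point.
  In terms of S = \<open>rt2\<close>, t - 1 is a real Moebius function, so a real value forces S to
  be real, where \<open>rt2_real_bound\<close> gives positivity; the quotient in the logarithm needs
  one further case.\<close>

lemma saddle2_slit:
  assumes z: "z \<in> slit_both"
  shows "saddle2 \<kappa> z - 1 \<notin> \<real>\<^sub>\<le>\<^sub>0" "saddle2 \<kappa> z / (1 - z * saddle2 \<kappa> z) \<notin> \<real>\<^sub>\<le>\<^sub>0"
    "saddle2 \<kappa> z \<noteq> 1" "1 - z * saddle2 \<kappa> z \<noteq> 0"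
proof -
  have zl: "z \<in> slit_left" using z by (simp add: slit_both_def)
  define S where "S = rt2 \<kappa> z"
  have S: "Re S > 0" "1 + S \<noteq> 0" using Re_rt2[OF zl] rt2_nz[OF zl] by (auto simp: S_def)
  have S2: "2 * of_real \<kappa> - 1 - S \<noteq> 0" using rt2_ne[OF z] by (simp add: S_def)
  have real: "0 < Re S \<and> Re S < 2 * \<kappa> - 1" if "Im S = 0"
  proof -
    have "S = of_real (Re S)" using that by (simp add: complex_eq_iff)
    then show ?thesis using rt2_real_bound[OF z] by (simp add: S_def)
  qed
  have k: "complex_of_real \<kappa> - 1 \<noteq> 0" using \<kappa> by (simp add: complex_eq_iff)
  show s1: "saddle2 \<kappa> z - 1 \<notin> \<real>\<^sub>\<le>\<^sub>0"
  proof
    assume "saddle2 \<kappa> z - 1 \<in> \<real>\<^sub>\<le>\<^sub>0"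
    then obtain x where x: "saddle2 \<kappa> z - 1 = of_real x" "x \<le> 0" by (elim nonpos_Reals_cases)
    then have eq: "2 * of_real \<kappa> - 1 - S = of_real x * (1 + S)"
      using saddle2_minus_1[OF zl] S by (simp add: S_def field_simps)
    from arg_cong[OF eq, of Im] have "Im S * (1 + x) = 0" by (simp add: algebra_simps)
    moreover from arg_cong[OF eq, of Re] have re: "2 * \<kappa> - 1 - Re S = x * (1 + Re S)" by simp
    have "x \<noteq> -1" using re \<kappa> by auto
    ultimately have "Im S = 0" by auto
    from real[OF this] have "2 * \<kappa> - 1 - Re S > 0" "x * (1 + Re S) \<le> 0"
      using x by (auto simp: mult_nonpos_nonneg)
    then show False using re by simp
  qed
  then show "saddle2 \<kappa> z \<noteq> 1" by auto
  show "saddle2 \<kappa> z / (1 - z * saddle2 \<kappa> z) \<notin> \<real>\<^sub>\<le>\<^sub>0"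
  proof
    define p where "p = (1 + S) * (2 * of_real \<kappa> - 1 - S)"
    have p0: "p \<noteq> 0" using S S2 by (simp add: p_def)
    assume "saddle2 \<kappa> z / (1 - z * saddle2 \<kappa> z) \<in> \<real>\<^sub>\<le>\<^sub>0"
    then obtain x where x: "of_real (4 * \<kappa> * (\<kappa> - 1)) / p = of_real x" "x \<le> 0"
      unfolding saddle2_quotient[OF zl] p_def S_def by (elim nonpos_Reals_cases) auto
    then have eq: "of_real (4 * \<kappa> * (\<kappa> - 1)) = of_real x * p" using p0 by (simp add: field_simps)
    have x0: "x < 0" using x eq \<kappa> by (cases "x = 0") auto
    from arg_cong[OF eq, of Im] have "x * Im p = 0" by simp
    then have "Im p = 0" using x0 by simp
    have "4 * \<kappa> * (\<kappa> - 1) > 0" using \<kappa> by simp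
    with arg_cong[OF eq, of Re] have "x * Re p > 0" by simp
    then have rp: "Re p < 0" using x0 by (simp add: zero_less_mult_iff)
    \<comment> \<open>Besides real S, p is real on the line Re S = \<kappa> - 1, where its factors
      are conjugate and p > 0.\<close>
    have "Im p = 2 * Im S * (\<kappa> - 1 - Re S)" by (simp add: p_def algebra_simps)
    with \<open>Im p = 0\<close> consider "Im S = 0" | "Re S = \<kappa> - 1" by auto
    then show False
    proof cases
      case 1
      then have "Re p = (1 + Re S) * (2 * \<kappa> - 1 - Re S)" by (simp add: p_def)
      also have "\<dots> > 0" using real[OF 1] by simp
      finally show False using rp by simp
    next
      case 2
      have "Re p = (1 + Re S) * (2 * \<kappa> - 1 - Re S) + Im S * Im S" by (simp add: p_def)
      then have "Re p = \<kappa>\<^sup>2 + (Im S)\<^sup>2" unfolding 2 by (simp add: power2_eq_square)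
      then show False using rp zero_le_power2[of \<kappa>] zero_le_power2[of "Im S"] by linarith
    qed
  qed
  show "1 - z * saddle2 \<kappa> z \<noteq> 0" unfolding saddle2_mult[OF zl] using rt2_ne[OF z] k by simp
qed

text \<open>As in the confluent case only the explicit dependence counts; it gives \<kappa> t/(1 - z
  t), here written in the root.\<close>

lemma phi2_saddle_deriv:
  assumes z: "z \<in> slit_both"
  shows "((\<lambda>z. - phi2 \<kappa> z (saddle2 \<kappa> z)) has_field_derivative
     4 * (of_real \<kappa>)\<^sup>2 * (of_real \<kappa> - 1) / ((1 + rt2 \<kappa> z) * (2 * of_real \<kappa> - 1 - rt2 \<kappa> z))) (at z)"
proof -
  have zl: "z \<in> slit_left" using z by (simp add: slit_both_def)
  define k where "k = complex_of_real \<kappa>"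
  define S where "S = rt2 \<kappa> z"
  define s' where "s' = 2 * k * (k - 1) / S"
  have k: "k - 1 \<noteq> 0" "k \<noteq> 0" using \<kappa> by (auto simp: k_def complex_eq_iff)
  have nz: "S \<noteq> 0" "1 + S \<noteq> 0" "2 * k - 1 - S \<noteq> 0"
    using rt2_nz[OF zl] rt2_ne[OF z] by (auto simp: S_def k_def)
  have dS: "(rt2 \<kappa> has_field_derivative s') (at z)"
    unfolding s'_def S_def k_def by (rule rt2_deriv[OF zl])
  have dt: "(saddle2 \<kappa> has_field_derivative (- (2 * k) * s' / (1 + S)\<^sup>2)) (at z)"
  proof -
    have "((\<lambda>z. 2 * k / (1 + rt2 \<kappa> z)) has_field_derivative ((0 * (1 + S) - 2 * k * (0 + s')) / ((1 + S) * (1 + S)))) (at z)"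
      unfolding S_def by (intro DERIV_divide DERIV_const DERIV_add dS) (use nz in \<open>simp add: S_def\<close>)
    then show ?thesis unfolding saddle2_def[abs_def] k_def[symmetric] by (simp add: power2_eq_square)
  qed
  define t where "t = saddle2 \<kappa> z"
  define q where "q = 1 - z * t"
  have q: "q = (2 * k - 1 - S) / (2 * (k - 1))" unfolding q_def t_def S_def k_def by (rule saddle2_mult[OF zl])
  have t1: "t - 1 = (2 * k - 1 - S) / (1 + S)" unfolding t_def S_def k_def by (rule saddle2_minus_1[OF zl])
  have te: "t = 2 * k / (1 + S)" by (simp add: t_def saddle2_def S_def k_def)
  have slit: "t - 1 \<notin> \<real>\<^sub>\<le>\<^sub>0" "t / q \<notin> \<real>\<^sub>\<le>\<^sub>0" using saddle2_slit[OF z] by (auto simp: t_def q_def)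
  have q0: "q \<noteq> 0" "t \<noteq> 0" "t - 1 \<noteq> 0" using slit by auto
  define t' where "t' = - (2 * k) * s' / (1 + S)\<^sup>2"
  have dt': "(saddle2 \<kappa> has_field_derivative t') (at z)" using dt by (simp add: t'_def)
  have "((\<lambda>z. saddle2 \<kappa> z / (1 - z * saddle2 \<kappa> z)) has_field_derivative
      ((t' * q - t * (0 - (1 * t + t' * z))) / (q * q))) (at z)"
    unfolding q_def t_def
    by (intro DERIV_divide DERIV_diff DERIV_const DERIV_mult DERIV_ident dt') (use q0 in \<open>simp add: q_def t_def\<close>)
  then have "((\<lambda>z. Ln (saddle2 \<kappa> z / (1 - z * saddle2 \<kappa> z))) has_field_derivative
      (inverse (t / q) * ((t' * q - t * (0 - (1 * t + t' * z))) / (q * q)))) (at z)"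
    using DERIV_chain2[OF has_field_derivative_Ln, where g = "\<lambda>z. saddle2 \<kappa> z / (1 - z * saddle2 \<kappa> z)" and x = z]
      slit(2) unfolding q_def t_def by blast
  moreover have "((\<lambda>z. Ln (saddle2 \<kappa> z - 1)) has_field_derivative (inverse (t - 1) * (t' - 0))) (at z)"
    using DERIV_chain2[OF has_field_derivative_Ln, where g = "\<lambda>z. saddle2 \<kappa> z - 1" and x = z]
      DERIV_diff[OF dt' DERIV_const] slit(1) unfolding t_def by blast
  ultimately have "((\<lambda>z. - phi2 \<kappa> z (saddle2 \<kappa> z)) has_field_derivative
      (- (- k * (inverse (t / q) * ((t' * q - t * (0 - (1 * t + t' * z))) / (q * q)))
          + (k - 1) * (inverse (t - 1) * (t' - 0))))) (at z)"
    unfolding phi2_def of_real_diff of_real_1 k_def[symmetric]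
    by (intro DERIV_minus DERIV_add DERIV_cmult)
  also have "- (- k * (inverse (t / q) * ((t' * q - t * (0 - (1 * t + t' * z))) / (q * q)))
          + (k - 1) * (inverse (t - 1) * (t' - 0)))
      = k * t / q + t' * (k / t + k * z / q - (k - 1) / (t - 1))"
    using q0 by (simp add: field_simps)
  also have "k / t + k * z / q - (k - 1) / (t - 1) = k / (t * q) - (k - 1) / (t - 1)"
  proof -
    have "k / (t * q) = k * (q + z * t) / (t * q)" by (simp add: q_def)
    also have "\<dots> = k / t + k * z / q" using q0 by (simp add: field_simps)
    finally show ?thesis by simp
  qed
  \<comment> \<open>The saddle point equation; it is what removes the unknown derivative t'.\<close>
  also have "k / (t * q) - (k - 1) / (t - 1) = 0"
  proof -
    have "2 * k / (1 + S) * (a / (2 * b)) = k * (a / (1 + S)) / b" for a b by simp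
    then have tq: "t * q = k * (t - 1) / (k - 1)" unfolding q t1 unfolding te .
    have "k / (k * a / b) = b / a" for a b using k(2) by simp
    then show ?thesis unfolding tq by (simp only: diff_self)
  qed
  also have "k * t / q + t' * 0 = 4 * k\<^sup>2 * (k - 1) / ((1 + S) * (2 * k - 1 - S))"
  proof -
    have "k * t / q = 4 * k\<^sup>2 * (k - 1) / ((1 + S) * (2 * k - 1 - S))"
    proof -
      have "k * (2 * k / (1 + S)) / (a / (2 * b)) = 4 * k\<^sup>2 * b / ((1 + S) * a)" for a b
        by (simp add: power2_eq_square)
      then show ?thesis unfolding q unfolding te .
    qed
    then show ?thesis by (simp only: mult_zero_right add_0_right)
  qed
  finally show ?thesis unfolding S_def k_def .
qed

lemma wkb2_deriv:
  assumes z: "z \<in> slit_both"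
  shows "(wkb2 m \<kappa> has_field_derivative
     ((of_real m * (4 * (of_real \<kappa>)\<^sup>2 * (of_real \<kappa> - 1) / ((1 + rt2 \<kappa> z) * (2 * of_real \<kappa> - 1 - rt2 \<kappa> z)))
        + (2 * of_real \<kappa> * (of_real \<kappa> - 1) / rt2 \<kappa> z) * (1 / (2 * of_real \<kappa> - 1 - rt2 \<kappa> z) - 1 / (2 * rt2 \<kappa> z)))
       * wkb2 m \<kappa> z)) (at z)"
proof -
  have zl: "z \<in> slit_left" using z by (simp add: slit_both_def)
  define k where "k = complex_of_real \<kappa>"
  define S where "S = rt2 \<kappa> z"
  define s' where "s' = 2 * k * (k - 1) / S"
  define p where "p = 4 * k\<^sup>2 * (k - 1) / ((1 + S) * (2 * k - 1 - S))"
  have S: "S \<notin> \<real>\<^sub>\<le>\<^sub>0" using Re_rt2[OF zl] by (auto simp: S_def complex_nonpos_Reals_iff)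
  define s where "s = csqrt S"
  define d where "d = 2 * k - 1 - S"
  have nz: "S \<noteq> 0" "d \<noteq> 0" "s \<noteq> 0" "s\<^sup>2 = S"
    using rt2_nz[OF zl] rt2_ne[OF z] by (auto simp: S_def k_def s_def d_def)
  have dS: "(rt2 \<kappa> has_field_derivative s') (at z)"
    unfolding s'_def S_def k_def by (rule rt2_deriv[OF zl])
  have ds: "((\<lambda>z. csqrt (rt2 \<kappa> z)) has_field_derivative (inverse (2 * s) * s')) (at z)"
    using DERIV_chain2[OF has_field_derivative_csqrt dS] S unfolding S_def s_def by blast
  define c0 where "c0 = complex_of_real (\<kappa> * ln \<kappa> - (\<kappa> - 1) * ln (\<kappa> - 1))"
  define e where "e = exp (of_real m * (- phi2 \<kappa> z (saddle2 \<kappa> z) - c0))"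
  have de: "((\<lambda>z. exp (of_real m * (- phi2 \<kappa> z (saddle2 \<kappa> z) - c0))) has_field_derivative
        (of_real m * p * e)) (at z)"
    unfolding e_def p_def k_def S_def
    by (rule derivative_eq_intros phi2_saddle_deriv[OF z] refl)+ simp
  have "(wkb2 m \<kappa> has_field_derivative
      ((0 * (d * s) - 2 * (k - 1) * ((0 - s') * s + inverse (2 * s) * s' * d)) / ((d * s) * (d * s)) * e
        + of_real m * p * e * (2 * (k - 1) / (d * s)))) (at z)"
    unfolding wkb2_def[abs_def] k_def[symmetric] c0_def[symmetric]
    using nz
    unfolding d_def S_def s_def e_def
    by (intro DERIV_mult DERIV_divide DERIV_const DERIV_diff dS ds[unfolded s_def S_def] de[unfolded e_def]) auto
  also have "(0 * (d * s) - 2 * (k - 1) * ((0 - s') * s + inverse (2 * s) * s' * d)) / ((d * s) * (d * s)) * e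
        + of_real m * p * e * (2 * (k - 1) / (d * s))
      = (of_real m * p + s' * (1 / d - 1 / (2 * s\<^sup>2))) * (2 * (k - 1) / (d * s) * e)"
    using nz(1-3) by (simp add: field_simps power2_eq_square)
  also have "2 * (k - 1) / (d * s) * e = wkb2 m \<kappa> z"
    by (simp add: wkb2_def d_def s_def e_def c0_def k_def S_def)
  finally show ?thesis
    unfolding nz(4) d_def s'_def p_def S_def k_def .
qed

lemma wkb2_nz:
  assumes z: "z \<in> slit_both"
  shows "wkb2 m \<kappa> z \<noteq> 0"
proof -
  have "z \<in> slit_left" using z by (simp add: slit_both_def)
  moreover have "complex_of_real \<kappa> - 1 \<noteq> 0" using \<kappa> by (simp add: complex_eq_iff)
  ultimately show ?thesis using rt2_nz[of z] rt2_ne[OF z] by (simp add: wkb2_def)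
qed

lemma wkb2_0: "wkb2 m \<kappa> 0 = 1"
proof -
  have t: "saddle2 \<kappa> 0 = of_real \<kappa>" by (simp add: saddle2_def rt2_0)
  have "phi2 \<kappa> 0 (of_real \<kappa>) = of_real (- (\<kappa> * ln \<kappa> - (\<kappa> - 1) * ln (\<kappa> - 1)))"
  proof -
    have "Ln (complex_of_real \<kappa> - 1) = of_real (ln (\<kappa> - 1))"
      using Ln_of_real[of "\<kappa> - 1"] \<kappa> by simp
    then show ?thesis using \<kappa> by (simp add: phi2_def Ln_of_real)
  qed
  moreover have "complex_of_real \<kappa> - 1 \<noteq> 0" using \<kappa> by (simp add: complex_eq_iff)
  then have "2 * (complex_of_real \<kappa> - 1) / (2 * of_real \<kappa> - 1 - 1) = 1"
    by (simp add: algebra_simps)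
  ultimately show ?thesis by (simp add: wkb2_def t rt2_0)
qed

end

text \<open>The point with \<open>z/(1 - z) = r \<eta>/(1 - \<eta>)\<close>.\<close>

definition path2 :: "complex \<Rightarrow> real \<Rightarrow> complex" where
  "path2 \<eta> r = of_real r * \<eta> / (1 - (1 - of_real r) * \<eta>)"

lemma path2_denom:
  assumes "\<eta> \<in> slit_both" "0 \<le> r" "r \<le> 1"
  shows "1 - (1 - of_real r) * \<eta> \<noteq> 0"
proof
  assume eq: "1 - (1 - of_real r) * \<eta> = 0"
  then have r: "1 - r \<noteq> 0" by auto
  have "of_real (1 - r) * \<eta> = 1" using eq by simp
  then have "\<eta> = of_real (1 / (1 - r))" using r by (simp add: field_simps)
  moreover have "1 / (1 - r) \<in> {1..}" using assms r by (auto simp: field_simps)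
  ultimately show False using assms(1) by (auto simp: slit_both_def simp del: of_real_divide)
qed

lemma path2_real:
  fixes r y :: real
  assumes y: "y < 1" and r: "0 < r" "r \<le> 1" "0 < y"
  shows "0 < r * y / (1 - (1 - r) * y)" "r * y / (1 - (1 - r) * y) < 1"
proof -
  have "(1 - r) * y \<le> 1 - r" using y r by (intro mult_left_le) auto
  then have p: "1 - (1 - r) * y > 0" using r by linarith
  then show "0 < r * y / (1 - (1 - r) * y)" using r by simp
  show "r * y / (1 - (1 - r) * y) < 1" using p y by (simp add: field_simps)
qed

text \<open>The map is a Moebius transformation with real coefficients: a real point x on the path
  forces \<eta> to be real, hence in (0, 1) unless it is 0, and then the path stays in (0, 1) by
  \<open>path2_real\<close>.\<close>

lemma path2_slit:
  assumes \<eta>: "\<eta> \<in> slit_both" and r: "0 \<le> r" "r \<le> 1"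
  shows "path2 \<eta> r \<in> slit_both"
proof (rule ccontr)
  assume neg: "path2 \<eta> r \<notin> slit_both"
  have "0 \<in> slit_both" by (auto simp: slit_both_def slit_left_def)
  with neg have nz: "path2 \<eta> r \<noteq> 0" by metis
  then have r0: "r > 0" using r by (cases "r = 0") (auto simp: path2_def)
  have \<eta>0: "\<eta> \<noteq> 0" using nz by (auto simp: path2_def)
  have "path2 \<eta> r \<in> \<real>\<^sub>\<le>\<^sub>0 \<or> path2 \<eta> r \<in> complex_of_real ` {1..}"
    using neg nz by (auto simp: slit_both_def slit_left_def)
  then obtain x where x: "path2 \<eta> r = of_real x" "x \<le> 0 \<or> x \<ge> 1"
    by (auto elim: nonpos_Reals_cases)
  have "of_real r * \<eta> = of_real x * (1 - (1 - of_real r) * \<eta>)"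
    using x(1) path2_denom[OF \<eta> r] by (simp add: path2_def field_simps)
  then have eq: "\<eta> * of_real (r + x * (1 - r)) = of_real x" by (simp add: algebra_simps)
  have "x \<noteq> 0" using x nz by auto
  have d: "r + x * (1 - r) \<noteq> 0"
  proof
    assume "r + x * (1 - r) = 0"
    from eq[unfolded this] \<open>x \<noteq> 0\<close> show False by simp
  qed
  define y where "y = x / (r + x * (1 - r))"
  from d have "complex_of_real (r + x * (1 - r)) \<noteq> 0" by (simp only: of_real_eq_0_iff) simp
  from nonzero_mult_div_cancel_right[OF this, of \<eta>]
  have \<eta>y: "\<eta> = of_real y" unfolding eq y_def of_real_divide by (rule sym)
  have "y > 0" using \<eta> \<eta>0 unfolding \<eta>y by (auto simp: slit_both_def slit_left_def not_le)
  moreover have "y < 1" using \<eta> unfolding \<eta>y by (auto simp: slit_both_def not_le[symmetric])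
  ultimately have "0 < r * y / (1 - (1 - r) * y)" "r * y / (1 - (1 - r) * y) < 1"
    using path2_real r0 r by auto
  moreover have "of_real x = complex_of_real (r * y / (1 - (1 - r) * y))"
    using x(1) unfolding path2_def \<eta>y by simp
  then have "x = r * y / (1 - (1 - r) * y)" by (simp only: of_real_eq_iff)
  ultimately show False using x(2) by linarith
qed

lemma path2_deriv:
  assumes \<eta>: "\<eta> \<in> slit_both" and r: "0 < r" "r \<le> 1"
  shows "(path2 \<eta> has_vector_derivative (path2 \<eta> r * (1 - path2 \<eta> r) / of_real r)) (at r)"
proof -
  define d where "d = 1 - (1 - of_real r) * \<eta>"
  have d: "d \<noteq> 0" using path2_denom[OF \<eta>] r by (simp add: d_def)
  have "((\<lambda>w. w * \<eta> / (1 - (1 - w) * \<eta>)) has_field_derivative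
      ((1 * \<eta> * d - of_real r * \<eta> * \<eta>) / (d * d))) (at (of_real r))"
    unfolding d_def
    by (rule derivative_eq_intros refl | use d in \<open>simp add: d_def\<close>)+
  from has_vector_derivative_real_field[OF this]
  have "(path2 \<eta> has_vector_derivative ((1 * \<eta> * d - of_real r * \<eta> * \<eta>) / (d * d))) (at r)"
    unfolding path2_def[abs_def] .
  also have "(1 * \<eta> * d - of_real r * \<eta> * \<eta>) / (d * d) = \<eta> * (1 - \<eta>) / (d * d)"
    by (simp add: d_def algebra_simps)
  also have "1 - path2 \<eta> r = (1 - \<eta>) / d"
  proof -
    have "d - of_real r * \<eta> = 1 - \<eta>" by (simp add: d_def algebra_simps)
    moreover have "1 - path2 \<eta> r = (d - of_real r * \<eta>) / d"
      using d by (simp add: path2_def d_def[symmetric] diff_divide_distrib)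
    ultimately show ?thesis by simp
  qed
  then have "\<eta> * (1 - \<eta>) / (d * d) = path2 \<eta> r * (1 - path2 \<eta> r) / of_real r"
    using r by (simp add: path2_def d_def[symmetric])
  finally show ?thesis .
qed

lemma t2_eq_saddle2:
  assumes \<kappa>: "\<kappa> > 1" and z: "z \<in> slit_left" "z \<noteq> 0"
  shows "t2 \<kappa> z = saddle2 \<kappa> z"
proof -
  define k where "k = complex_of_real \<kappa>"
  have k: "k - 1 \<noteq> 0" using \<kappa> by (simp add: k_def complex_eq_iff)
  have eq: "1 - z * saddle2 \<kappa> z = (2 * k - 1 - rt2 \<kappa> z) / (2 * (k - 1))"
    unfolding k_def by (rule saddle2_mult[OF \<kappa> z(1)])
  then have "z * saddle2 \<kappa> z = (- 1 + rt2 \<kappa> z) / (2 * (k - 1))"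
    using k by (simp add: field_simps)
  moreover have "t2 \<kappa> z = (- 1 + rt2 \<kappa> z) / (2 * (k - 1)) / z"
    unfolding t2_def rt2_def[symmetric] k_def by (simp add: mult_ac)
  ultimately have "t2 \<kappa> z = z * saddle2 \<kappa> z / z" by simp
  then show ?thesis using z(2) by simp
qed

lemma phi2_deriv2:
  assumes t: "t - 1 \<notin> \<real>\<^sub>\<le>\<^sub>0" "t / (1 - \<eta> * t) \<notin> \<real>\<^sub>\<le>\<^sub>0" "1 - \<eta> * t \<noteq> 0"
  shows "deriv (deriv (phi2 \<kappa> \<eta>)) t
    = of_real \<kappa> * (1 - 2 * \<eta> * t) / (t * (1 - \<eta> * t))\<^sup>2 - of_real (\<kappa> - 1) / (t - 1)\<^sup>2"
proof -
  let ?S1 = "(\<lambda>s. 1 - \<eta> * s) -` (- {0})"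
  have op1: "open ?S1" by (intro open_vimage) (auto intro!: continuous_intros)
  have cont: "continuous_on ?S1 (\<lambda>s. s / (1 - \<eta> * s))" by (auto intro!: continuous_intros)
  have op2: "open (?S1 \<inter> (\<lambda>s. s / (1 - \<eta> * s)) -` (- \<real>\<^sub>\<le>\<^sub>0))"
    by (intro continuous_open_preimage cont op1) (simp add: open_Compl)
  have op3: "open ((\<lambda>s. s - 1) -` (- \<real>\<^sub>\<le>\<^sub>0 :: complex set))"
    by (intro open_vimage) (auto intro!: continuous_intros simp: open_Compl)
  let ?S = "(?S1 \<inter> (\<lambda>s. s / (1 - \<eta> * s)) -` (- \<real>\<^sub>\<le>\<^sub>0)) \<inter> (\<lambda>s. s - 1) -` (- \<real>\<^sub>\<le>\<^sub>0 :: complex set)"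
  have op: "open ?S" by (intro open_Int op2 op3)
  have slit: "s / (1 - \<eta> * s) \<notin> \<real>\<^sub>\<le>\<^sub>0" "s - 1 \<notin> \<real>\<^sub>\<le>\<^sub>0" "1 - \<eta> * s \<noteq> 0" "s \<noteq> 0" "s - 1 \<noteq> 0" if "s \<in> ?S" for s
    using that by auto
  have tS: "t \<in> ?S" using t by auto
  have d1: "deriv (phi2 \<kappa> \<eta>) s = - of_real \<kappa> / (s * (1 - \<eta> * s)) + of_real (\<kappa> - 1) / (s - 1)" if "s \<in> ?S" for s
  proof (rule DERIV_imp_deriv)
    note nz = slit[OF that]
    define q where "q = 1 - \<eta> * s"
    have q: "q \<noteq> 0" using nz by (simp add: q_def)
    have dq: "((\<lambda>s. s / (1 - \<eta> * s)) has_field_derivative ((1 * q - s * (0 - \<eta>)) / (q * q))) (at s)"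
      unfolding q_def by (rule derivative_eq_intros refl | use nz in simp)+
    have "((\<lambda>s. Ln (s / (1 - \<eta> * s))) has_field_derivative (inverse (s / q) * ((1 * q - s * (0 - \<eta>)) / (q * q)))) (at s)"
      using DERIV_chain2[OF has_field_derivative_Ln, where g = "\<lambda>s. s / (1 - \<eta> * s)" and x = s]
        dq nz(1) unfolding q_def by blast
    moreover have "inverse (s / q) * ((1 * q - s * (0 - \<eta>)) / (q * q)) = 1 / (s * q)"
    proof -
      have "1 * q - s * (0 - \<eta>) = 1" by (simp add: q_def)
      then show ?thesis using q nz by (simp add: field_simps)
    qed
    ultimately have L: "((\<lambda>s. Ln (s / (1 - \<eta> * s))) has_field_derivative 1 / (s * q)) (at s)" by simp
    have "((\<lambda>s. s - 1) has_field_derivative (1 - 0)) (at s)" by (intro DERIV_diff DERIV_ident DERIV_const)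
    then have "((\<lambda>s. Ln (s - 1)) has_field_derivative (inverse (s - 1) * (1 - 0))) (at s)"
      using DERIV_chain2[OF has_field_derivative_Ln, where g = "\<lambda>s. s - 1" and x = s] nz(2) by blast
    then have "(phi2 \<kappa> \<eta> has_field_derivative
        (- of_real \<kappa> * (1 / (s * q)) + of_real (\<kappa> - 1) * (inverse (s - 1) * (1 - 0)))) (at s)"
      unfolding phi2_def[abs_def] by (intro DERIV_add DERIV_cmult L)
    then show "(phi2 \<kappa> \<eta> has_field_derivative - of_real \<kappa> / (s * (1 - \<eta> * s)) + of_real (\<kappa> - 1) / (s - 1)) (at s)"
      by (simp add: q_def divide_inverse)
  qed
  have nz: "t \<noteq> 0" "t - 1 \<noteq> 0" "1 - \<eta> * t \<noteq> 0" using slit[OF tS] by auto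
  have "((\<lambda>s. - of_real \<kappa> / (s * (1 - \<eta> * s)) + of_real (\<kappa> - 1) / (s - 1)) has_field_derivative
      ((0 * (t * (1 - \<eta> * t)) - (- of_real \<kappa>) * (1 * (1 - \<eta> * t) + (0 - \<eta> * 1) * t)) / ((t * (1 - \<eta> * t)) * (t * (1 - \<eta> * t)))
       + (0 * (t - 1) - of_real (\<kappa> - 1) * (1 - 0)) / ((t - 1) * (t - 1)))) (at t)"
    by (intro DERIV_add DERIV_divide DERIV_const DERIV_mult DERIV_diff DERIV_ident DERIV_cmult) (use nz in auto)
  also have "(0 * (t * (1 - \<eta> * t)) - (- of_real \<kappa>) * (1 * (1 - \<eta> * t) + (0 - \<eta> * 1) * t)) / ((t * (1 - \<eta> * t)) * (t * (1 - \<eta> * t)))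
       + (0 * (t - 1) - of_real (\<kappa> - 1) * (1 - 0)) / ((t - 1) * (t - 1))
     = of_real \<kappa> * (1 - 2 * \<eta> * t) / (t * (1 - \<eta> * t))\<^sup>2 - of_real (\<kappa> - 1) / (t - 1)\<^sup>2"
  proof -
    have "0 * (t * (1 - \<eta> * t)) - (- of_real \<kappa>) * (1 * (1 - \<eta> * t) + (0 - \<eta> * 1) * t) = of_real \<kappa> * (1 - 2 * \<eta> * t)"
      by (simp add: algebra_simps)
    moreover have "0 * (t - 1) - complex_of_real (\<kappa> - 1) * (1 - 0) = - of_real (\<kappa> - 1)" by simp
    ultimately show ?thesis by (simp only: power2_eq_square minus_divide_left[symmetric] diff_conv_add_uminus)
  qed
  finally have "(deriv (phi2 \<kappa> \<eta>) has_field_derivative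
      (of_real \<kappa> * (1 - 2 * \<eta> * t) / (t * (1 - \<eta> * t))\<^sup>2 - of_real (\<kappa> - 1) / (t - 1)\<^sup>2)) (at t)"
    by (rule has_field_derivative_transform_within_open[OF _ op tS]) (use d1 in auto)
  then show ?thesis by (rule DERIV_imp_deriv)
qed

text \<open>With q = 1 - z t the saddle point equation reads t q = \<kappa> (t - 1)/(\<kappa> - 1).
  It cancels (t - 1)^2 from the second derivative and leaves an expression linear in q, hence linear
  in the root.\<close>

lemma X2_eq_deriv2:
  assumes \<kappa>: "\<kappa> > 1" and z: "z \<in> slit_both"
  shows "of_real ((\<kappa> - 1) / \<kappa>) * rt2 \<kappa> z
    = - ((saddle2 \<kappa> z - 1)\<^sup>2 * deriv (deriv (phi2 \<kappa> z)) (saddle2 \<kappa> z))"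
proof -
  have zl: "z \<in> slit_left" using z by (simp add: slit_both_def)
  define t where "t = saddle2 \<kappa> z"
  define k where "k = complex_of_real \<kappa>"
  define S where "S = rt2 \<kappa> z"
  define q where "q = 1 - z * t"
  have k: "k \<noteq> 0" "k - 1 \<noteq> 0" using \<kappa> by (auto simp: k_def complex_eq_iff)
  have t: "t - 1 \<noteq> 0" "q \<noteq> 0" "t \<noteq> 0"
    using saddle2_slit[OF \<kappa> z] by (auto simp: t_def q_def)
  have q: "q = (2 * k - 1 - S) / (2 * (k - 1))" unfolding q_def t_def S_def k_def by (rule saddle2_mult[OF \<kappa> zl])
  have t1: "t - 1 = (2 * k - 1 - S) / (1 + S)" unfolding t_def S_def k_def by (rule saddle2_minus_1[OF \<kappa> zl])
  have te: "t = 2 * k / (1 + S)" by (simp add: t_def saddle2_def S_def k_def)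
  have "2 * k / (1 + S) * (a / (2 * b)) = k * (a / (1 + S)) / b" for a b by simp
  then have tq: "t * q = k * (t - 1) / (k - 1)" unfolding q t1 unfolding te .
  have frac: "x\<^sup>2 * (k * c / (k * x / (k - 1))\<^sup>2) = (k - 1)\<^sup>2 * c / k" if "x \<noteq> 0" for x c
    using that k by (simp add: field_simps power2_eq_square)
  have neg: "- (x\<^sup>2 * (a - b / x\<^sup>2)) = b - x\<^sup>2 * a" if "x \<noteq> 0" for x a b :: complex
    using that by (simp add: right_diff_distrib)
  have zt: "1 - 2 * z * t = 2 * q - 1" by (simp add: q_def)
  have kq: "2 * (k - 1) * q = 2 * k - 1 - S" unfolding q using k(2) by simp
  have "- ((t - 1)\<^sup>2 * deriv (deriv (phi2 \<kappa> z)) t)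
      = (k - 1) - (t - 1)\<^sup>2 * (k * (2 * q - 1) / (k * (t - 1) / (k - 1))\<^sup>2)"
    unfolding t_def phi2_deriv2[OF saddle2_slit(1,2,4)[OF \<kappa> z]] unfolding t_def[symmetric] zt q_def[symmetric] tq
    unfolding neg[OF t(1)] by (simp add: k_def)
  also have "\<dots> = (k - 1) - (k - 1)\<^sup>2 * (2 * q - 1) / k" unfolding frac[OF t(1)] ..
  also have "\<dots> = (k - 1) * (k - (2 * (k - 1) * q - (k - 1))) / k"
    using k by (simp add: field_simps power2_eq_square)
  also have "\<dots> = (k - 1) / k * S" unfolding kq by simp
  finally show ?thesis by (simp add: t_def k_def S_def)
qed

text \<open>Now \<open>psi2 z t * (t - 1)\<close> is 1/(1 - z t), which supplies the rational factor
  of \<open>wkb2\<close>; the constant (\<kappa> - 1)/\<kappa> in X cancels against the one from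
  Stirling's formula.\<close>

lemma laplace_main_wkb2:
  assumes m: "m > 0" and \<kappa>: "\<kappa> > 1" and z: "z \<in> slit_both" "z \<noteq> 0"
  shows "laplace_main m \<kappa> (phi2 \<kappa> z) (psi2 z) (t2 \<kappa> z)
     = of_real (exp (stirling_rem m + stirling_rem (m * (\<kappa> - 1)) - stirling_rem (m * \<kappa>))) * wkb2 m \<kappa> z"
proof -
  have zl: "z \<in> slit_left" using z by (simp add: slit_both_def)
  define \<rho> where "\<rho> = stirling_rem m + stirling_rem (m * (\<kappa> - 1)) - stirling_rem (m * \<kappa>)"
  define c0 where "c0 = \<kappa> * ln \<kappa> - (\<kappa> - 1) * ln (\<kappa> - 1)"
  define t where "t = saddle2 \<kappa> z"
  define s where "s = sqrt ((\<kappa> - 1) / \<kappa>)"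
  have s: "s > 0" "s\<^sup>2 = (\<kappa> - 1) / \<kappa>" using \<kappa> by (auto simp: s_def)
  define X where "X = of_real ((\<kappa> - 1) / \<kappa>) * rt2 \<kappa> z"
  have t: "t \<noteq> 1" "1 - z * t \<noteq> 0" using saddle2_slit(3,4)[OF \<kappa> z(1)] by (auto simp: t_def)
  have "Re X > 0" using Re_rt2[OF \<kappa> zl] \<kappa> unfolding X_def by simp
  then have X: "X \<noteq> 0" "Re X \<ge> 0" by auto
  have rs: "csqrt X = of_real s * csqrt (rt2 \<kappa> z)"
  proof -
    have "rt2 \<kappa> z \<notin> \<real>\<^sub>\<le>\<^sub>0" using Re_rt2[OF \<kappa> zl] by (auto simp: complex_nonpos_Reals_iff)
    then have "Re (csqrt (rt2 \<kappa> z)) > 0" by (rule Re_csqrt_pos)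
    then have "csqrt ((of_real s * csqrt (rt2 \<kappa> z))\<^sup>2) = of_real s * csqrt (rt2 \<kappa> z)"
      using s by (intro csqrt_square) (simp del: csqrt.simps)
    moreover have "(of_real s * csqrt (rt2 \<kappa> z))\<^sup>2 = X"
      unfolding X_def power_mult_distrib power2_csqrt s(2)[symmetric] by simp
    ultimately show ?thesis by simp
  qed
  have C: "C_const m \<kappa> / sqrt (2 * pi * m) = s * exp (- m * c0) * exp \<rho>"
    unfolding C_const_stirling[OF m \<kappa>] c0_def[symmetric] \<rho>_def[symmetric] real_sqrt_mult[of "2 * pi * m"] s_def
    using m by simp
  have "laplace_main m \<kappa> (phi2 \<kappa> z) (psi2 z) t
     = of_real (C_const m \<kappa> / sqrt (2 * pi * m)) * (psi2 z t * (t - 1)) / csqrt X * exp (- of_real m * phi2 \<kappa> z t)"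
    by (rule laplace_main_eq[OF m t(1) _ X]) (use X2_eq_deriv2[OF \<kappa> z(1)] in \<open>simp add: t_def X_def\<close>)
  also have "psi2 z t * (t - 1) = 1 / (1 - z * t)" using t by (simp add: psi2_def divide_inverse)
  also have "\<dots> = 2 * (of_real \<kappa> - 1) / (2 * of_real \<kappa> - 1 - rt2 \<kappa> z)"
    unfolding t_def saddle2_mult[OF \<kappa> zl] by simp
  also have "of_real (C_const m \<kappa> / sqrt (2 * pi * m)) * (2 * (of_real \<kappa> - 1) / (2 * of_real \<kappa> - 1 - rt2 \<kappa> z)) / csqrt X
      * exp (- of_real m * phi2 \<kappa> z t)
    = of_real (exp \<rho>) * (2 * (of_real \<kappa> - 1) / ((2 * of_real \<kappa> - 1 - rt2 \<kappa> z) * csqrt (rt2 \<kappa> z))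
       * (exp (of_real (- m * c0)) * exp (- of_real m * phi2 \<kappa> z t)))"
    unfolding C exp_of_real rs using s by simp
  also have "exp (of_real (- m * c0)) * exp (- of_real m * phi2 \<kappa> z t) = exp (of_real m * (- phi2 \<kappa> z t - of_real c0))"
    unfolding exp_add[symmetric] by (rule arg_cong[of _ _ exp]) (simp add: algebra_simps)
  finally show ?thesis
    unfolding t2_eq_saddle2[OF \<kappa> zl z(2)] \<rho>_def wkb2_def t_def c0_def .
qed

text \<open>The analogue of \<open>err1\<close>: the residual divided by z S. Here z
  \<open>b\<close> is the part of D log \<open>wkb2\<close> free of m, and \<open>b'\<close>,
  \<open>s'\<close> are the z-derivatives of \<open>b\<close> and S. The terms -z b and -(1 - z)
  stem from the parts of P and Q free of m.\<close>

definition err2 :: "real \<Rightarrow> complex \<Rightarrow> complex \<Rightarrow> complex" where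
  "err2 \<kappa> z S = (let k = of_real \<kappa>; s' = 2 * k * (k - 1) / S;
      b = 1 / 2 + (2 * k - 1) / (2 * S) - k * (k - 1) * (1 - z) / S\<^sup>2;
      b' = - (2 * k - 1) * s' / (2 * S\<^sup>2) + k * (k - 1) / S\<^sup>2 + 2 * k * (k - 1) * (1 - z) * s' / S ^ 3
    in ((1 - z) * (b + z * b') + z * b\<^sup>2 - z * b - (1 - z)) / S)"

text \<open>Same scheme with D = z (1 - z) d/dz along \<open>path2\<close>. Since the path is not
  linear in r, the bounds keep their factor r.\<close>

lemma F2_wkb2_estimate:
  fixes m \<kappa> K :: real and \<eta> :: complex
  defines "C \<equiv> K * (exp K + 1) + exp K"
  assumes K: "K > 0" and m: "m \<ge> 2 * C" and \<kappa>: "\<kappa> > 1" and \<eta>: "\<eta> \<in> slit_both"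
    and bound1: "\<And>r. 0 < r \<Longrightarrow> r < 1 \<Longrightarrow>
      cmod (path2 \<eta> r * (2 * of_real \<kappa> - 1) / rt2 \<kappa> (path2 \<eta> r)) \<le> K * r"
    and bound2: "\<And>r. 0 < r \<Longrightarrow> r < 1 \<Longrightarrow>
      cmod (path2 \<eta> r * err2 \<kappa> (path2 \<eta> r) (rt2 \<kappa> (path2 \<eta> r))) \<le> K * r"
  shows "cmod (F2 m \<kappa> \<eta> / wkb2 m \<kappa> \<eta> - 1) \<le> 2 * C / m"
proof -
  have C: "C > 0" unfolding C_def using K by (simp add: add_pos_pos)
  have m0: "m > 0" using m C by linarith
  define f where "f = hyp2F1 (of_real (m * \<kappa> + 1)) (of_real (m * \<kappa> + 1)) (of_real (m + 1))"
  have ab: "m * \<kappa> + 1 > 0" "m * \<kappa> + 1 > 1" "m + 1 > 0" using m0 \<kappa> by (auto intro!: add_pos_pos)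
  note fh = hyp2F1_holomorphic_fps(1)[OF ab, folded f_def]
  define \<gamma> where "\<gamma> = path2 \<eta>"
  define M :: complex where "M = of_real m"
  define k :: complex where "k = of_real \<kappa>"
  let ?S = "rt2 \<kappa>"
  define s' where "s' = (\<lambda>z. 2 * k * (k - 1) / ?S z)"
  define b where "b = (\<lambda>z. 1 / 2 + (2 * k - 1) / (2 * ?S z) - k * (k - 1) * (1 - z) / (?S z)\<^sup>2)"
  define b' where "b' = (\<lambda>z. - (2 * k - 1) * s' z / (2 * (?S z)\<^sup>2) + k * (k - 1) / (?S z)\<^sup>2
     + 2 * k * (k - 1) * (1 - z) * s' z / ?S z ^ 3)"
  have k: "k \<noteq> 0" "k - 1 \<noteq> 0" using \<kappa> by (auto simp: k_def complex_eq_iff)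
  have Z: "z \<in> slit_both" if z: "z \<in> \<gamma> ` {0..1}" for z
    using z path2_slit[OF \<eta>] by (auto simp: \<gamma>_def)
  have \<gamma>1: "\<gamma> 1 = \<eta>" by (simp add: \<gamma>_def path2_def)
  have "cmod (f (\<gamma> 1) / wkb2 m \<kappa> (\<gamma> 1) - 1) \<le> 2 * C / m"
    unfolding C_def
  proof (rule wkb_along_path[OF K m[unfolded C_def],
        where g = "\<lambda>z. z * (1 - z)" and F = f and DF = "\<lambda>z. z * (1 - z) * deriv f z"
          and M = "wkb2 m \<kappa>" and R = ?S and lam = "\<lambda>z. M * ((?S z - 1 + 2 * k * z) / 2) + z * b z"
          and P = "\<lambda>z. M * (1 - 2 * k * z) - z" and Q = "\<lambda>z. - (z * (1 - z) * (M * k + 1)\<^sup>2)"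
          and \<sigma> = "\<lambda>z. z * (2 * k - 1) / ?S z" and e = "\<lambda>z. z * err2 \<kappa> z (?S z)"
          and F' = "deriv f"
          and DF' = "\<lambda>z. (1 - 2 * z) * deriv f z + z * (1 - z) * deriv (deriv f) z"
          and M' = "\<lambda>z. (M * (4 * k\<^sup>2 * (k - 1) / ((1 + ?S z) * (2 * k - 1 - ?S z)))
             + s' z * (1 / (2 * k - 1 - ?S z) - 1 / (2 * ?S z))) * wkb2 m \<kappa> z"
          and R' = s' and lam' = "\<lambda>z. M * ((s' z + 2 * k) / 2) + (b z + z * b' z)"])
    show "\<gamma> 0 = 0" by (simp add: \<gamma>_def path2_def)
    show "continuous_on {0..1} \<gamma>"
      unfolding \<gamma>_def path2_def[abs_def] using path2_denom[OF \<eta>] by (auto intro!: continuous_intros)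
    show "(\<gamma> has_vector_derivative \<gamma> r * (1 - \<gamma> r) / of_real r) (at r)" if "0 < r" "r < 1" for r
      unfolding \<gamma>_def using that by (intro path2_deriv[OF \<eta>]) auto
    fix z assume "z \<in> \<gamma> ` {0..1}"
    then have z: "z \<in> slit_both" by (rule Z)
    then have zl: "z \<in> slit_left" and zr: "z \<in> slit_right" by (auto simp: slit_both_def slit_right_def)
    define S where "S = ?S z"
    have S0: "S \<noteq> 0" "1 + S \<noteq> 0" "2 * k - 1 - S \<noteq> 0"
      using rt2_nz[OF \<kappa> zl] rt2_ne[OF \<kappa> z] by (auto simp: S_def k_def)
    have S2: "S\<^sup>2 = 1 + 4 * k * (k - 1) * z" unfolding S_def k_def by (rule rt2_square[OF \<kappa>])
    show df: "(f has_field_derivative deriv f z) (at z)"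
      using fh slit_right(1) zr by (rule holomorphic_derivI)
    have "deriv f holomorphic_on slit_right" using fh slit_right(1) by (rule holomorphic_deriv)
    then have ddf: "(deriv f has_field_derivative deriv (deriv f) z) (at z)"
      using slit_right(1) zr by (rule holomorphic_derivI)
    show "((\<lambda>z. z * (1 - z) * deriv f z) has_field_derivative
        (1 - 2 * z) * deriv f z + z * (1 - z) * deriv (deriv f) z) (at z)"
      by (rule derivative_eq_intros refl ddf)+ (simp add: algebra_simps)
    show "(wkb2 m \<kappa> has_field_derivative (M * (4 * k\<^sup>2 * (k - 1) / ((1 + ?S z) * (2 * k - 1 - ?S z)))
             + s' z * (1 / (2 * k - 1 - ?S z) - 1 / (2 * ?S z))) * wkb2 m \<kappa> z) (at z)"
      unfolding M_def k_def s'_def by (rule wkb2_deriv[OF \<kappa> z])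
    show dS: "(?S has_field_derivative s' z) (at z)" unfolding s'_def k_def by (rule rt2_deriv[OF \<kappa> zl])
    have db: "(b has_field_derivative b' z) (at z)"
    proof -
      have "(b has_field_derivative
         (0 + (0 * (2 * S) - (2 * k - 1) * (2 * s' z)) / ((2 * S) * (2 * S))
           - ((k * (k - 1) * (0 - 1)) * S\<^sup>2 - k * (k - 1) * (1 - z) * (2 * S * s' z)) / (S\<^sup>2 * S\<^sup>2))) (at z)"
        unfolding b_def S_def
        by (rule derivative_eq_intros refl dS | use S0 in \<open>simp add: S_def\<close>)+
      also have "0 + (0 * (2 * S) - (2 * k - 1) * (2 * s' z)) / ((2 * S) * (2 * S))
           - ((k * (k - 1) * (0 - 1)) * S\<^sup>2 - k * (k - 1) * (1 - z) * (2 * S * s' z)) / (S\<^sup>2 * S\<^sup>2) = b' z"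
      proof -
        have *: "0 + (0 * (2 * S) - p * (2 * x)) / ((2 * S) * (2 * S)) - ((q * (0 - 1)) * S\<^sup>2 - q * y * (2 * S * x)) / (S\<^sup>2 * S\<^sup>2)
          = - p * x / (2 * S\<^sup>2) + q / S\<^sup>2 + 2 * q * y * x / S ^ 3" for p q x y
          using S0(1) by (simp add: field_simps power2_eq_square power3_eq_cube)
        show ?thesis unfolding * b'_def S_def[symmetric] by (simp add: mult_ac)
      qed
      finally show ?thesis .
    qed
    show "((\<lambda>z. M * ((?S z - 1 + 2 * k * z) / 2) + z * b z) has_field_derivative
        M * ((s' z + 2 * k) / 2) + (b z + z * b' z)) (at z)"
      by (rule derivative_eq_intros refl dS db | simp)+
    show "z * (1 - z) * ((1 - 2 * z) * deriv f z + z * (1 - z) * deriv (deriv f) z)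
        + (M * (1 - 2 * k * z) - z) * (z * (1 - z) * deriv f z) + - (z * (1 - z) * (M * k + 1)\<^sup>2) * f z = 0"
    proof -
      have "z * (1 - z) * ((1 - 2 * z) * deriv f z + z * (1 - z) * deriv (deriv f) z)
        + (M * (1 - 2 * k * z) - z) * (z * (1 - z) * deriv f z) + - (z * (1 - z) * (M * k + 1)\<^sup>2) * f z
        = z * (1 - z) * (z * (1 - z) * deriv (deriv f) z
            + (of_real (m + 1) - of_real ((m * \<kappa> + 1) + (m * \<kappa> + 1) + 1) * z) * deriv f z
            - of_real ((m * \<kappa> + 1) * (m * \<kappa> + 1)) * f z)"
        by (simp add: M_def k_def algebra_simps power2_eq_square)
      also have "\<dots> = 0" unfolding f_def hyp2F1_ode[OF ab zr] by simp
      finally show ?thesis .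
    qed
    \<comment> \<open>Factoring z and 1 - z in terms of S cancels the denominators in the
      logarithmic derivative of \<open>wkb2\<close>.\<close>
    have z1: "1 - z = (2 * k - 1 - S) * (2 * k - 1 + S) / (4 * k * (k - 1))"
    proof -
      have "(2 * k - 1 - S) * (2 * k - 1 + S) = (2 * k - 1)\<^sup>2 - S\<^sup>2" by (simp add: algebra_simps power2_eq_square)
      also have "\<dots> = (4 * k * (k - 1)) * (1 - z)" unfolding S2 by (simp add: algebra_simps power2_eq_square)
      finally show ?thesis using k by simp
    qed
    have z0: "4 * k * (k - 1) * z = (S - 1) * (S + 1)" using S2 by (simp add: algebra_simps power2_eq_square)
    show "z * (1 - z) * ((M * (4 * k\<^sup>2 * (k - 1) / ((1 + ?S z) * (2 * k - 1 - ?S z)))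
             + s' z * (1 / (2 * k - 1 - ?S z) - 1 / (2 * ?S z))) * wkb2 m \<kappa> z)
        = (M * ((?S z - 1 + 2 * k * z) / 2) + z * b z) * wkb2 m \<kappa> z"
    proof -
      have e1: "z * (1 - z) * (4 * k\<^sup>2 * (k - 1) / ((1 + S) * (2 * k - 1 - S))) = (S - 1 + 2 * k * z) / 2"
      proof -
        have "z * (1 - z) * (4 * k\<^sup>2 * (k - 1) / ((1 + S) * (2 * k - 1 - S))) = z * k * (2 * k - 1 + S) / (1 + S)"
          unfolding z1 using S0 k by (simp add: power2_eq_square)
        also have "\<dots> = (4 * k * (k - 1) * z) * (2 * k - 1 + S) / (4 * (k - 1) * (1 + S))"
        proof -
          have "z * k * p / q = 4 * k * j * z * p / (4 * j * q)" if "j \<noteq> 0" for p q j using that by simp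
          then show ?thesis using k(2) .
        qed
        also have "\<dots> = (S - 1) * (2 * k - 1 + S) / (4 * (k - 1))"
          unfolding z0 using S0(2) by (simp add: add.commute)
        also have "\<dots> = (2 * (k - 1) * (S - 1) + (S - 1) * (S + 1)) / (4 * (k - 1))"
          by (rule arg_cong[of _ _ "\<lambda>x. x / (4 * (k - 1))"]) (simp add: algebra_simps)
        also have "\<dots> = (2 * (k - 1) * (S - 1 + 2 * k * z)) / (2 * (k - 1) * 2)"
          unfolding z0[symmetric] by (rule arg_cong2[of _ _ _ _ "(/)"]) (simp_all add: algebra_simps)
        also have "\<dots> = (S - 1 + 2 * k * z) / 2"
        proof -
          have "2 * j * y / (2 * j * 2) = y / 2" if "j \<noteq> 0" for y j :: complex using that by simp
          then show ?thesis using k(2) .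
        qed
        finally show ?thesis .
      qed
      \<comment> \<open>The two fractions are the contributions of the amplitude factors 1/(2k - 1 -
        S) and S^(-1/2).\<close>
      have e2: "z * (1 - z) * (s' z * (1 / (2 * k - 1 - S) - 1 / (2 * S))) = z * b z"
      proof -
        have "(1 - z) * s' z / (2 * k - 1 - S) = (2 * k - 1 + S) / (2 * S)"
        proof -
          have "d * c / (4 * k * j) * (2 * k * j / S) / d = c / (2 * S)" if "j \<noteq> 0" "d \<noteq> 0" for c d j
            using that k(1) by simp
          then show ?thesis unfolding z1 s'_def S_def[symmetric] using k(2) S0(3) .
        qed
        also have "\<dots> = 1 / 2 + (2 * k - 1) / (2 * S)" using S0(1) by (simp add: add_divide_distrib)
        finally have a: "(1 - z) * s' z / (2 * k - 1 - S) = 1 / 2 + (2 * k - 1) / (2 * S)" .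
        have c: "(1 - z) * s' z / (2 * S) = k * (k - 1) * (1 - z) / S\<^sup>2"
        proof -
          have "y * (2 * k * j / S) / (2 * S) = k * j * y / S\<^sup>2" for y j
            by (simp add: power2_eq_square)
          then show ?thesis unfolding s'_def S_def[symmetric] .
        qed
        have "z * (1 - z) * (s' z * (1 / (2 * k - 1 - S) - 1 / (2 * S)))
            = z * ((1 - z) * s' z / (2 * k - 1 - S) - (1 - z) * s' z / (2 * S))"
          by (simp only: right_diff_distrib mult_ac times_divide_eq_right mult_1_right mult_1_left)
        then show ?thesis unfolding a c b_def S_def[symmetric] .
      qed
      have lin: "z * (1 - z) * ((M * p + q) * w) = (M * (z * (1 - z) * p) + z * (1 - z) * q) * w" for p q w
        by (simp add: algebra_simps)
      show ?thesis unfolding S_def[symmetric] lin e1 e2 ..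
    qed
    show "wkb2 m \<kappa> z \<noteq> 0" by (rule wkb2_nz[OF \<kappa> z])
    show "?S z \<noteq> 0" using S0 by (simp add: S_def)
    have zb: "S * b z = S / 2 + (2 * k - 1) / 2 - k * (k - 1) * (1 - z) / S"
      unfolding b_def S_def[symmetric] using S0(1) by (simp add: field_simps power2_eq_square)
    show "2 * (M * ((?S z - 1 + 2 * k * z) / 2) + z * b z) + (M * (1 - 2 * k * z) - z) + z * (1 - z) * s' z / ?S z
        = of_real m * ?S z + z * (2 * k - 1) / ?S z"
    proof -
      have c: "z * (1 - z) * s' z / S = 2 * z * (k * (k - 1) * (1 - z) / S\<^sup>2)"
      proof -
        have "z * y * (2 * k * j / S) / S = 2 * z * (k * j * y / S\<^sup>2)" for y j
          by (simp add: power2_eq_square)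
        then show ?thesis unfolding s'_def S_def[symmetric] .
      qed
      have d: "2 * (z * b z) = z + z * (2 * k - 1) / S - 2 * z * (k * (k - 1) * (1 - z) / S\<^sup>2)"
      proof -
        have "2 * (z * (1 / 2 + p / (2 * S) - q)) = z + z * p / S - 2 * z * q" for p q
          by (simp add: right_diff_distrib distrib_left)
        then show ?thesis unfolding b_def S_def[symmetric] .
      qed
      have "2 * (M * ((S - 1 + 2 * k * z) / 2) + x) + (M * (1 - 2 * k * z) - z) + y = M * S + (2 * x - z + y)" for x y
        by (simp add: field_simps)
      note lin = this
      show ?thesis unfolding S_def[symmetric] M_def[symmetric] lin d c by simp
    qed
    show "z * (1 - z) * (M * ((s' z + 2 * k) / 2) + (b z + z * b' z)) + (M * ((?S z - 1 + 2 * k * z) / 2) + z * b z)\<^sup>2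
        + (M * (1 - 2 * k * z) - z) * (M * ((?S z - 1 + 2 * k * z) / 2) + z * b z) + - (z * (1 - z) * (M * k + 1)\<^sup>2)
        = z * err2 \<kappa> z (?S z) * ?S z"
    proof -
      \<comment> \<open>Again sorted by powers of m: \<open>m2\<close> is the quadratic for u,
        \<open>m1\<close> the linear equation for l, \<open>m00\<close> the error term.\<close>
      define u where "u = (S - 1 + 2 * k * z) / 2"
      define l where "l = z * b z"
      have m2: "u\<^sup>2 + (1 - 2 * k * z) * u - k\<^sup>2 * (z * (1 - z)) = 0"
      proof -
        have "4 * (u\<^sup>2 + (1 - 2 * k * z) * u - k\<^sup>2 * (z * (1 - z))) = S\<^sup>2 - (1 + 4 * k * (k - 1) * z)"
          by (simp add: u_def field_simps power2_eq_square)
        then have "4 * (u\<^sup>2 + (1 - 2 * k * z) * u - k\<^sup>2 * (z * (1 - z))) = 0" unfolding S2 by simp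
        then show ?thesis by (simp only: mult_eq_0_iff) simp
      qed
      have uS: "2 * u + (1 - 2 * k * z) = S" by (simp add: u_def field_simps)
      have Sl: "S * l = z * (S / 2 + (2 * k - 1) / 2 - k * (k - 1) * (1 - z) / S)"
        unfolding zb[symmetric] l_def by simp
      have gs: "z * (1 - z) * ((s' z + 2 * k) / 2) = z * (k * (k - 1) * (1 - z) / S) + z * (1 - z) * k"
      proof -
        have "z * y * ((2 * k * j / S + 2 * k) / 2) = z * (k * j * y / S) + z * y * k" for y j
          by (simp add: add_divide_distrib distrib_left)
        then show ?thesis unfolding s'_def S_def[symmetric] .
      qed
      have m1: "z * (1 - z) * ((s' z + 2 * k) / 2) + (2 * u + (1 - 2 * k * z)) * l - z * u - 2 * k * (z * (1 - z)) = 0"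
      proof -
        have "z * w + z * (1 - z) * k + z * (S / 2 + (2 * k - 1) / 2 - w)
            - z * ((S - 1 + 2 * k * z) / 2) - 2 * k * (z * (1 - z)) = 0" for w
          by (simp add: field_simps)
        then show ?thesis unfolding uS Sl gs unfolding u_def .
      qed
      have m00: "z * (1 - z) * (b z + z * b' z) + l\<^sup>2 - z * l - z * (1 - z) = z * err2 \<kappa> z S * S"
      proof -
        have e: "err2 \<kappa> z S * S = (1 - z) * (b z + z * b' z) + z * (b z)\<^sup>2 - z * b z - (1 - z)"
          unfolding err2_def Let_def b_def b'_def s'_def S_def[symmetric] k_def[symmetric] using S0(1) by simp
        show ?thesis
          unfolding mult.assoc[of z "err2 \<kappa> z S"] e l_def by (simp add: algebra_simps power2_eq_square)
      qed
      have "z * (1 - z) * (M * ((s' z + 2 * k) / 2) + (b z + z * b' z)) + (M * u + l)\<^sup>2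
        + (M * (1 - 2 * k * z) - z) * (M * u + l) + - (z * (1 - z) * (M * k + 1)\<^sup>2)
        = M\<^sup>2 * (u\<^sup>2 + (1 - 2 * k * z) * u - k\<^sup>2 * (z * (1 - z)))
          + M * (z * (1 - z) * ((s' z + 2 * k) / 2) + (2 * u + (1 - 2 * k * z)) * l - z * u - 2 * k * (z * (1 - z)))
          + (z * (1 - z) * (b z + z * b' z) + l\<^sup>2 - z * l - z * (1 - z))"
        by (simp add: algebra_simps power2_eq_square)
      also have "\<dots> = z * err2 \<kappa> z S * S" unfolding m2 m1 m00 by simp
      finally show ?thesis unfolding u_def l_def S_def .
    qed
  next
    show "f 0 = 1" using hypergeometric_at_0(2)[OF ab] by (simp add: f_def)
    show "wkb2 m \<kappa> 0 = 1" by (rule wkb2_0[OF \<kappa>])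
    show "M * ((?S 0 - 1 + 2 * k * 0) / 2) + 0 * b 0 = 0" by (simp add: rt2_0[OF \<kappa>])
  next
    fix r :: real assume r: "0 < r" "r < 1"
    then have "\<gamma> r \<in> slit_both" by (intro Z) auto
    then show "Re (?S (\<gamma> r)) \<ge> 0" using Re_rt2[OF \<kappa>, of "\<gamma> r"] by (simp add: slit_both_def)
    show "cmod (\<gamma> r * (2 * k - 1) / ?S (\<gamma> r)) \<le> K * r" using bound1[OF r] by (simp add: \<gamma>_def k_def)
    show "cmod (\<gamma> r * err2 \<kappa> (\<gamma> r) (?S (\<gamma> r))) \<le> K * r" using bound2[OF r] by (simp add: \<gamma>_def)
  qed auto
  then show ?thesis unfolding \<gamma>1 by (simp add: F2_def f_def)
qed

section \<open>Uniformity\<close>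

text \<open>Bounds are taken over all pairs of a point and a square root there. This set is compact
  whatever branch is meant, so no continuity of the chosen branch has to be discussed.\<close>

lemma compact_square_roots:
  fixes f :: "'a::metric_space \<Rightarrow> complex"
  assumes T: "compact T" and f: "continuous_on T f"
  shows "compact {(x, w). x \<in> T \<and> w\<^sup>2 = f x}"
proof -
  obtain b where b: "\<And>x. x \<in> T \<Longrightarrow> cmod (f x) \<le> b"
    using compact_imp_bounded[OF compact_continuous_image[OF f T]] by (auto simp: bounded_iff)
  \<comment> \<open>Every root lies in this ball: |w| > b + 1 \<ge> 1 would give |w| \<le> |w|^2
    \<le> b.\<close>
  let ?B = "T \<times> cball (0::complex) (b + 1)"
  have "continuous_on ?B (\<lambda>p. (snd p)\<^sup>2 - f (fst p))"
    by (intro continuous_intros continuous_on_compose2[OF f]) auto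
  moreover have B: "compact ?B" using T by (intro compact_Times) auto
  ultimately have "closed (?B \<inter> (\<lambda>p. (snd p)\<^sup>2 - f (fst p)) -` {0})"
    by (intro continuous_closed_preimage compact_imp_closed) auto
  from compact_Int_closed[OF B this]
  have "compact (?B \<inter> (\<lambda>p. (snd p)\<^sup>2 - f (fst p)) -` {0})"
    by (simp only: Int_assoc[symmetric] Int_absorb)
  also have "?B \<inter> (\<lambda>p. (snd p)\<^sup>2 - f (fst p)) -` {0} = {(x, w). x \<in> T \<and> w\<^sup>2 = f x}"
  proof -
    have "cmod w \<le> b + 1" if "x \<in> T" "w\<^sup>2 = f x" for x w
    proof (rule ccontr)
      assume "\<not> cmod w \<le> b + 1"
      then have w: "cmod w > b + 1" by simp
      have "b \<ge> 0" using b[OF that(1)] norm_ge_zero[of "f x"] by linarith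
      then have "cmod w * 1 \<le> cmod w * cmod w" using w by (intro mult_left_mono) auto
      also have "\<dots> \<le> b" using b[OF that(1)] that(2) by (metis norm_mult power2_eq_square)
      finally show False using w by simp
    qed
    then show ?thesis by auto
  qed
  finally show ?thesis .
qed

lemma compact_continuous_bound:
  fixes h :: "'a::topological_space \<Rightarrow> complex"
  assumes "compact T" "continuous_on T h"
  shows "\<exists>K>0. \<forall>x\<in>T. cmod (h x) \<le> K"
proof -
  obtain b where "\<And>x. x \<in> T \<Longrightarrow> cmod (h x) \<le> b"
    using compact_imp_bounded[OF compact_continuous_image[OF assms(2,1)]] by (auto simp: bounded_iff)
  then have "\<forall>x\<in>T. cmod (h x) \<le> max b 1" by (auto intro: le_max_iff_disj[THEN iffD2])
  then show ?thesis by (intro exI[of _ "max b 1"]) auto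
qed

text \<open>The condition on the infimum is replaced by one closed condition for each y, which makes
  compactness evident.\<close>

definition Omega_hull :: "real \<Rightarrow> (real \<times> complex) set" where
  "Omega_hull \<delta> = {1 + \<delta>..1 + 1 / \<delta>} \<times> (cball 0 (1 / \<delta>) \<inter> (\<Inter>y\<in>{..<0}. {z. \<delta> \<le> cmod (z - complex_of_real y)}))"

definition Omega2_hull :: "real \<Rightarrow> (real \<times> complex) set" where
  "Omega2_hull \<delta> = Omega_hull \<delta> \<inter> UNIV \<times> (\<Inter>y\<in>{1<..}. {z. \<delta> \<le> cmod (z - complex_of_real y)})"

lemma compact_Omega_hulls: "compact (Omega_hull \<delta>)" "compact (Omega2_hull \<delta>)"
proof -
  have cl: "closed (\<Inter>y\<in>Y. {z. \<delta> \<le> cmod (z - complex_of_real y)})" for Y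
    by (intro closed_INT ballI closed_Collect_le continuous_intros)
  show "compact (Omega_hull \<delta>)"
    unfolding Omega_hull_def by (intro compact_Times compact_Int_closed cl) auto
  then show "compact (Omega2_hull \<delta>)"
    unfolding Omega2_hull_def by (intro compact_Int_closed closed_Times cl) auto
qed

lemma Omega_subset: "Omega \<delta> \<subseteq> Omega_hull \<delta>" "Omega2 \<delta> \<subseteq> Omega2_hull \<delta>"
proof -
  have inf: "\<delta> \<le> cmod (z - of_real y)" if "(INF y\<in>Y. cmod (z - complex_of_real y)) \<ge> \<delta>" "y \<in> Y" for z y Y
  proof -
    have "(INF y\<in>Y. cmod (z - complex_of_real y)) \<le> cmod (z - of_real y)"
      by (rule cINF_lower[OF _ that(2)]) (auto intro!: bdd_belowI[of _ 0])
    with that(1) show ?thesis by simp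
  qed
  show *: "Omega \<delta> \<subseteq> Omega_hull \<delta>"
    unfolding Omega_def Omega_hull_def using inf[where Y = "{..<0}"] by (auto simp: algebra_simps)
  then show "Omega2 \<delta> \<subseteq> Omega2_hull \<delta>"
    unfolding Omega2_def Omega2_hull_def using inf[where Y = "{1<..}"] by auto
qed

lemma Omega_hull_slit:
  assumes \<delta>: "\<delta> > 0" and p: "(\<kappa>, z) \<in> Omega_hull \<delta>"
  shows "\<kappa> > 1" "z \<in> slit_left" "z \<noteq> 0" "\<delta> \<le> \<kappa> - 1"
proof -
  show "\<kappa> > 1" "\<delta> \<le> \<kappa> - 1" using p \<delta> by (auto simp: Omega_hull_def)
  have far: "\<delta> \<le> cmod (z - of_real y)" if "y < 0" for y using p that by (auto simp: Omega_hull_def)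
  have "z \<notin> \<real>\<^sub>\<le>\<^sub>0"
  proof
    assume "z \<in> \<real>\<^sub>\<le>\<^sub>0"
    then obtain x where x: "z = of_real x" "x \<le> 0" by (elim nonpos_Reals_cases)
    \<comment> \<open>The test point lies \<delta>/2 to the left, so it is strictly negative even
      for x = 0.\<close>
    have "\<delta> \<le> cmod (of_real x - of_real (x - \<delta> / 2))" using far[of "x - \<delta> / 2"] x \<delta> by simp
    also have "\<dots> = \<delta> / 2" using \<delta> by (simp flip: of_real_diff)
    finally show False using \<delta> by simp
  qed
  then show "z \<in> slit_left" "z \<noteq> 0" by (auto simp: slit_left_def)
qed

lemma Omega2_hull_slit:
  assumes \<delta>: "\<delta> > 0" and p: "(\<kappa>, z) \<in> Omega2_hull \<delta>"
  shows "z \<in> slit_both"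
proof -
  have far: "\<delta> \<le> cmod (z - of_real y)" if "y > 1" for y using p that by (auto simp: Omega2_hull_def)
  have "z \<notin> complex_of_real ` {1..}"
  proof
    assume "z \<in> complex_of_real ` {1..}"
    then obtain x where x: "z = of_real x" "x \<ge> 1" by auto
    have "\<delta> \<le> cmod (of_real x - of_real (x + \<delta> / 2))" using far[of "x + \<delta> / 2"] x \<delta> by simp
    also have "\<dots> = \<delta> / 2" using \<delta> by (simp flip: of_real_diff)
    finally show False using \<delta> by simp
  qed
  moreover have "z \<in> slit_left" using Omega_hull_slit(2)[OF \<delta>, of \<kappa>] p by (auto simp: Omega2_hull_def)
  ultimately show ?thesis by (simp add: slit_both_def)
qed

text \<open>The set of all (\<kappa>, r \<eta>) with 0 \<le> r \<le> 1 is compact and the roots over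
  it do not vanish, so 1/R and \<open>err1\<close> are bounded there in terms of \<delta> alone. The
  half-plane condition enters only through \<open>F1_wkb1_estimate\<close>.\<close>

lemma F1_wkb1_uniform:
  assumes \<delta>: "\<delta> > 0"
  shows "\<exists>C>0. \<forall>m\<ge>C. \<forall>(\<kappa>, \<eta>)\<in>Omega1 \<delta>. cmod (F1 m \<kappa> \<eta> / wkb1 m \<kappa> \<eta> - 1) \<le> C / m"
proof -
  let ?\<Phi> = "\<lambda>(r::real, p::real \<times> complex). (fst p, of_real r * snd p)"
  define T where "T = ?\<Phi> ` ({0..1} \<times> Omega_hull \<delta>)"
  have "compact T" unfolding T_def case_prod_beta
    by (intro compact_continuous_image compact_Times compact_Omega_hulls continuous_intros) auto
  moreover have "continuous_on T (\<lambda>p. (snd p - 1)\<^sup>2 + 4 * of_real (fst p) * snd p)"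
    by (intro continuous_intros)
  ultimately have cT: "compact {(x, w). x \<in> T \<and> w\<^sup>2 = (snd x - 1)\<^sup>2 + 4 * of_real (fst x) * snd x}"
    (is "compact ?T") by (rule compact_square_roots)
  have T: "\<kappa> > 1 \<and> z \<in> slit_left" if "(\<kappa>, z) \<in> T" for \<kappa> z
  proof -
    from that obtain r \<eta> where r: "0 \<le> r" "r \<le> 1" "(\<kappa>, \<eta>) \<in> Omega_hull \<delta>" "z = of_real r * \<eta>"
      by (auto simp: T_def)
    then show ?thesis using Omega_hull_slit[OF \<delta> r(3)]
      by (auto simp: slit_left_def complex_nonpos_Reals_iff mult_le_0_iff)
  qed
  have nz: "w \<noteq> 0" if "((\<kappa>, z), w) \<in> ?T" for \<kappa> z w
  proof -
    have *: "\<kappa> > 1" "z \<in> slit_left" using T that by auto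
    have "w\<^sup>2 = (rt1 \<kappa> z)\<^sup>2" using that unfolding rt1_square(2)[OF *] by simp
    then show ?thesis using rt1_nz[OF *] by auto
  qed
  have "continuous_on ?T (\<lambda>q. 1 / snd q)"
    using nz by (intro continuous_intros) auto
  from compact_continuous_bound[OF cT this] obtain K1
    where K1: "K1 > 0" and "\<forall>q\<in>?T. cmod (1 / snd q) \<le> K1" by blast
  note K1 = K1 bspec[OF this(2), of "((\<kappa>, z), w)" for \<kappa> z w, unfolded fst_conv snd_conv]
  have "continuous_on ?T (\<lambda>q. err1 (fst (fst q)) (snd (fst q)) (snd q))"
    unfolding err1_def Let_def shift1_def using nz by (intro continuous_intros) auto
  from compact_continuous_bound[OF cT this] obtain K2
    where K2: "K2 > 0" and "\<forall>q\<in>?T. cmod (err1 (fst (fst q)) (snd (fst q)) (snd q)) \<le> K2" by blast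
  note K2 = K2 bspec[OF this(2), of "((\<kappa>, z), w)" for \<kappa> z w, unfolded fst_conv snd_conv]
  \<comment> \<open>The factor 1/\<delta> bounds |\<eta>|; the sum serves both coefficients with one
    constant.\<close>
  define K where "K = (1 / \<delta>) * (K1 + K2)"
  have K: "K > 0" using \<delta> K1 K2 by (simp add: K_def)
  define C where "C = K * (exp K + 1) + exp K"
  have C: "C > 0" unfolding C_def using K by (simp add: add_pos_pos)
  show ?thesis
  proof (intro exI[of _ "2 * C"] conjI allI impI, goal_cases)
    case (2 m)
    show ?case
    proof (clarify)
      fix \<kappa> \<eta> assume p: "(\<kappa>, \<eta>) \<in> Omega1 \<delta>"
      then have pb: "(\<kappa>, \<eta>) \<in> Omega_hull \<delta>" and Re: "Re \<eta> \<ge> 1 - 2 * \<kappa>"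
        using Omega_subset(1)[of \<delta>] by (auto simp: Omega1_def)
      have inT: "((\<kappa>, of_real r * \<eta>), rt1 \<kappa> (of_real r * \<eta>)) \<in> ?T" if "0 < r" "r < 1" for r
      proof -
        have a: "(\<kappa>, of_real r * \<eta>) \<in> T"
          unfolding T_def using that pb by (intro image_eqI[of _ _ "(r, (\<kappa>, \<eta>))"]) auto
        then have "\<kappa> > 1" "of_real r * \<eta> \<in> slit_left" using T by auto
        from rt1_square(2)[OF this] a show ?thesis by simp
      qed
      have \<eta>: "cmod \<eta> \<le> 1 / \<delta>" using pb by (auto simp: Omega_hull_def)
      show "cmod (F1 m \<kappa> \<eta> / wkb1 m \<kappa> \<eta> - 1) \<le> 2 * C / m"
        unfolding C_def
      proof (rule F1_wkb1_estimate[OF K])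
        show "2 * (K * (exp K + 1) + exp K) \<le> m" using 2 by (simp add: C_def)
        show "1 < \<kappa>" "\<eta> \<in> slit_left" using Omega_hull_slit[OF \<delta> pb] by auto
        show "1 - 2 * \<kappa> \<le> Re \<eta>" by (rule Re)
        fix r :: real assume r: "0 < r" "r < 1"
        have "cmod (\<eta> / rt1 \<kappa> (of_real r * \<eta>)) = cmod \<eta> * cmod (1 / rt1 \<kappa> (of_real r * \<eta>))"
          by (simp add: norm_divide)
        also have "\<dots> \<le> (1 / \<delta>) * (K1 + K2)"
          using \<eta> K1(2)[OF inT[OF r]] K1 K2 \<delta> by (intro mult_mono) auto
        finally show "cmod (\<eta> / rt1 \<kappa> (of_real r * \<eta>)) \<le> K" by (simp add: K_def)
        have "cmod (\<eta> * err1 \<kappa> (of_real r * \<eta>) (rt1 \<kappa> (of_real r * \<eta>)))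
            = cmod \<eta> * cmod (err1 \<kappa> (of_real r * \<eta>) (rt1 \<kappa> (of_real r * \<eta>)))"
          by (simp add: norm_mult)
        also have "\<dots> \<le> (1 / \<delta>) * (K1 + K2)"
          using \<eta> K2(2)[OF inT[OF r]] K1 K2 \<delta> by (intro mult_mono) auto
        finally show "cmod (\<eta> * err1 \<kappa> (of_real r * \<eta>) (rt1 \<kappa> (of_real r * \<eta>))) \<le> K"
          by (simp add: K_def)
      qed
    qed
  qed (use C in simp)
qed

text \<open>As in the confluent case, over the compact set swept out by the paths, which stay away
  from both cuts.\<close>

lemma F2_wkb2_uniform:
  assumes \<delta>: "\<delta> > 0"
  shows "\<exists>C>0. \<forall>m\<ge>C. \<forall>(\<kappa>, \<eta>)\<in>Omega2 \<delta>. cmod (F2 m \<kappa> \<eta> / wkb2 m \<kappa> \<eta> - 1) \<le> C / m"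
proof -
  define D where "D = {0..1::real} \<times> Omega2_hull \<delta>"
  have cD: "compact D" unfolding D_def by (intro compact_Times compact_Omega_hulls) auto
  have nzD: "1 - (1 - of_real (fst q)) * snd (snd q) \<noteq> 0" if "q \<in> D" for q
    using path2_denom[of "snd (snd q)" "fst q"] Omega2_hull_slit[OF \<delta>, of "fst (snd q)" "snd (snd q)"] that
    by (auto simp: D_def)
  have "continuous_on D (\<lambda>q. snd (snd q) / (1 - (1 - of_real (fst q)) * snd (snd q)))"
    using nzD by (intro continuous_intros) auto
  \<comment> \<open>\<open>K0\<close> bounds the point on the path divided by r, which yields the
    factor r in the required bounds.\<close>
  then obtain K0 where K0: "K0 > 0"
    "\<And>q. q \<in> D \<Longrightarrow> cmod (snd (snd q) / (1 - (1 - of_real (fst q)) * snd (snd q))) \<le> K0"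
    using compact_continuous_bound[OF cD] by blast
  define T where "T = (\<lambda>q. (fst (snd q), path2 (snd (snd q)) (fst q))) ` D"
  have "compact T" unfolding T_def path2_def using nzD
    by (intro compact_continuous_image cD continuous_intros) auto
  moreover have "continuous_on T (\<lambda>p. 1 + 4 * of_real (fst p) * (of_real (fst p) - 1) * snd p)"
    by (intro continuous_intros)
  ultimately have cT: "compact {(x, w). x \<in> T \<and> w\<^sup>2 = 1 + 4 * of_real (fst x) * (of_real (fst x) - 1) * snd x}"
    (is "compact ?T") by (rule compact_square_roots)
  have T: "\<kappa> > 1 \<and> z \<in> slit_left" if "(\<kappa>, z) \<in> T" for \<kappa> z
  proof -
    from that obtain r \<eta> where r: "0 \<le> r" "r \<le> 1" "(\<kappa>, \<eta>) \<in> Omega2_hull \<delta>" "z = path2 \<eta> r"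
      by (auto simp: T_def D_def)
    have "z \<in> slit_both" unfolding r(4) by (rule path2_slit[OF Omega2_hull_slit[OF \<delta> r(3)] r(1,2)])
    moreover have "\<kappa> > 1" using Omega_hull_slit(1)[OF \<delta>, of \<kappa> \<eta>] r(3) by (auto simp: Omega2_hull_def)
    ultimately show ?thesis by (simp add: slit_both_def)
  qed
  have nz: "w \<noteq> 0" if "((\<kappa>, z), w) \<in> ?T" for \<kappa> z w
  proof -
    have *: "\<kappa> > 1" "z \<in> slit_left" using T that by auto
    have "w\<^sup>2 = (rt2 \<kappa> z)\<^sup>2" using that unfolding rt2_square[OF *(1)] by simp
    then show ?thesis using rt2_nz(1)[OF *] by auto
  qed
  have "continuous_on ?T (\<lambda>q. (2 * of_real (fst (fst q)) - 1) / snd q)"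
    using nz by (intro continuous_intros) auto
  from compact_continuous_bound[OF cT this] obtain K1
    where K1: "K1 > 0" and "\<forall>q\<in>?T. cmod ((2 * of_real (fst (fst q)) - 1) / snd q) \<le> K1" by blast
  note K1 = K1 bspec[OF this(2), of "((\<kappa>, z), w)" for \<kappa> z w, unfolded fst_conv snd_conv]
  have "continuous_on ?T (\<lambda>q. err2 (fst (fst q)) (snd (fst q)) (snd q))"
    unfolding err2_def Let_def using nz by (intro continuous_intros) auto
  from compact_continuous_bound[OF cT this] obtain K2
    where K2: "K2 > 0" and "\<forall>q\<in>?T. cmod (err2 (fst (fst q)) (snd (fst q)) (snd q)) \<le> K2" by blast
  note K2 = K2 bspec[OF this(2), of "((\<kappa>, z), w)" for \<kappa> z w, unfolded fst_conv snd_conv]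
  define K where "K = K0 * (K1 + K2)"
  have K: "K > 0" using K0 K1 K2 by (simp add: K_def)
  define C where "C = K * (exp K + 1) + exp K"
  have C: "C > 0" unfolding C_def using K by (simp add: add_pos_pos)
  show ?thesis
  proof (intro exI[of _ "2 * C"] conjI allI impI, goal_cases)
    case (2 m)
    show ?case
    proof (clarify)
      fix \<kappa> \<eta> assume "(\<kappa>, \<eta>) \<in> Omega2 \<delta>"
      then have pb: "(\<kappa>, \<eta>) \<in> Omega2_hull \<delta>" using Omega_subset(2)[of \<delta>] by auto
      have inT: "((\<kappa>, path2 \<eta> r), rt2 \<kappa> (path2 \<eta> r)) \<in> ?T" if "0 < r" "r < 1" for r
      proof -
        have a: "(\<kappa>, path2 \<eta> r) \<in> T"
          unfolding T_def D_def using that pb by (intro image_eqI[of _ _ "(r, (\<kappa>, \<eta>))"]) auto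
        then have "\<kappa> > 1" using T by auto
        from rt2_square[OF this] a show ?thesis by simp
      qed
      have path: "cmod (path2 \<eta> r) \<le> r * K0" if "0 < r" "r < 1" for r
      proof -
        have "(r, (\<kappa>, \<eta>)) \<in> D" using that pb by (simp add: D_def)
        from K0(2)[OF this] have "r * cmod (\<eta> / (1 - (1 - of_real r) * \<eta>)) \<le> r * K0"
          using that by (intro mult_left_mono) auto
        then show ?thesis using that by (simp add: path2_def norm_divide norm_mult)
      qed
      show "cmod (F2 m \<kappa> \<eta> / wkb2 m \<kappa> \<eta> - 1) \<le> 2 * C / m"
        unfolding C_def
      proof (rule F2_wkb2_estimate[OF K])
        show "2 * (K * (exp K + 1) + exp K) \<le> m" using 2 by (simp add: C_def)
        show "1 < \<kappa>" using Omega_hull_slit(1)[OF \<delta>, of \<kappa> \<eta>] pb by (auto simp: Omega2_hull_def)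
        show "\<eta> \<in> slit_both" by (rule Omega2_hull_slit[OF \<delta> pb])
        fix r :: real assume r: "0 < r" "r < 1"
        have bd: "cmod (path2 \<eta> r * x) \<le> K * r" if "cmod x \<le> K1 + K2" for x
        proof -
          have "cmod (path2 \<eta> r) * cmod x \<le> (r * K0) * (K1 + K2)"
            using path[OF r] that r K0(1) by (intro mult_mono) auto
          then show ?thesis by (simp add: norm_mult K_def mult_ac)
        qed
        show "cmod (path2 \<eta> r * (2 * of_real \<kappa> - 1) / rt2 \<kappa> (path2 \<eta> r)) \<le> K * r"
          unfolding times_divide_eq_right[symmetric]
          by (rule bd) (use K1(2)[OF inT[OF r]] K2(1) in simp)
        show "cmod (path2 \<eta> r * err2 \<kappa> (path2 \<eta> r) (rt2 \<kappa> (path2 \<eta> r))) \<le> K * r"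
          by (rule bd) (use K2(2)[OF inT[OF r]] K1(1) in simp)
      qed
    qed
  qed (use C in simp)
qed

text \<open>The error function must not depend on \<delta>, so it is taken as F/L - 1 everywhere; L
  does not vanish on the parameter sets. Uniformity follows from F/L = (F/W) exp (-\<rho>), where
  \<rho> is the combination of Stirling remainders and both factors tend to 1 uniformly.\<close>

lemma asymptotics_from_wkb:
  fixes F L W :: "real \<Rightarrow> real \<times> complex \<Rightarrow> complex" and \<Omega> :: "real \<Rightarrow> (real \<times> complex) set"
  assumes \<Omega>: "\<And>\<delta> \<kappa> \<eta>. \<delta> > 0 \<Longrightarrow> (\<kappa>, \<eta>) \<in> \<Omega> \<delta> \<Longrightarrow> \<delta> \<le> \<kappa> - 1"
    and L: "\<And>\<delta> m \<kappa> \<eta>. \<delta> > 0 \<Longrightarrow> m > 0 \<Longrightarrow> (\<kappa>, \<eta>) \<in> \<Omega> \<delta> \<Longrightarrow> L m (\<kappa>, \<eta>) =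
       of_real (exp (stirling_rem m + stirling_rem (m * (\<kappa> - 1)) - stirling_rem (m * \<kappa>))) * W m (\<kappa>, \<eta>)"
    and W: "\<And>\<delta> m p. \<delta> > 0 \<Longrightarrow> p \<in> \<Omega> \<delta> \<Longrightarrow> W m p \<noteq> 0"
    and F: "\<And>\<delta>. \<delta> > 0 \<Longrightarrow> \<exists>C>0. \<forall>m\<ge>C. \<forall>p\<in>\<Omega> \<delta>. cmod (F m p / W m p - 1) \<le> C / m"
  shows "\<exists>r. \<forall>\<delta>>0. (\<forall>m>0. \<forall>p\<in>\<Omega> \<delta>. F m p = L m p * (1 + r m p)) \<and> uniform_limit (\<Omega> \<delta>) r (\<lambda>_. 0) at_top"
proof (intro exI[of _ "\<lambda>m p. F m p / L m p - 1"] allI impI conjI ballI)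
  fix \<delta> m :: real and p assume "\<delta> > 0" "m > 0" "p \<in> \<Omega> \<delta>"
  then have "L m p \<noteq> 0" using L[of \<delta> m "fst p" "snd p"] W[of \<delta> p m] by simp
  then show "F m p = L m p * (1 + (F m p / L m p - 1))" by simp
next
  fix \<delta> :: real assume \<delta>: "\<delta> > 0"
  define \<rho> where "\<rho> m p = stirling_rem m + stirling_rem (m * (fst p - 1)) - stirling_rem (m * fst p)"
    for m :: real and p :: "real \<times> complex"
  obtain C where C: "C > 0" "\<And>m p. m \<ge> C \<Longrightarrow> p \<in> \<Omega> \<delta> \<Longrightarrow> cmod (F m p / W m p - 1) \<le> C / m"
    using F[OF \<delta>] by blast
  have lim0: "((\<lambda>m. c / m) \<longlongrightarrow> 0) at_top" for c :: real
    by real_asymp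
  have u1: "uniform_limit (\<Omega> \<delta>) (\<lambda>m p. F m p / W m p) (\<lambda>_. 1) at_top"
  proof (rule uniform_limitI)
    fix e :: real assume "e > 0"
    then have "eventually (\<lambda>m. C / m < e) at_top" using order_tendstoD(2)[OF lim0] by blast
    then show "\<forall>\<^sub>F m in at_top. \<forall>p\<in>\<Omega> \<delta>. dist (F m p / W m p) 1 < e"
      using eventually_ge_at_top[of C]
      by eventually_elim (use C(2) in \<open>fastforce simp: dist_norm\<close>)
  qed
  have u2: "uniform_limit (\<Omega> \<delta>) (\<lambda>m p. complex_of_real (exp (- \<rho> m p))) (\<lambda>_. 1) at_top"
  proof (rule uniform_limitI)
    fix e :: real assume e: "e > 0"
    have "((\<lambda>x::real. exp (- x)) \<longlongrightarrow> exp (- 0)) (at 0)" by (intro tendsto_intros)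
    then obtain d where d: "d > 0" "\<And>x::real. x \<noteq> 0 \<Longrightarrow> \<bar>x\<bar> < d \<Longrightarrow> \<bar>exp (- x) - 1\<bar> < e"
      using e by (auto simp: LIM_def dist_real_def)
    have "eventually (\<lambda>m. (1 + 1 / \<delta>) / m < d) at_top" using order_tendstoD(2)[OF lim0 d(1)] .
    then show "\<forall>\<^sub>F m in at_top. \<forall>p\<in>\<Omega> \<delta>. dist (complex_of_real (exp (- \<rho> m p))) 1 < e"
      using eventually_gt_at_top[of 0]
    proof eventually_elim
      case (elim m)
      show ?case
      proof
        fix p assume "p \<in> \<Omega> \<delta>"
        then have "\<delta> \<le> fst p - 1" using \<Omega>[OF \<delta>, of "fst p" "snd p"] by simp
        from stirling_rem_combination_bound[OF elim(2) this \<delta>] elim(1)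
        have "\<bar>\<rho> m p\<bar> < d" by (simp add: \<rho>_def)
        then have "\<bar>exp (- \<rho> m p) - 1\<bar> < e" using d(2)[of "\<rho> m p"] e by (cases "\<rho> m p = 0") auto
        then show "dist (complex_of_real (exp (- \<rho> m p))) 1 < e"
          using dist_of_real[of "exp (- \<rho> m p)" 1, where ?'a = complex] by (simp add: dist_real_def)
      qed
    qed
  qed
  have "uniform_limit (\<Omega> \<delta>) (\<lambda>m p. F m p / W m p * of_real (exp (- \<rho> m p))) (\<lambda>_. 1 * 1) at_top"
    by (rule uniform_lim_mult[OF u1 u2]) (auto simp: bounded_iff)
  then have "uniform_limit (\<Omega> \<delta>) (\<lambda>m p. F m p / W m p * of_real (exp (- \<rho> m p)) - 1) (\<lambda>_. 1 * 1 - 1) at_top"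
    by (intro uniform_limit_minus uniform_limit_const)
  also have "?this \<longleftrightarrow> uniform_limit (\<Omega> \<delta>) (\<lambda>m p. F m p / L m p - 1) (\<lambda>_. 0) at_top"
  proof (rule uniform_limit_cong)
    show "\<forall>\<^sub>F m in at_top. \<forall>p\<in>\<Omega> \<delta>. F m p / W m p * of_real (exp (- \<rho> m p)) - 1 = F m p / L m p - 1"
      using eventually_gt_at_top[of 0]
    proof eventually_elim
      case (elim m)
      show ?case
      proof
        fix p assume p: "p \<in> \<Omega> \<delta>"
        have "L m p = of_real (exp (\<rho> m p)) * W m p"
          using L[OF \<delta> elim, of "fst p" "snd p"] p by (simp add: \<rho>_def)
        moreover have "complex_of_real (exp (- \<rho> m p)) = 1 / of_real (exp (\<rho> m p))"
          by (simp add: exp_minus divide_inverse)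
        ultimately show "F m p / W m p * of_real (exp (- \<rho> m p)) - 1 = F m p / L m p - 1" by simp
      qed
    qed
  qed simp
  finally show "uniform_limit (\<Omega> \<delta>) (\<lambda>m p. F m p / L m p - 1) (\<lambda>_. 0) at_top" .
qed

theorem lemma3:
  shows "(\<exists>r :: real \<Rightarrow> real \<times> complex \<Rightarrow> complex. \<forall>\<delta>>0.
            (\<forall>m>0. \<forall>(\<kappa>, \<eta>)\<in>Omega1 \<delta>.
               F1 m \<kappa> \<eta> = laplace_main m \<kappa> (phi1 \<kappa> \<eta>) psi1 (t1 \<kappa> \<eta>) * (1 + r m (\<kappa>, \<eta>))) \<and>
            uniform_limit (Omega1 \<delta>) r (\<lambda>_. 0) at_top)
       \<and> (\<exists>r :: real \<Rightarrow> real \<times> complex \<Rightarrow> complex. \<forall>\<delta>>0.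
            (\<forall>m>0. \<forall>(\<kappa>, \<eta>)\<in>Omega2 \<delta>.
               F2 m \<kappa> \<eta> = laplace_main m \<kappa> (phi2 \<kappa> \<eta>) (psi2 \<eta>) (t2 \<kappa> \<eta>) * (1 + r m (\<kappa>, \<eta>))) \<and>
            uniform_limit (Omega2 \<delta>) r (\<lambda>_. 0) at_top)"
proof
  have \<Omega>1: "\<kappa> > 1" "\<eta> \<in> slit_left" "\<eta> \<noteq> 0" "\<delta> \<le> \<kappa> - 1" "Re \<eta> \<ge> 1 - 2 * \<kappa>"
    if "\<delta> > 0" "(\<kappa>, \<eta>) \<in> Omega1 \<delta>" for \<delta> \<kappa> \<eta>
    using Omega_hull_slit[OF that(1), of \<kappa> \<eta>] that(2) Omega_subset(1)[of \<delta>] by (auto simp: Omega1_def)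
  have \<Omega>2: "\<kappa> > 1" "\<eta> \<in> slit_both" "\<eta> \<noteq> 0" "\<delta> \<le> \<kappa> - 1"
    if "\<delta> > 0" "(\<kappa>, \<eta>) \<in> Omega2 \<delta>" for \<delta> \<kappa> \<eta>
  proof -
    have "(\<kappa>, \<eta>) \<in> Omega2_hull \<delta>" using that Omega_subset(2) by blast
    then show "\<kappa> > 1" "\<eta> \<in> slit_both" "\<eta> \<noteq> 0" "\<delta> \<le> \<kappa> - 1"
      using Omega_hull_slit[OF that(1), of \<kappa> \<eta>] Omega2_hull_slit[OF that(1), of \<kappa> \<eta>] by (auto simp: Omega2_hull_def)
  qed
  have "\<exists>r. \<forall>\<delta>>0. (\<forall>m>0. \<forall>p\<in>Omega1 \<delta>. F1 m (fst p) (snd p)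
        = laplace_main m (fst p) (phi1 (fst p) (snd p)) psi1 (t1 (fst p) (snd p)) * (1 + r m p))
      \<and> uniform_limit (Omega1 \<delta>) r (\<lambda>_. 0) at_top"
  proof (rule asymptotics_from_wkb[where W = "\<lambda>m p. wkb1 m (fst p) (snd p)"], goal_cases)
    case (3 \<delta> m p)
    then show ?case using wkb1_nz \<Omega>1[of \<delta> "fst p" "snd p"] by simp
  next
    case (4 \<delta>)
    then show ?case using F1_wkb1_uniform by (simp add: case_prod_beta)
  qed (use \<Omega>1 in \<open>simp_all add: laplace_main_wkb1\<close>)
  then show "\<exists>r :: real \<Rightarrow> real \<times> complex \<Rightarrow> complex. \<forall>\<delta>>0.
            (\<forall>m>0. \<forall>(\<kappa>, \<eta>)\<in>Omega1 \<delta>.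
               F1 m \<kappa> \<eta> = laplace_main m \<kappa> (phi1 \<kappa> \<eta>) psi1 (t1 \<kappa> \<eta>) * (1 + r m (\<kappa>, \<eta>))) \<and>
            uniform_limit (Omega1 \<delta>) r (\<lambda>_. 0) at_top"
    by (simp add: case_prod_beta)
  have "\<exists>r. \<forall>\<delta>>0. (\<forall>m>0. \<forall>p\<in>Omega2 \<delta>. F2 m (fst p) (snd p)
        = laplace_main m (fst p) (phi2 (fst p) (snd p)) (psi2 (snd p)) (t2 (fst p) (snd p)) * (1 + r m p))
      \<and> uniform_limit (Omega2 \<delta>) r (\<lambda>_. 0) at_top"
  proof (rule asymptotics_from_wkb[where W = "\<lambda>m p. wkb2 m (fst p) (snd p)"], goal_cases)
    case (3 \<delta> m p)
    then show ?case using wkb2_nz \<Omega>2[of \<delta> "fst p" "snd p"] by simp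
  next
    case (4 \<delta>)
    then show ?case using F2_wkb2_uniform by (simp add: case_prod_beta)
  qed (use \<Omega>2 in \<open>simp_all add: laplace_main_wkb2\<close>)
  then show "\<exists>r :: real \<Rightarrow> real \<times> complex \<Rightarrow> complex. \<forall>\<delta>>0.
            (\<forall>m>0. \<forall>(\<kappa>, \<eta>)\<in>Omega2 \<delta>.
               F2 m \<kappa> \<eta> = laplace_main m \<kappa> (phi2 \<kappa> \<eta>) (psi2 \<eta>) (t2 \<kappa> \<eta>) * (1 + r m (\<kappa>, \<eta>))) \<and>
            uniform_limit (Omega2 \<delta>) r (\<lambda>_. 0) at_top"
    by (simp add: case_prod_beta)
qed

end
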